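(* Let $n\ge 4$. There exists a sequence $(\theta_m)_{m\ge1}$ of positive numbers such that the following hold. (Choice of $\theta_m$.) For every $k\ge1$, let $D_k=Q_1^+\setminus\bigcup_{m=1}^{k}V_{\frac{1}{4^m}e_1,\theta_m}$ and let $u^k$ be the solution of $\Delta u^k=0$ in $D_k$, $u^k=g^k$ on $\partial D_k$, where $g^k\equiv0$ on $\partial D_k\cap Q_1^+$ and $g^k\equiv x_n$ on $\partial D_k\setminus Q_1^+$. Then $$\frac{\partial u^k}{\partial x_n}\ge 1-\sum_{m=1}^{k}\frac{1}{4^m}\quad\text{on } K_1=\{y:\ y'=0,\ 0\le y_n\le 1/2\}.$$ (Conclusion.) Let $$\Omega=Q_1^+\setminus\left(\bigcup_{m=1}^{\infty}V_{\frac{1}{4^m}e_1,\theta_m}\right),$$ let $g\equiv0$ on $\partial\Omega\cap Q_1^+$ and $g\equiv x_n$ on $\partial\Omega\setminus Q_1^+$, and let $u$ be the solution of $\Delta u=0$ in $\Omega$, $u=g$ on $\partial\Omega$. Then $u$ is not differentiable at $0$.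
   Context: Notation: points of $\mathbb{R}^n$ are written $x=(x',x_n)$ with $x'\in\mathbb{R}^{n-1}$, $x_n\in\mathbb{R}$; $e_1,\dots,e_n$ is the standard basis; $\mathbb{R}^n_+=\{x\in\mathbb{R}^n:x_n>0\}$; $Q_1=\{x:-1<x_i<1,\ 1\le i\le n\}$ and $Q_1^+=Q_1\cap\mathbb{R}^n_+$. For $x\in\mathbb{R}^n$ and $\theta>0$, $$\tilde V_{x,\theta}=\{y:\ \theta(y_n-x_n)\le-|y'-x'|\},\qquad V_{x,\theta}=|x|e_n+\tilde V_{x,\theta}.$$ Thus $V_{x,\theta}$ is the downward-opening cone with vertex $x+|x|e_n$. Solutions of the Dirichlet problems are continuous up to the boundary. At a boundary point $x_0\in\partial\Omega$, "$u$ is differentiable at $x_0$" means that there exists a vector $\xi$ such that $u(x)=u(x_0)+\xi\cdot(x-x_0)+o(|x-x_0|)$ for $x\in\bar\Omega$. *)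

theory Defs
  imports "HOL-Analysis.Analysis" "HOL-Library.Landau_Symbols"
begin

text \<open>
  Points of \<open>n\<close>-dimensional space are vectors indexed by an arbitrary finite type.  Throughout, \<open>l\<close>
  is the index playing the role of the last coordinate \<open>x_n\<close>, so that \<open>axis l 1\<close> is \<open>e_n\<close>.
\<close>

definition tangential :: "'n::finite \<Rightarrow> real ^ 'n \<Rightarrow> real ^ 'n"
  \<comment> \<open>the part \<open>x'\<close> of \<open>x = (x', x_n)\<close>, kept in the full space as \<open>(x', 0)\<close>\<close>
  where "tangential l x = (\<chi> i. if i = l then 0 else x $ i)"

definition upper_half_space :: "'n::finite \<Rightarrow> (real ^ 'n) set"
  where "upper_half_space l = {x. x $ l > 0}"

definition Q1 :: "(real ^ 'n::finite) set"
  where "Q1 = {x. \<forall>i. -1 < x $ i \<and> x $ i < 1}"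

definition Q1_plus :: "'n::finite \<Rightarrow> (real ^ 'n) set"
  where "Q1_plus l = Q1 \<inter> upper_half_space l"

definition V_tilde :: "'n::finite \<Rightarrow> real ^ 'n \<Rightarrow> real \<Rightarrow> (real ^ 'n) set"
  where "V_tilde l x \<theta> =
    {y. \<theta> * (y $ l - x $ l) \<le> - norm (tangential l y - tangential l x)}"

definition V :: "'n::finite \<Rightarrow> real ^ 'n \<Rightarrow> real \<Rightarrow> (real ^ 'n) set"
  where "V l x \<theta> = (\<lambda>y. norm x *\<^sub>R axis l 1 + y) ` V_tilde l x \<theta>"

definition K1 :: "'n::finite \<Rightarrow> (real ^ 'n) set"
  where "K1 l = {y. tangential l y = 0 \<and> 0 \<le> y $ l \<and> y $ l \<le> 1 / 2}"

definition boundary_data :: "'n::finite \<Rightarrow> real ^ 'n \<Rightarrow> real"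
  where "boundary_data l x = (if x \<in> Q1_plus l then 0 else x $ l)"


definition partial_deriv :: "'n::finite \<Rightarrow> (real ^ 'n \<Rightarrow> real) \<Rightarrow> real ^ 'n \<Rightarrow> real"
  where "partial_deriv i f x = deriv (\<lambda>t. f (x + t *\<^sub>R axis i 1)) 0"

definition C1_on :: "(real ^ 'n::finite) set \<Rightarrow> (real ^ 'n \<Rightarrow> real) \<Rightarrow> bool"
  \<comment> \<open>intended for open \<open>D\<close>\<close>
  where "C1_on D f \<longleftrightarrow> continuous_on D f \<and>
    (\<forall>i. (\<forall>x\<in>D. (\<lambda>t. f (x + t *\<^sub>R axis i 1)) field_differentiable (at 0)) \<and>
         continuous_on D (partial_deriv i f))"

definition C2_on :: "(real ^ 'n::finite) set \<Rightarrow> (real ^ 'n \<Rightarrow> real) \<Rightarrow> bool"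
  where "C2_on D f \<longleftrightarrow> C1_on D f \<and> (\<forall>i. C1_on D (partial_deriv i f))"

definition laplacian :: "(real ^ 'n::finite \<Rightarrow> real) \<Rightarrow> real ^ 'n \<Rightarrow> real"
  where "laplacian f x = (\<Sum>i\<in>UNIV. partial_deriv i (partial_deriv i f) x)"

definition dirichlet_solution ::
    "(real ^ 'n::finite) set \<Rightarrow> (real ^ 'n \<Rightarrow> real) \<Rightarrow> (real ^ 'n \<Rightarrow> real) \<Rightarrow> bool"
  where "dirichlet_solution D g u \<longleftrightarrow>
    continuous_on (closure D) u \<and>
    C2_on D u \<and> (\<forall>x\<in>D. laplacian u x = 0) \<and>
    (\<forall>x\<in>frontier D. u x = g x)"

definition the_dirichlet_solution ::
    "(real ^ 'n::finite) set \<Rightarrow> (real ^ 'n \<Rightarrow> real) \<Rightarrow> (real ^ 'n \<Rightarrow> real) \<Rightarrow> bool"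
  \<comment> \<open>uniqueness can only be required on \<open>closure D\<close>, as values elsewhere are arbitrary\<close>
  where "the_dirichlet_solution D g u \<longleftrightarrow>
    dirichlet_solution D g u \<and>
    (\<forall>v. dirichlet_solution D g v \<longrightarrow> (\<forall>x\<in>closure D. v x = u x))"


text \<open>
  The partial derivative at a point of \<open>closure D\<close> of a function that is only meaningful on
  \<open>closure D\<close>.  At interior points this is the usual two-sided derivative, and where the line
  through \<open>x\<close> meets \<open>closure D\<close> on one side only it is the one-sided derivative.  The
  limit point condition keeps the derivative from being vacuously arbitrary.
\<close>

definition has_partial_deriv_upto ::
    "(real ^ 'n::finite) set \<Rightarrow> 'n \<Rightarrow> (real ^ 'n \<Rightarrow> real) \<Rightarrow> real ^ 'n \<Rightarrow> real \<Rightarrow> bool"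
  where "has_partial_deriv_upto D i u x d \<longleftrightarrow>
    (let T = {t. x + t *\<^sub>R axis i 1 \<in> closure D} in
       x \<in> closure D \<and> 0 islimpt T \<and>
       ((\<lambda>t. u (x + t *\<^sub>R axis i 1)) has_real_derivative d) (at 0 within T))"

definition boundary_differentiable ::
    "(real ^ 'n::finite) set \<Rightarrow> (real ^ 'n \<Rightarrow> real) \<Rightarrow> real ^ 'n \<Rightarrow> bool"
  where "boundary_differentiable D u x0 \<longleftrightarrow>
    (\<exists>\<xi>. (\<lambda>x. u x - (u x0 + \<xi> \<bullet> (x - x0))) \<in> o[at x0 within closure D](\<lambda>x. norm (x - x0)))"

end

theory Submission
  imports Defs
begin

text \<open>
  Everything rests on the maximum principle; no integration is used.  If \<open>r = |x' - a'|\<close> is the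
  distance to the axis of a spike of radius \<open>\<rho>\<close>, then \<open>x\<^sub>l \<rho> / r\<close> is superharmonic in dimension at
  least four and dominates \<open>x\<^sub>l\<close> on the spike.  Hence inserting the \<open>k\<close>-th spike lowers the solution
  by at most a multiple of \<open>x\<^sub>l \<rho>\<^sub>k / r\<^sub>k\<close>, and an interior gradient estimate turns this into the bound
  \<open>4\<^sup>-\<^sup>k\<close> for the change of the normal derivative on the axis, provided \<open>\<theta>\<^sub>k\<close> is a small multiple of
  \<open>16\<^sup>-\<^sup>k\<close>.  In the limit domain \<open>u (t e\<^sub>l) \<ge> 3 t / 4\<close>, while \<open>u\<close> vanishes at the tips
  \<open>4\<^sup>-\<^sup>m (e\<^sub>f + e\<^sub>l)\<close> and on the negative \<open>f\<close>-axis, which no linear function can match.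

  The solutions come from Perron's method.  Dirichlet problems on balls are solved by harmonic
  polynomials: a polynomial agrees on a sphere with a harmonic one, and polynomials are dense.
  Tips and sides of the spikes are regular because of an explicit barrier for the exterior cone.
\<close>

section \<open>Maximum principle and gradient estimate\<close>

text \<open>What the k-th spike may cost is decided on small balls around the points t e_l of
  \<open>K1\<close>. Such a ball has to avoid both the bottom and the spike, so its radius is about
  the smaller of t and q = 4^-k. The spike has radius \<theta> q at its base and lies about q away,
  so the barrier is about \<theta> times the height, and the gradient estimate divides by the radius
  of the ball. For t not small this gives n^2 \<theta> / q, which must be at most q: hence an
  aperture of order q^2 / n^2. For small t the radius is of order t, and the factor x_l of the
  barrier compensates for that. The lower end of \<open>K1\<close> lies on the boundary, where
  interior estimates say nothing and even the existence of the one-sided derivative has to be shown.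
  With finitely many spikes the boundary is flat near 0, so an odd reflection gives existence; the
  value follows from u(t e_l) >= 3t/4 alone, because the claimed bound is at most 3/4 for k >=
  1.\<close>

definition has_lap :: "(real ^ 'n::finite \<Rightarrow> real) \<Rightarrow> real ^ 'n \<Rightarrow> real ^ 'n \<Rightarrow> real \<Rightarrow> bool"
  \<comment> \<open>\<open>g\<close> is the gradient and \<open>L\<close> the Laplacian of \<open>w\<close> at \<open>x\<close>; only the restrictions of \<open>w\<close> to
    coordinate lines need to be differentiable\<close>
  where "has_lap w x g L \<longleftrightarrow> (\<exists>G H.
    (\<forall>i. (\<forall>\<^sub>F t in nhds 0. ((\<lambda>t. w (x + t *\<^sub>R axis i 1)) has_real_derivative G i t) (at t)) \<and>
         G i 0 = g $ i \<and> (G i has_real_derivative H i) (at 0)) \<and>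
    L = (\<Sum>i\<in>UNIV. H i))"

lemma has_lapI:
  assumes "\<And>i. \<forall>\<^sub>F t in nhds 0. ((\<lambda>t. w (x + t *\<^sub>R axis i 1)) has_real_derivative G i t) (at t)"
    and "\<And>i. G i 0 = g $ i"
    and "\<And>i. (G i has_real_derivative H i) (at 0)"
    and "L = (\<Sum>i\<in>UNIV. H i)"
  shows "has_lap w x g L"
  unfolding has_lap_def using assms by blast

lemma has_lapE:
  assumes "has_lap w x g L"
  obtains G H where
    "\<And>i. \<forall>\<^sub>F t in nhds 0. ((\<lambda>t. w (x + t *\<^sub>R axis i 1)) has_real_derivative G i t) (at t)"
    "\<And>i. G i 0 = g $ i"
    "\<And>i. (G i has_real_derivative H i) (at 0)"
    "L = (\<Sum>i\<in>UNIV. H i)"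
  using assms unfolding has_lap_def by blast

lemma has_lap_eq:
  assumes "has_lap w x g L" "g = g'" "L = L'"
  shows "has_lap w x g' L'"
  using assms by simp

lemma has_lap_line_deriv:
  assumes "has_lap w x g L"
  shows "((\<lambda>t. w (x + t *\<^sub>R axis i 1)) has_real_derivative g $ i) (at 0)"
  using assms by (elim has_lapE) (metis eventually_nhds_x_imp_x)

lemma has_lap_const: "has_lap (\<lambda>x. c) x 0 0"
  by (rule has_lapI[where G="\<lambda>i t. 0" and H="\<lambda>i. 0"]) auto

lemma has_lap_coord: "has_lap (\<lambda>x. x $ j) x (axis j 1) 0"
proof (rule has_lapI[where G="\<lambda>i t. axis i 1 $ j" and H="\<lambda>i. 0"])
  fix i
  show "\<forall>\<^sub>F t in nhds 0. ((\<lambda>t. (x + t *\<^sub>R axis i 1) $ j) has_real_derivative axis i 1 $ j) (at t)"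
    by (rule always_eventually) (auto intro!: derivative_eq_intros)
qed (auto simp: axis_def)

lemma has_lap_add:
  assumes "has_lap u x g L" "has_lap v x h M"
  shows "has_lap (\<lambda>x. u x + v x) x (g + h) (L + M)"
proof -
  from assms(1) obtain G H where 1:
    "\<And>i. \<forall>\<^sub>F t in nhds 0. ((\<lambda>t. u (x + t *\<^sub>R axis i 1)) has_real_derivative G i t) (at t)"
    "\<And>i. G i 0 = g $ i" "\<And>i. (G i has_real_derivative H i) (at 0)" "L = (\<Sum>i\<in>UNIV. H i)"
    by (elim has_lapE) blast
  from assms(2) obtain G' H' where 2:
    "\<And>i. \<forall>\<^sub>F t in nhds 0. ((\<lambda>t. v (x + t *\<^sub>R axis i 1)) has_real_derivative G' i t) (at t)"
    "\<And>i. G' i 0 = h $ i" "\<And>i. (G' i has_real_derivative H' i) (at 0)" "M = (\<Sum>i\<in>UNIV. H' i)"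
    by (elim has_lapE) blast
  show ?thesis
  proof (rule has_lapI[where G="\<lambda>i t. G i t + G' i t" and H="\<lambda>i. H i + H' i"])
    show "\<forall>\<^sub>F t in nhds 0. ((\<lambda>t. u (x + t *\<^sub>R axis i 1) + v (x + t *\<^sub>R axis i 1))
        has_real_derivative G i t + G' i t) (at t)" for i
      using 1(1)[of i] 2(1)[of i] by eventually_elim (rule DERIV_add)
    show "((\<lambda>t. G i t + G' i t) has_real_derivative H i + H' i) (at 0)" for i
      using 1(3) 2(3) by (rule DERIV_add)
  qed (use 1 2 in \<open>auto simp: sum.distrib\<close>)
qed

lemma has_lap_mult:
  assumes "has_lap u x g L" "has_lap v x h M"
  shows "has_lap (\<lambda>x. u x * v x) x (v x *\<^sub>R g + u x *\<^sub>R h) (v x * L + u x * M + 2 * (g \<bullet> h))"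
proof -
  from assms(1) obtain G H where 1:
    "\<And>i. \<forall>\<^sub>F t in nhds 0. ((\<lambda>t. u (x + t *\<^sub>R axis i 1)) has_real_derivative G i t) (at t)"
    "\<And>i. G i 0 = g $ i" "\<And>i. (G i has_real_derivative H i) (at 0)" "L = (\<Sum>i\<in>UNIV. H i)"
    by (elim has_lapE) blast
  from assms(2) obtain G' H' where 2:
    "\<And>i. \<forall>\<^sub>F t in nhds 0. ((\<lambda>t. v (x + t *\<^sub>R axis i 1)) has_real_derivative G' i t) (at t)"
    "\<And>i. G' i 0 = h $ i" "\<And>i. (G' i has_real_derivative H' i) (at 0)" "M = (\<Sum>i\<in>UNIV. H' i)"
    by (elim has_lapE) blast
  note d1 = has_lap_line_deriv[OF assms(1)] and d2 = has_lap_line_deriv[OF assms(2)]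
  show ?thesis
  proof (rule has_lapI[where G="\<lambda>i t. G i t * v (x + t *\<^sub>R axis i 1) + G' i t * u (x + t *\<^sub>R axis i 1)"
        and H="\<lambda>i. (H i * v x + h $ i * g $ i) + (H' i * u x + g $ i * h $ i)"])
    show "\<forall>\<^sub>F t in nhds 0. ((\<lambda>t. u (x + t *\<^sub>R axis i 1) * v (x + t *\<^sub>R axis i 1))
        has_real_derivative G i t * v (x + t *\<^sub>R axis i 1) + G' i t * u (x + t *\<^sub>R axis i 1)) (at t)" for i
      using 1(1)[of i] 2(1)[of i] by eventually_elim (rule DERIV_mult)
    show "((\<lambda>t. G i t * v (x + t *\<^sub>R axis i 1) + G' i t * u (x + t *\<^sub>R axis i 1)) has_real_derivative
        (H i * v x + h $ i * g $ i) + (H' i * u x + g $ i * h $ i)) (at 0)" for i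
      using DERIV_add[OF DERIV_mult[OF 1(3)[of i] d2[of i]] DERIV_mult[OF 2(3)[of i] d1[of i]]]
      by (simp add: 1(2) 2(2))
  qed (use 1 2 in \<open>auto simp: sum.distrib inner_vec_def sum_distrib_left algebra_simps\<close>)
qed

lemma has_lap_cmult:
  assumes "has_lap u x g L"
  shows "has_lap (\<lambda>x. c * u x) x (c *\<^sub>R g) (c * L)"
  using has_lap_mult[OF has_lap_const[of c] assms] by simp

lemma has_lap_uminus:
  assumes "has_lap u x g L"
  shows "has_lap (\<lambda>x. - u x) x (- g) (- L)"
  using has_lap_cmult[OF assms, of "-1"] by simp

lemma has_lap_diff:
  assumes "has_lap u x g L" "has_lap v x h M"
  shows "has_lap (\<lambda>x. u x - v x) x (g - h) (L - M)"
  using has_lap_add[OF assms(1) has_lap_uminus[OF assms(2)]] by simp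

lemma has_lap_sum:
  assumes "\<And>j. j \<in> J \<Longrightarrow> has_lap (u j) x (g j) (L j)"
  shows "has_lap (\<lambda>x. \<Sum>j\<in>J. u j x) x (\<Sum>j\<in>J. g j) (\<Sum>j\<in>J. L j)"
  using assms
proof (induction J rule: infinite_finite_induct)
  case (insert j J)
  then show ?case using has_lap_add[of "u j" x "g j" "L j"] by simp
qed (auto intro: has_lap_const)

lemma tendsto_coord_line: "((\<lambda>t. (x::real^'n::finite) + t *\<^sub>R axis i 1) \<longlongrightarrow> x) (nhds (0::real))"
proof -
  have "isCont (\<lambda>t. x + t *\<^sub>R axis i (1::real)) (0::real)" by (intro continuous_intros)
  then show ?thesis by (simp add: continuous_at tendsto_nhds_iff)
qed

lemma has_lap_chain:
  assumes "has_lap w x g L"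
    and F: "\<forall>\<^sub>F s in nhds (w x). (F has_real_derivative F' s) (at s)"
    and F': "(F' has_real_derivative F'') (at (w x))"
  shows "has_lap (\<lambda>x. F (w x)) x (F' (w x) *\<^sub>R g) (F'' * (g \<bullet> g) + F' (w x) * L)"
proof -
  from assms(1) obtain G H where 1:
    "\<And>i. \<forall>\<^sub>F t in nhds 0. ((\<lambda>t. w (x + t *\<^sub>R axis i 1)) has_real_derivative G i t) (at t)"
    "\<And>i. G i 0 = g $ i" "\<And>i. (G i has_real_derivative H i) (at 0)" "L = (\<Sum>i\<in>UNIV. H i)"
    by (elim has_lapE) blast
  note d = has_lap_line_deriv[OF assms(1)]
  show ?thesis
  proof (rule has_lapI[where G="\<lambda>i t. F' (w (x + t *\<^sub>R axis i 1)) * G i t"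
        and H="\<lambda>i. F'' * g $ i * g $ i + H i * F' (w x)"])
    fix i
    have "isCont (\<lambda>t. w (x + t *\<^sub>R axis i 1)) 0"
      using d[of i] DERIV_isCont by blast
    then have "((\<lambda>t. w (x + t *\<^sub>R axis i 1)) \<longlongrightarrow> w x) (nhds 0)"
      by (simp add: continuous_at tendsto_nhds_iff)
    then have "\<forall>\<^sub>F t in nhds 0. (F has_real_derivative F' (w (x + t *\<^sub>R axis i 1))) (at (w (x + t *\<^sub>R axis i 1)))"
      using F unfolding filterlim_iff by blast
    then show "\<forall>\<^sub>F t in nhds 0. ((\<lambda>t. F (w (x + t *\<^sub>R axis i 1)))
        has_real_derivative F' (w (x + t *\<^sub>R axis i 1)) * G i t) (at t)"
      using 1(1)[of i]
      by eventually_elim (rule DERIV_chain2)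
    have "((\<lambda>t. F' (w (x + t *\<^sub>R axis i 1))) has_real_derivative F'' * g $ i) (at 0)"
      by (rule DERIV_chain2[OF _ d]) (use F' in simp)
    from DERIV_mult[OF this 1(3)[of i]]
    show "((\<lambda>t. F' (w (x + t *\<^sub>R axis i 1)) * G i t) has_real_derivative F'' * g $ i * g $ i + H i * F' (w x)) (at 0)"
      by (simp add: 1(2))
  qed (use 1 in \<open>auto simp: sum.distrib inner_vec_def sum_distrib_left algebra_simps\<close>)
qed

lemma has_lap_imp_derivs:
  assumes "has_lap w x g L"
  shows "partial_deriv i w x = g $ i" and "laplacian w x = L"
proof -
  from assms obtain G H where 1:
    "\<And>i. \<forall>\<^sub>F t in nhds 0. ((\<lambda>t. w (x + t *\<^sub>R axis i 1)) has_real_derivative G i t) (at t)"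
    "\<And>i. G i 0 = g $ i" "\<And>i. (G i has_real_derivative H i) (at 0)" "L = (\<Sum>i\<in>UNIV. H i)"
    by (elim has_lapE) blast
  show "partial_deriv i w x = g $ i"
    unfolding partial_deriv_def by (rule DERIV_imp_deriv[OF has_lap_line_deriv[OF assms]])
  have "partial_deriv i (partial_deriv i w) x = H i" for i
  proof -
    have "\<forall>\<^sub>F t in nhds 0. partial_deriv i w (x + t *\<^sub>R axis i 1) = G i t"
      using 1(1)[of i]
    proof eventually_elim
      case (elim t)
      have "((\<lambda>s. w (x + (s + t) *\<^sub>R axis i 1)) has_real_derivative G i t) (at 0)"
        using elim DERIV_shift[of "\<lambda>t. w (x + t *\<^sub>R axis i 1)" "G i t" 0 t] by (simp add: add.commute)
      then show ?case unfolding partial_deriv_def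
        by (intro DERIV_imp_deriv) (simp add: scaleR_add_left algebra_simps)
    qed
    then have "((\<lambda>t. partial_deriv i w (x + t *\<^sub>R axis i 1)) has_real_derivative H i) (at 0)"
      using 1(3)[of i] by (subst DERIV_cong_ev[OF refl _ refl, where g="G i"])
    then show ?thesis
      unfolding partial_deriv_def[of i "partial_deriv i w"] by (rule DERIV_imp_deriv)
  qed
  then show "laplacian w x = L" unfolding laplacian_def 1(4) by simp
qed

lemma line_deriv_shift:
  assumes "(\<lambda>s. w ((x + t *\<^sub>R axis i 1) + s *\<^sub>R axis i 1)) field_differentiable (at 0)"
  shows "((\<lambda>t. w (x + t *\<^sub>R axis i 1)) has_real_derivative partial_deriv i w (x + t *\<^sub>R axis i 1)) (at t)"
proof -
  have "((\<lambda>s. w ((x + t *\<^sub>R axis i 1) + s *\<^sub>R axis i 1)) has_real_derivative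
      partial_deriv i w (x + t *\<^sub>R axis i 1)) (at 0)"
    using assms unfolding partial_deriv_def by (simp add: field_differentiable_derivI)
  then show ?thesis
    using DERIV_shift[of "\<lambda>t. w (x + t *\<^sub>R axis i 1)" _ 0 t]
    by (simp add: scaleR_add_left algebra_simps)
qed

text \<open>Entry point for solutions: openness of \<open>D\<close> keeps a piece of each coordinate
  line through \<open>x\<close> inside \<open>D\<close>, where \<open>partial_deriv\<close> serves
  as the derivative \<open>G\<close>.\<close>

lemma C2_on_has_lap:
  assumes "C2_on D w" "open D" "x \<in> D"
  shows "has_lap w x (\<chi> i. partial_deriv i w x) (laplacian w x)"
proof (rule has_lapI[where G="\<lambda>i t. partial_deriv i w (x + t *\<^sub>R axis i 1)"
      and H="\<lambda>i. partial_deriv i (partial_deriv i w) x"])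
  fix i
  have "\<forall>\<^sub>F t in nhds (0::real). x + t *\<^sub>R axis i 1 \<in> D"
    using tendsto_coord_line assms(2,3) by (rule topological_tendstoD)
  then show "\<forall>\<^sub>F t in nhds 0. ((\<lambda>t. w (x + t *\<^sub>R axis i 1)) has_real_derivative
      partial_deriv i w (x + t *\<^sub>R axis i 1)) (at t)"
    by eventually_elim (use assms in \<open>auto intro!: line_deriv_shift simp: C2_on_def C1_on_def\<close>)
  show "((\<lambda>t. partial_deriv i w (x + t *\<^sub>R axis i 1)) has_real_derivative
      partial_deriv i (partial_deriv i w) x) (at 0)"
    using line_deriv_shift[of "partial_deriv i w" x 0 i] assms by (auto simp: C2_on_def C1_on_def)
qed (auto simp: laplacian_def)

text \<open>If \<open>H\<close> were positive, \<open>G\<close> would vanish at 0 and be positive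
  just to the right, so \<open>f\<close> would increase strictly away from its maximum.\<close>

lemma second_deriv_nonpos_at_max:
  fixes f :: "real \<Rightarrow> real"
  assumes f: "\<forall>\<^sub>F t in nhds 0. (f has_real_derivative G t) (at t)"
    and G: "(G has_real_derivative H) (at 0)"
    and max: "\<forall>\<^sub>F t in nhds 0. f t \<le> f 0"
  shows "H \<le> 0"
proof (rule ccontr)
  assume "\<not> H \<le> 0"
  then have "H > 0" by simp
  from f max have "\<forall>\<^sub>F t in nhds 0. (f has_real_derivative G t) (at t) \<and> f t \<le> f 0"
    by eventually_elim simp
  then obtain d where "d > 0" and d: "\<And>t. \<bar>t\<bar> < d \<Longrightarrow> (f has_real_derivative G t) (at t)"
      "\<And>t. \<bar>t\<bar> < d \<Longrightarrow> f t \<le> f 0"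
    unfolding eventually_nhds_metric dist_real_def by (metis diff_zero)
  have "G 0 = 0"
    by (rule DERIV_local_max[where f=f and x=0 and d=d]) (use d \<open>d > 0\<close> in auto)
  from DERIV_pos_inc_right[OF G \<open>H > 0\<close>] \<open>G 0 = 0\<close> obtain e where "e > 0"
    and e: "\<And>h. 0 < h \<Longrightarrow> h < e \<Longrightarrow> G h > 0" by auto
  define s where "s = min d e / 2"
  have s: "0 < s" "s < d" "s < e" using \<open>d > 0\<close> \<open>e > 0\<close> by (auto simp: s_def min_def)
  have "f 0 < f s"
  proof (rule DERIV_pos_imp_increasing_open[OF s(1)])
    show "\<And>t. 0 < t \<Longrightarrow> t < s \<Longrightarrow> \<exists>y. (f has_real_derivative y) (at t) \<and> 0 < y"
      using d(1) e s by (metis abs_of_pos less_trans)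
    have "\<And>t. 0 \<le> t \<Longrightarrow> t \<le> s \<Longrightarrow> isCont f t"
      using DERIV_isCont[OF d(1)] s by auto
    then show "continuous_on {0..s} f" by (intro continuous_at_imp_continuous_on) auto
  qed
  with d(2)[of s] s show False by auto
qed

lemma has_lap_normsq: "has_lap (\<lambda>x::real^'n::finite. (x - a) \<bullet> (x - a)) x (2 *\<^sub>R (x - a)) (2 * CARD('n))"
proof -
  have "has_lap (\<lambda>x::real^'n. \<Sum>i\<in>UNIV. (x $ i - a $ i) * (x $ i - a $ i)) x
     (\<Sum>i\<in>UNIV. (x $ i - a $ i) *\<^sub>R axis i 1 + (x $ i - a $ i) *\<^sub>R axis i 1) (\<Sum>i\<in>(UNIV::'n set). 2)"
  proof (rule has_lap_sum)
    fix i
    have "has_lap (\<lambda>x. x $ i - a $ i) x (axis i 1) 0"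
      using has_lap_diff[OF has_lap_coord has_lap_const] by simp
    from has_lap_mult[OF this this]
    show "has_lap (\<lambda>x. (x $ i - a $ i) * (x $ i - a $ i)) x
       ((x $ i - a $ i) *\<^sub>R axis i 1 + (x $ i - a $ i) *\<^sub>R axis i 1) 2"
      by (simp add: inner_axis_axis)
  qed
  moreover have "(\<Sum>i\<in>UNIV. (x $ i - a $ i) *\<^sub>R axis i 1 + (x $ i - a $ i) *\<^sub>R axis i 1) = 2 *\<^sub>R (x - a)"
    by (simp add: vec_eq_iff axis_def if_distrib[where f="\<lambda>z. _ * z"] cong: if_cong)
  ultimately show ?thesis
    by (simp add: inner_vec_def mult.commute)
qed

text \<open>Adding e |y|^2 makes the Laplacian strictly positive, and the second derivative test on
  each coordinate line then forbids an interior maximum.\<close>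

lemma maximum_principle:
  fixes w :: "real ^ 'n::finite \<Rightarrow> real"
  assumes "open D" "bounded D" and cont: "continuous_on (closure D) w"
    and sub: "\<And>x. x \<in> D \<Longrightarrow> \<exists>g L. has_lap w x g L \<and> L \<ge> 0"
    and bd: "\<And>x. x \<in> frontier D \<Longrightarrow> w x \<le> 0"
    and x: "x \<in> closure D"
  shows "w x \<le> 0"
proof (rule ccontr)
  assume "\<not> w x \<le> 0"
  have "bounded (closure D)" using assms by auto
  then obtain B where B: "\<And>y. y \<in> closure D \<Longrightarrow> norm y \<le> B" by (auto simp: bounded_iff)
  \<comment> \<open>Small enough that the perturbation, at most e B^2 on the closure, stays below
    \<open>w x\<close>. A maximum point of \<open>v\<close> then has \<open>w z > 0\<close> and
    cannot lie on the frontier.\<close>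
  define e where "e = w x / (2 * (B\<^sup>2 + 1))"
  have "e > 0" using \<open>\<not> w x \<le> 0\<close> unfolding e_def
    by (metis add_nonneg_pos divide_pos_pos mult_pos_pos not_le zero_le_power2 zero_less_numeral zero_less_one)
  have eB: "e * B\<^sup>2 < w x"
  proof -
    have "e * (B\<^sup>2 + 1) = w x / 2" unfolding e_def
      by (metis (no_types, lifting) add_nonneg_pos less_irrefl mult.commute nonzero_divide_mult_cancel_left
          times_divide_eq_right zero_le_power2 zero_less_one divide_divide_eq_left' nonzero_mult_div_cancel_right)
    then show ?thesis using \<open>e > 0\<close> \<open>\<not> w x \<le> 0\<close> by (simp add: algebra_simps)
  qed
  define v where "v y = w y + e * (y \<bullet> y)" for y
  have "continuous_on (closure D) v" unfolding v_def by (intro continuous_intros cont)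
  moreover have "compact (closure D)" using assms by auto
  ultimately have "\<exists>z\<in>closure D. \<forall>y\<in>closure D. v y \<le> v z"
    using x by (intro continuous_attains_sup) auto
  then obtain z where z: "z \<in> closure D" "\<And>y. y \<in> closure D \<Longrightarrow> v y \<le> v z"
    by blast
  have "w x \<le> v x" unfolding v_def using \<open>e > 0\<close> by auto
  then have vz: "w x \<le> v z" using z(2)[OF x] by simp
  have "z \<bullet> z \<le> B\<^sup>2" using B[OF z(1)] by (metis norm_ge_zero power2_norm_eq_inner power_mono)
  then have "v z \<le> w z + e * B\<^sup>2" unfolding v_def using \<open>e > 0\<close> by simp
  then have "w z > 0" using vz eB by linarith
  then have "z \<in> D" using bd z(1) \<open>open D\<close> by (fastforce simp: frontier_def interior_open)
  from sub[OF this] obtain g L where gL: "has_lap w z g L" "L \<ge> 0" by blast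
  have "has_lap v z (g + e *\<^sub>R (2 *\<^sub>R (z - 0))) (L + e * (2 * CARD('n)))"
    unfolding v_def using has_lap_add[OF gL(1) has_lap_cmult[OF has_lap_normsq[of 0 z]]] by simp
  then obtain G H where 1:
    "\<And>i. \<forall>\<^sub>F t in nhds 0. ((\<lambda>t. v (z + t *\<^sub>R axis i 1)) has_real_derivative G i t) (at t)"
    "\<And>i. (G i has_real_derivative H i) (at 0)" "L + e * (2 * CARD('n)) = (\<Sum>i\<in>UNIV. H i)"
    by (elim has_lapE) blast
  have "H i \<le> 0" for i
  proof (rule second_deriv_nonpos_at_max[OF 1(1) 1(2)])
    have "\<forall>\<^sub>F t in nhds (0::real). z + t *\<^sub>R axis i 1 \<in> D"
      using tendsto_coord_line \<open>open D\<close> \<open>z \<in> D\<close> by (rule topological_tendstoD)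
    then show "\<forall>\<^sub>F t in nhds 0. v (z + t *\<^sub>R axis i 1) \<le> v (z + 0 *\<^sub>R axis i 1)"
      by eventually_elim (use z(2) closure_subset in auto)
  qed
  then have "(\<Sum>i\<in>UNIV. H i) \<le> 0" by (simp add: sum_nonpos)
  moreover have "e * (2 * CARD('n)) > 0" using \<open>e > 0\<close> by simp
  ultimately show False using 1(3) gL(2) by linarith
qed

text \<open>Second derivatives pick up the square of the factor of their coordinate line, so a
  common square suffices. This serves reflections (c = 1) and dilations by 1/R (c = 1/R^2)
  alike.\<close>

lemma has_lap_compose_diag:
  fixes w :: "real ^ 'n::finite \<Rightarrow> real" and T :: "real ^ 'n \<Rightarrow> real ^ 'n"
  assumes w: "has_lap w (T x) g L"
    and T: "\<And>i t. T (x + t *\<^sub>R axis i 1) = T x + (\<sigma> i * t) *\<^sub>R axis i 1"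
    and \<sigma>: "\<And>i. \<sigma> i * \<sigma> i = c"
  shows "has_lap (\<lambda>x. w (T x)) x (\<chi> i. \<sigma> i * g $ i) (c * L)"
proof -
  from w obtain G H where 1:
    "\<And>i. \<forall>\<^sub>F t in nhds 0. ((\<lambda>t. w (T x + t *\<^sub>R axis i 1)) has_real_derivative G i t) (at t)"
    "\<And>i. G i 0 = g $ i" "\<And>i. (G i has_real_derivative H i) (at 0)" "L = (\<Sum>i\<in>UNIV. H i)"
    by (elim has_lapE) blast
  show ?thesis
  proof (rule has_lapI[where G="\<lambda>i t. \<sigma> i * G i (\<sigma> i * t)" and H="\<lambda>i. c * H i"])
    fix i
    have "isCont (\<lambda>t. \<sigma> i * t) 0" by (intro continuous_intros)
    then have "((\<lambda>t. \<sigma> i * t) \<longlongrightarrow> 0) (nhds 0)" by (simp add: continuous_at tendsto_nhds_iff)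
    with 1(1)[of i] have "\<forall>\<^sub>F t in nhds 0.
        ((\<lambda>t. w (T x + t *\<^sub>R axis i 1)) has_real_derivative G i (\<sigma> i * t)) (at (\<sigma> i * t))"
      unfolding filterlim_iff by blast
    then show "\<forall>\<^sub>F t in nhds 0. ((\<lambda>t. w (T (x + t *\<^sub>R axis i 1)))
        has_real_derivative \<sigma> i * G i (\<sigma> i * t)) (at t)"
    proof eventually_elim
      case (elim t)
      have "((\<lambda>t. \<sigma> i * t) has_real_derivative \<sigma> i) (at t)" by (auto intro!: derivative_eq_intros)
      from DERIV_chain2[where f="\<lambda>t. w (T x + t *\<^sub>R axis i 1)", OF elim this]
      show ?case by (simp add: T mult.commute)
    qed
    have "(G i has_real_derivative H i) (at (\<sigma> i * 0))" using 1(3)[of i] by simp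
    have "((\<lambda>t. \<sigma> i * t) has_real_derivative \<sigma> i) (at 0)" by (auto intro!: derivative_eq_intros)
    from DERIV_cmult[OF DERIV_chain2[where f="G i", OF \<open>(G i has_real_derivative H i) (at (\<sigma> i * 0))\<close> this], of "\<sigma> i"]
    show "((\<lambda>t. \<sigma> i * G i (\<sigma> i * t)) has_real_derivative c * H i) (at 0)"
      using \<sigma>[of i] by (simp add: algebra_simps)
  qed (use 1 in \<open>auto simp: sum_distrib_left\<close>)
qed

section \<open>Reflections and the interior gradient estimate\<close>

definition reflect :: "'n::finite \<Rightarrow> real \<Rightarrow> real ^ 'n \<Rightarrow> real ^ 'n"
  where "reflect l c x = (\<chi> i. if i = l then 2 * c - x $ i else x $ i)"

lemma reflect_nth: "reflect l c x $ i = (if i = l then 2 * c - x $ i else x $ i)"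
  by (simp add: reflect_def)

lemma reflect_reflect [simp]: "reflect l c (reflect l c x) = x"
  by (simp add: vec_eq_iff reflect_nth)

lemma continuous_on_reflect [continuous_intros]: "continuous_on S (reflect l c)"
proof -
  have "continuous_on S (\<lambda>x. if i = l then 2 * c - x $ i else x $ i)" for i
    by (cases "i = l") (auto intro!: continuous_intros)
  then show ?thesis unfolding reflect_def by (intro continuous_on_vec_lambda)
qed

lemma dist_reflect: "dist (reflect l c x) (reflect l c y) = dist x y"
  unfolding dist_vec_def L2_set_def
  by (intro arg_cong[where f=sqrt] sum.cong refl) (auto simp: reflect_nth dist_real_def power2_commute)

lemma has_lap_reflect:
  assumes "has_lap w (reflect l c x) g L"
  shows "has_lap (\<lambda>x. w (reflect l c x)) x (\<chi> i. (if i = l then -1 else 1) * g $ i) L"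
  using has_lap_compose_diag[where T="reflect l c" and \<sigma>="\<lambda>i. if i = l then -1 else 1" and c=1, OF assms]
  by (force simp: vec_eq_iff reflect_nth axis_def)

lemma deriv_le_of_linear_bound:
  fixes f :: "real \<Rightarrow> real"
  assumes "(f has_real_derivative D) (at 0 within {0<..})" "f 0 = 0" "d > 0"
    and "\<And>t. 0 < t \<Longrightarrow> t < d \<Longrightarrow> f t \<le> c * t"
  shows "D \<le> c"
proof -
  have "((\<lambda>t. f t / t) \<longlongrightarrow> D) (at_right 0)"
    using assms(1,2) by (simp add: has_field_derivative_iff)
  moreover have "\<forall>\<^sub>F t in at_right 0. f t / t \<le> c"
    unfolding eventually_at_right_field
    using assms(3,4) by (intro exI[of _ d]) (auto simp: divide_le_eq)
  ultimately show ?thesis by (intro tendsto_upperbound) auto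
qed

lemma norm_le_card_mult:
  fixes x :: "real ^ 'n::finite" and d :: real
  assumes "\<And>i. \<bar>x $ i\<bar> \<le> d"
  shows "norm x \<le> CARD('n) * d"
proof -
  have "norm x \<le> (\<Sum>i\<in>UNIV. \<bar>x $ i\<bar>)" by (rule norm_le_l1_cart)
  also have "\<dots> \<le> (\<Sum>i\<in>(UNIV::'n set). d)" by (intro sum_mono assms)
  finally show ?thesis by simp
qed

lemma square_le_inner:
  fixes y :: "real ^ 'n::finite"
  shows "(y $ l)\<^sup>2 \<le> y \<bullet> y"
proof -
  have "(\<Sum>j\<in>{l}. (y $ j)\<^sup>2) \<le> (\<Sum>j\<in>UNIV. (y $ j)\<^sup>2)"
    by (intro sum_mono2) auto
  then show ?thesis by (simp add: inner_vec_def power2_eq_square)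
qed

text \<open>The odd part of \<open>u\<close> in the direction \<open>l\<close> is dominated on a half cube by an explicit harmonic
  quadratic polynomial that vanishes to first order at the centre.\<close>

lemma harmonic_gradient_le:
  fixes u :: "real ^ 'n::finite \<Rightarrow> real" and M :: real
  assumes R: "R > 0" and cont: "continuous_on (cball a R) u"
    and harm: "\<And>x. x \<in> cball a R \<Longrightarrow> \<exists>g. has_lap u x g 0"
    and bound: "\<And>x. x \<in> cball a R \<Longrightarrow> \<bar>u x\<bar> \<le> M"
    and g: "has_lap u a g 0"
  shows "g $ l \<le> (CARD('n))\<^sup>2 * M / R"
proof -
  define n where "n = real CARD('n)"
  have n: "n \<ge> 1" unfolding n_def using zero_less_card_finite[where 'a='n] by linarith
  \<comment> \<open>The half cube of side \<open>d\<close> lies in the ball, because the norm is at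
    most n times the largest coordinate.\<close>
  define d where "d = R / n"
  have d: "d > 0" "n * d = R" unfolding d_def using R n by auto
  have M: "M \<ge> 0" using bound[of a] R by auto
  define C where "C = {x::real^'n. (\<forall>i. i \<noteq> l \<longrightarrow> \<bar>x $ i - a $ i\<bar> \<le> d) \<and> 0 \<le> x $ l - a $ l \<and> x $ l - a $ l \<le> d}"
  define B where "B = {x::real^'n. (\<forall>i. i \<noteq> l \<longrightarrow> \<bar>x $ i - a $ i\<bar> < d) \<and> 0 < x $ l - a $ l \<and> x $ l - a $ l < d}"
  have "closed C" unfolding C_def
    by (intro closed_Collect_conj closed_Collect_all closed_Collect_imp closed_Collect_le continuous_intros open_Collect_const)
  have "open {x::real^'n. i \<noteq> l \<longrightarrow> \<bar>x $ i - a $ i\<bar> < d}" for i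
    by (cases "i = l") (auto intro!: open_Collect_less continuous_intros)
  then have "open ((\<Inter>i. {x::real^'n. i \<noteq> l \<longrightarrow> \<bar>x $ i - a $ i\<bar> < d}) \<inter>
      {x. 0 < x $ l - a $ l} \<inter> {x. x $ l - a $ l < d})"
    by (intro open_Int open_INT open_Collect_less continuous_intros) auto
  also have "\<dots> = B" unfolding B_def by auto
  finally have "open B" .
  have "B \<subseteq> C" unfolding B_def C_def by (auto simp: less_imp_le)
  then have clB: "closure B \<subseteq> C" using \<open>closed C\<close> by (simp add: closure_minimal)
  have C_ball: "C \<subseteq> cball a R"
  proof
    fix x assume "x \<in> C"
    then have "\<bar>(x - a) $ i\<bar> \<le> d" for i unfolding C_def by (cases "i = l") auto
    from norm_le_card_mult[of "x - a", OF this] show "x \<in> cball a R"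
      using d(2) by (simp add: dist_norm norm_minus_commute n_def)
  qed
  have "bounded B" using \<open>B \<subseteq> C\<close> C_ball bounded_cball bounded_subset by (metis subset_trans)
  define rf where "rf = reflect l (a $ l)"
  have rf_a: "rf a = a" by (simp add: rf_def vec_eq_iff reflect_nth)
  have rf_ball: "rf x \<in> cball a R" if "x \<in> cball a R" for x
    using that dist_reflect[of l "a $ l" a x] rf_a by (simp add: rf_def)
  \<comment> \<open>Write \<tau> for \<open>x $ l - a $ l\<close>. The term -n \<tau>^2 cancels the
    Laplacian 2n of |x - a|^2. The linear term turns the bracket into |x - a|^2 + n \<tau> (d -
    \<tau>), which is nonnegative on the half cube and at least d^2 on every face except \<tau> = 0,
    where the odd part of \<open>u\<close> vanishes anyway.\<close>
  define \<psi> where "\<psi> x = (M / d\<^sup>2) * (((x - a) \<bullet> (x - a) - n * (x $ l - a $ l)\<^sup>2) + n * d * (x $ l - a $ l))" for x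
  have \<psi>_lap: "\<exists>g. has_lap \<psi> x g 0" for x
  proof -
    have 1: "has_lap (\<lambda>x. x $ l - a $ l) x (axis l 1) 0"
      using has_lap_diff[OF has_lap_coord has_lap_const] by simp
    from has_lap_mult[OF this this]
    have 2: "\<exists>g. has_lap (\<lambda>x. (x $ l - a $ l)\<^sup>2) x g 2"
      by (auto simp: inner_axis_axis power2_eq_square)
    then obtain g2 where 2: "has_lap (\<lambda>x. (x $ l - a $ l)\<^sup>2) x g2 2" by blast
    from has_lap_cmult[OF has_lap_add[OF has_lap_diff[OF has_lap_normsq[of a x]
          has_lap_cmult[OF 2, of n]] has_lap_cmult[OF 1, of "n * d"]], of "M / d\<^sup>2"]
    show ?thesis unfolding \<psi>_def n_def by (auto simp: mult.commute)
  qed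
  have \<psi>_ge: "\<psi> x \<ge> (if x \<in> B \<or> x $ l = a $ l then 0 else M)" if "x \<in> C" for x
  proof -
    define \<tau> where "\<tau> = x $ l - a $ l"
    have \<tau>: "0 \<le> \<tau>" "\<tau> \<le> d" using that unfolding C_def \<tau>_def by auto
    have nn: "n * \<tau> * (d - \<tau>) \<ge> 0" using \<tau> n by simp
    have eq: "\<psi> x = (M / d\<^sup>2) * ((x - a) \<bullet> (x - a) + n * \<tau> * (d - \<tau>))"
      unfolding \<psi>_def \<tau>_def[symmetric] by (simp add: algebra_simps power2_eq_square)
    have "\<psi> x \<ge> 0" unfolding eq using nn M by simp
    moreover have "\<psi> x \<ge> M" if nB: "x \<notin> B" "x $ l \<noteq> a $ l"
    proof -
      have "d\<^sup>2 \<le> (x - a) \<bullet> (x - a)"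
      proof (cases "\<tau> = d")
        case True
        then show ?thesis using square_le_inner[of "x - a" l] by (simp add: \<tau>_def)
      next
        case False
        then obtain i where "i \<noteq> l" "\<bar>x $ i - a $ i\<bar> = d"
          using \<open>x \<in> C\<close> nB unfolding C_def B_def \<tau>_def by force
        then show ?thesis using square_le_inner[of "x - a" i]
          by (metis power2_abs vector_minus_component)
      qed
      then have "(M / d\<^sup>2) * d\<^sup>2 \<le> \<psi> x" unfolding eq using nn M by (intro mult_left_mono) auto
      then show ?thesis using d by simp
    qed
    ultimately show ?thesis by auto
  qed
  define w where "w x = (1/2) * (u x - u (rf x)) - \<psi> x" for x
  have w_le: "w x \<le> 0" if "x \<in> closure B" for x
  proof (rule maximum_principle[OF \<open>open B\<close> \<open>bounded B\<close> _ _ _ that])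
    have "continuous_on (cball a R) (\<lambda>x. u (rf x))"
      unfolding rf_def
      by (rule continuous_on_compose2[OF cont continuous_on_reflect])
        (use rf_ball in \<open>auto simp: rf_def\<close>)
    then have "continuous_on (cball a R) w"
      unfolding w_def \<psi>_def by (intro continuous_intros cont)
    then show "continuous_on (closure B) w"
      using clB C_ball by (meson continuous_on_subset subset_trans)
    show "\<exists>g L. has_lap w x g L \<and> L \<ge> 0" if "x \<in> B" for x
    proof -
      have x: "x \<in> cball a R" using that \<open>B \<subseteq> C\<close> C_ball by auto
      obtain g1 where 1: "has_lap u x g1 0" using harm[OF x] by blast
      obtain g2 where 2: "has_lap u (rf x) g2 0" using harm[OF rf_ball[OF x]] by blast
      obtain g3 where 3: "has_lap \<psi> x g3 0" using \<psi>_lap by blast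
      from has_lap_diff[OF has_lap_cmult[OF has_lap_diff[OF 1 has_lap_reflect[OF 2[unfolded rf_def]]], of "1/2"] 3]
      show ?thesis unfolding w_def rf_def by (intro exI conjI, assumption) auto
    qed
    show "w x \<le> 0" if "x \<in> frontier B" for x
    proof -
      have x: "x \<in> C" "x \<notin> B"
        using that clB \<open>open B\<close> by (auto simp: frontier_def interior_open)
      then have xb: "x \<in> cball a R" using C_ball by auto
      show ?thesis
      proof (cases "x $ l = a $ l")
        case True
        then have "rf x = x" by (auto simp: rf_def vec_eq_iff reflect_nth)
        then show ?thesis unfolding w_def using \<psi>_ge[OF x(1)] x True by simp
      next
        case False
        then show ?thesis unfolding w_def
          using \<psi>_ge[OF x(1)] x bound[OF xb] bound[OF rf_ball[OF xb]] by (simp add: field_simps)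
      qed
    qed
  qed
  \<comment> \<open>On the axis the quadratic part of \<psi> is nonpositive since n >= 1, so the
    bound is linear in \<open>t\<close> and survives division by \<open>t\<close>.\<close>
  have line: "u (a + t *\<^sub>R axis l 1) - u (a + (-t) *\<^sub>R axis l 1) \<le> (2 * M * n / d) * t" if t: "0 < t" "t < d" for t
  proof -
    have "a + t *\<^sub>R axis l 1 \<in> B" using t d by (auto simp: B_def axis_def)
    then have 1: "w (a + t *\<^sub>R axis l 1) \<le> 0" using closure_subset w_le by blast
    have 2: "rf (a + t *\<^sub>R axis l 1) = a + (-t) *\<^sub>R axis l 1"
      by (simp add: vec_eq_iff rf_def reflect_nth axis_def)
    have "\<psi> (a + t *\<^sub>R axis l 1) = (M / d\<^sup>2) * (t * t - n * t * t + n * d * t)"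
      by (simp add: \<psi>_def inner_axis_axis power2_eq_square)
    also have "\<dots> \<le> (M / d\<^sup>2) * (n * d * t)"
      using n M t by (intro mult_left_mono) (auto simp: mult_le_cancel_right1 mult.assoc)
    also have "\<dots> = M * n / d * t"
      using d(1) by (simp add: power2_eq_square)
    finally have 3: "\<psi> (a + t *\<^sub>R axis l 1) \<le> M * n / d * t" .
    have "u (a + t *\<^sub>R axis l 1) - u (a + (-t) *\<^sub>R axis l 1) \<le> 2 * (M * n / d * t)"
    proof -
      have "p - q \<le> 2 * r" if "1 / 2 * (p - q) - s \<le> 0" "s \<le> r" for p q r s :: real
        using that by (simp add: field_simps)
      from this[OF 1[unfolded w_def 2] 3] show ?thesis .
    qed
    then show ?thesis by simp
  qed
  have "((\<lambda>t. u (a + (-t) *\<^sub>R axis l 1)) has_real_derivative g $ l * (-1)) (at 0)"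
    by (rule DERIV_chain2[of "\<lambda>s. u (a + s *\<^sub>R axis l 1)"])
      (use has_lap_line_deriv[OF g, of l] in \<open>auto intro!: derivative_eq_intros\<close>)
  from DERIV_diff[OF has_lap_line_deriv[OF g, of l] this]
  have "((\<lambda>t. u (a + t *\<^sub>R axis l 1) - u (a + (-t) *\<^sub>R axis l 1)) has_real_derivative 2 * g $ l) (at 0 within {0<..})"
    by (rule has_field_derivative_at_within[OF DERIV_cong]) simp
  from deriv_le_of_linear_bound[OF this _ d(1) line]
  have "2 * g $ l \<le> 2 * M * n / d" by simp
  also have "\<dots> = 2 * (n\<^sup>2 * M / R)"
    unfolding d_def using n R by (simp add: power2_eq_square field_simps)
  finally show ?thesis by (simp add: n_def)
qed

lemma harmonic_gradient_bound:
  fixes u :: "real ^ 'n::finite \<Rightarrow> real" and M :: real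
  assumes R: "R > 0" and cont: "continuous_on (cball a R) u"
    and harm: "\<And>x. x \<in> cball a R \<Longrightarrow> \<exists>g. has_lap u x g 0"
    and bound: "\<And>x. x \<in> cball a R \<Longrightarrow> \<bar>u x\<bar> \<le> M"
  shows "\<bar>partial_deriv l u a\<bar> \<le> (CARD('n))\<^sup>2 * M / R"
proof -
  obtain g where g: "has_lap u a g 0" using harm[of a] R by auto
  have "g $ l \<le> (CARD('n))\<^sup>2 * M / R"
    by (rule harmonic_gradient_le[OF R cont harm bound g])
  moreover have "(- g) $ l \<le> (CARD('n))\<^sup>2 * M / R"
  proof (rule harmonic_gradient_le[OF R _ _ _ ])
    show "continuous_on (cball a R) (\<lambda>x. - u x)" by (intro continuous_intros cont)
    show "\<exists>g. has_lap (\<lambda>x. - u x) x g 0" if "x \<in> cball a R" for x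
      using harm[OF that] has_lap_uminus by fastforce
    show "has_lap (\<lambda>x. - u x) a (- g) 0" using has_lap_uminus[OF g] by simp
  qed (use bound in auto)
  ultimately show ?thesis using has_lap_imp_derivs(1)[OF g, of l] by simp
qed

section \<open>Harmonic polynomials and the Dirichlet problem on balls\<close>

lemma rpf_line_deriv:
  fixes p :: "real ^ 'n::finite \<Rightarrow> real"
  assumes "real_polynomial_function p"
  shows "\<exists>q. real_polynomial_function q \<and>
    (\<forall>x. ((\<lambda>t. p (x + t *\<^sub>R axis i 1)) has_real_derivative q x) (at 0))"
  using assms
proof (induction p rule: real_polynomial_function.induct)
  case (linear f)
  interpret bounded_linear f by fact
  have "((\<lambda>t. f (x + t *\<^sub>R axis i 1)) has_real_derivative f (axis i 1)) (at 0)" for x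
    unfolding add scale by (auto intro!: derivative_eq_intros)
  then show ?case by (intro exI[of _ "\<lambda>x. f (axis i 1)"]) auto
next
  case (const c)
  show ?case by (intro exI[of _ "\<lambda>x. 0"]) auto
next
  case (add f g)
  then obtain f' g' where "real_polynomial_function f'" "real_polynomial_function g'"
    "\<And>x. ((\<lambda>t. f (x + t *\<^sub>R axis i 1)) has_real_derivative f' x) (at 0)"
    "\<And>x. ((\<lambda>t. g (x + t *\<^sub>R axis i 1)) has_real_derivative g' x) (at 0)" by blast
  then show ?case by (intro exI[of _ "\<lambda>x. f' x + g' x"]) (auto intro: DERIV_add)
next
  case (mult f g)
  then obtain f' g' where 1: "real_polynomial_function f'" "real_polynomial_function g'"
    "\<And>x. ((\<lambda>t. f (x + t *\<^sub>R axis i 1)) has_real_derivative f' x) (at 0)"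
    "\<And>x. ((\<lambda>t. g (x + t *\<^sub>R axis i 1)) has_real_derivative g' x) (at 0)" by blast
  have "((\<lambda>t. f (x + t *\<^sub>R axis i 1) * g (x + t *\<^sub>R axis i 1)) has_real_derivative
     f' x * g x + g' x * f x) (at 0)" for x
    using DERIV_mult[OF 1(3)[of x] 1(4)[of x]] by simp
  then show ?case using 1 mult.hyps
    by (intro exI[of _ "\<lambda>x. f' x * g x + g' x * f x"]) auto
qed

lemma rpf_has_partial_deriv:
  fixes p :: "real ^ 'n::finite \<Rightarrow> real"
  assumes "real_polynomial_function p"
  shows "((\<lambda>t. p (x + t *\<^sub>R axis i 1)) has_real_derivative partial_deriv i p x) (at 0)"
  using rpf_line_deriv[OF assms, of i] DERIV_imp_deriv unfolding partial_deriv_def by metis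

lemma rpf_partial_deriv:
  fixes p :: "real ^ 'n::finite \<Rightarrow> real"
  assumes "real_polynomial_function p"
  shows "real_polynomial_function (partial_deriv i p)"
proof -
  obtain q where q: "real_polynomial_function q"
    "\<And>x. ((\<lambda>t. p (x + t *\<^sub>R axis i 1)) has_real_derivative q x) (at 0)"
    using rpf_line_deriv[OF assms, of i] by blast
  have "partial_deriv i p = q"
    using q(2) DERIV_imp_deriv unfolding partial_deriv_def by blast
  with q(1) show ?thesis by simp
qed

lemma partial_deriv_rpf_add:
  fixes p :: "real ^ 'n::finite \<Rightarrow> real"
  assumes "real_polynomial_function p" "real_polynomial_function q"
  shows "partial_deriv i (\<lambda>x. p x + q x) = (\<lambda>x. partial_deriv i p x + partial_deriv i q x)"
  using DERIV_imp_deriv[OF DERIV_add[OF rpf_has_partial_deriv[OF assms(1)] rpf_has_partial_deriv[OF assms(2)]]]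
  unfolding partial_deriv_def[of i "\<lambda>x. p x + q x"] by blast

lemma partial_deriv_rpf_mult:
  fixes p :: "real ^ 'n::finite \<Rightarrow> real"
  assumes "real_polynomial_function p" "real_polynomial_function q"
  shows "partial_deriv i (\<lambda>x. p x * q x) = (\<lambda>x. partial_deriv i p x * q x + partial_deriv i q x * p x)"
proof
  fix x
  show "partial_deriv i (\<lambda>x. p x * q x) x = partial_deriv i p x * q x + partial_deriv i q x * p x"
    using DERIV_imp_deriv[OF DERIV_mult[OF rpf_has_partial_deriv[OF assms(1), of x i] rpf_has_partial_deriv[OF assms(2), of x i]]]
    unfolding partial_deriv_def[of i "\<lambda>x. p x * q x"] by simp
qed

lemma partial_deriv_const: "partial_deriv i (\<lambda>x. c) = (\<lambda>x. 0)"
  unfolding partial_deriv_def by simp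

lemma partial_deriv_rpf_sum:
  fixes p :: "'j \<Rightarrow> real ^ 'n::finite \<Rightarrow> real"
  assumes "finite J" "\<And>j. j \<in> J \<Longrightarrow> real_polynomial_function (p j)"
  shows "partial_deriv i (\<lambda>x. \<Sum>j\<in>J. p j x) = (\<lambda>x. \<Sum>j\<in>J. partial_deriv i (p j) x)"
  using assms
proof (induction J rule: finite_induct)
  case (insert j J)
  then have "real_polynomial_function (\<lambda>x. \<Sum>j\<in>J. p j x)" by auto
  with insert show ?case using partial_deriv_rpf_add[of "p j" "\<lambda>x. \<Sum>j\<in>J. p j x" i] by simp
qed (simp add: partial_deriv_const)

text \<open>Structural induction over polynomial functions. It lets the Laplacian commute with
  partial derivatives, so that derivatives of harmonic polynomials are harmonic.\<close>

lemma partial_deriv_commute: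
  fixes p :: "real ^ 'n::finite \<Rightarrow> real"
  assumes "real_polynomial_function p"
  shows "partial_deriv i (partial_deriv j p) = partial_deriv j (partial_deriv i p)"
  using assms
proof (induction p rule: real_polynomial_function.induct)
  case (linear f)
  interpret bounded_linear f by fact
  have "partial_deriv k f = (\<lambda>x. f (axis k 1))" for k
    unfolding partial_deriv_def add scale
    by (intro ext DERIV_imp_deriv) (auto intro!: derivative_eq_intros)
  then show ?case by (simp add: partial_deriv_const)
next
  case (const c)
  show ?case by (simp add: partial_deriv_const)
next
  case (add f g)
  then show ?case by (simp add: partial_deriv_rpf_add rpf_partial_deriv)
next
  case (mult f g)
  have "real_polynomial_function (\<lambda>x. partial_deriv k f x * g x)"
    "real_polynomial_function (\<lambda>x. partial_deriv k g x * f x)" for k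
    using mult by (auto intro: rpf_partial_deriv)
  then show ?case using mult
    by (simp add: partial_deriv_rpf_add partial_deriv_rpf_mult rpf_partial_deriv algebra_simps)
qed

lemma rpf_continuous_on:
  assumes "real_polynomial_function p"
  shows "continuous_on S p"
  using assms by (simp add: continuous_at_imp_continuous_on continuous_real_polymonial_function)

lemma rpf_C1_on:
  fixes p :: "real ^ 'n::finite \<Rightarrow> real"
  assumes "real_polynomial_function p"
  shows "C1_on S p"
  unfolding C1_on_def using assms rpf_has_partial_deriv[OF assms]
  by (auto intro!: rpf_continuous_on rpf_partial_deriv simp: field_differentiable_def)

lemma rpf_has_lap:
  fixes p :: "real ^ 'n::finite \<Rightarrow> real"
  assumes "real_polynomial_function p"
  shows "has_lap p x (\<chi> i. partial_deriv i p x) (laplacian p x)"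
  using C2_on_has_lap[of UNIV p x] assms by (auto simp: C2_on_def intro: rpf_C1_on rpf_partial_deriv)

definition harm_poly :: "(real ^ 'n::finite \<Rightarrow> real) \<Rightarrow> bool"
  where "harm_poly p \<longleftrightarrow> real_polynomial_function p \<and> (\<forall>x. laplacian p x = 0)"

lemma harm_poly_has_lap:
  assumes "harm_poly p"
  shows "has_lap p x (\<chi> i. partial_deriv i p x) 0"
  using rpf_has_lap[of p x] assms by (simp add: harm_poly_def)

lemma harm_polyI:
  assumes "real_polynomial_function p" "\<And>x. \<exists>g. has_lap p x g 0"
  shows "harm_poly p"
  unfolding harm_poly_def using assms has_lap_imp_derivs(2) by metis

lemma harm_poly_continuous_on: "harm_poly p \<Longrightarrow> continuous_on S p"
  by (simp add: harm_poly_def rpf_continuous_on)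

lemma harm_poly_partial_deriv:
  fixes p :: "real ^ 'n::finite \<Rightarrow> real"
  assumes "harm_poly p"
  shows "harm_poly (partial_deriv i p)"
proof -
  have rpf: "real_polynomial_function p" using assms by (simp add: harm_poly_def)
  have rpf': "real_polynomial_function (partial_deriv j (partial_deriv k p))" for j k
    using rpf by (intro rpf_partial_deriv)
  have "laplacian (partial_deriv i p) x = 0" for x
  proof -
    have "partial_deriv j (partial_deriv j (partial_deriv i p)) = partial_deriv i (partial_deriv j (partial_deriv j p))" for j
      using partial_deriv_commute[OF rpf, of j i] partial_deriv_commute[OF rpf_partial_deriv[OF rpf], of j i j]
      by simp
    then have "laplacian (partial_deriv i p) x = (\<Sum>j\<in>UNIV. partial_deriv i (partial_deriv j (partial_deriv j p)) x)"
      unfolding laplacian_def by simp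
    also have "\<dots> = partial_deriv i (\<lambda>x. \<Sum>j\<in>UNIV. partial_deriv j (partial_deriv j p) x) x"
      using partial_deriv_rpf_sum[of UNIV "\<lambda>j. partial_deriv j (partial_deriv j p)" i] rpf' by simp
    also have "(\<lambda>x. \<Sum>j\<in>UNIV. partial_deriv j (partial_deriv j p) x) = (\<lambda>x. 0)"
      using assms by (auto simp: harm_poly_def laplacian_def)
    finally show ?thesis by (simp add: partial_deriv_const)
  qed
  then show ?thesis using rpf rpf_partial_deriv by (auto simp: harm_poly_def)
qed

lemma harm_poly_const: "harm_poly (\<lambda>x. c)"
  by (rule harm_polyI) (auto intro: has_lap_const)

lemma harm_poly_coord: "harm_poly (\<lambda>x::real^'n::finite. x $ i)"
  by (rule harm_polyI) (auto intro: has_lap_coord real_polynomial_function.intros(1) bounded_linear_vec_nth)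

lemma harm_poly_add:
  assumes "harm_poly p" "harm_poly q"
  shows "harm_poly (\<lambda>x. p x + q x)"
proof (rule harm_polyI)
  show "\<exists>g. has_lap (\<lambda>x. p x + q x) x g 0" for x
    using has_lap_add[OF assms[THEN harm_poly_has_lap, of x]] by auto
qed (use assms in \<open>auto simp: harm_poly_def\<close>)

lemma harm_poly_cmult:
  assumes "harm_poly p"
  shows "harm_poly (\<lambda>x. c * p x)"
proof (rule harm_polyI)
  show "\<exists>g. has_lap (\<lambda>x. c * p x) x g 0" for x
    using has_lap_cmult[OF assms[THEN harm_poly_has_lap, of x]] by auto
qed (use assms in \<open>auto simp: harm_poly_def\<close>)

lemma harm_poly_diff:
  assumes "harm_poly p" "harm_poly q"
  shows "harm_poly (\<lambda>x. p x - q x)"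
  using harm_poly_add[OF assms(1) harm_poly_cmult[OF assms(2), of "-1"]] by simp

lemma harm_poly_sum:
  assumes "\<And>j. j \<in> J \<Longrightarrow> harm_poly (p j)"
  shows "harm_poly (\<lambda>x. \<Sum>j\<in>J. p j x)"
  using assms by (induction J rule: infinite_finite_induct) (auto intro: harm_poly_const harm_poly_add)

text \<open>Integer degrees make differentiation lower the degree uniformly; polynomials of negative
  degree vanish.\<close>

definition hom_poly :: "int \<Rightarrow> (real ^ 'n::finite \<Rightarrow> real) \<Rightarrow> bool"
  where "hom_poly k p \<longleftrightarrow> real_polynomial_function p \<and> (\<forall>t>0. \<forall>x. p (t *\<^sub>R x) = t powi k * p x)"

section \<open>Homogeneous polynomials and the harmonic projection\<close>

lemma hom_poly_partial_deriv:
  fixes p :: "real ^ 'n::finite \<Rightarrow> real"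
  assumes "hom_poly k p"
  shows "hom_poly (k - 1) (partial_deriv i p)"
proof -
  have rpf: "real_polynomial_function p" using assms by (simp add: hom_poly_def)
  have "partial_deriv i p (t *\<^sub>R x) = t powi (k - 1) * partial_deriv i p x" if "t > 0" for t x
  proof -
    have "((\<lambda>s. (1 / t) * s) has_real_derivative 1 / t) (at 0)"
      using DERIV_cmult[OF DERIV_ident, of "1 / t"] by simp
    from DERIV_chain2[where f="\<lambda>s. p (x + s *\<^sub>R axis i 1)", OF _ this, of "partial_deriv i p x"]
    have "((\<lambda>s. p (x + ((1 / t) * s) *\<^sub>R axis i 1)) has_real_derivative partial_deriv i p x * (1 / t)) (at 0)"
      using rpf_has_partial_deriv[OF rpf, of x i] by simp
    from DERIV_cmult[OF this, of "t powi k"]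
    have "((\<lambda>s. t powi k * p (x + ((1 / t) * s) *\<^sub>R axis i 1)) has_real_derivative
       t powi k * (partial_deriv i p x * (1 / t))) (at 0)" .
    moreover have "t powi k * p (x + ((1 / t) * s) *\<^sub>R axis i 1) = p (t *\<^sub>R x + s *\<^sub>R axis i 1)" for s
    proof -
      have "p (t *\<^sub>R (x + ((1 / t) * s) *\<^sub>R axis i 1)) = t powi k * p (x + ((1 / t) * s) *\<^sub>R axis i 1)"
        using assms that by (simp add: hom_poly_def)
      then show ?thesis using that by (simp add: scaleR_add_right)
    qed
    ultimately show ?thesis
      unfolding partial_deriv_def[of i p "t *\<^sub>R x"]
      using \<open>t > 0\<close> power_int_diff[of t k 1] by (intro DERIV_imp_deriv) simp
  qed
  then show ?thesis using rpf rpf_partial_deriv by (auto simp: hom_poly_def)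
qed

lemma hom_poly_sum:
  assumes "\<And>j. j \<in> J \<Longrightarrow> hom_poly k (p j)" "finite J"
  shows "hom_poly k (\<lambda>x. \<Sum>j\<in>J. p j x)"
  using assms by (auto simp: hom_poly_def sum_distrib_left)

lemma hom_poly_laplacian:
  assumes "hom_poly k p"
  shows "hom_poly (k - 2) (laplacian p)"
  unfolding laplacian_def[abs_def]
proof (rule hom_poly_sum)
  show "hom_poly (k - 2) (partial_deriv j (partial_deriv j p))" for j
    using hom_poly_partial_deriv[OF hom_poly_partial_deriv[OF assms], of j j] by simp
qed simp

text \<open>With m = -k > 0, homogeneity says t^m p(t x) = p(x) for t > 0, and the left side tends
  to 0 with t because p is continuous at the origin. This is what ends the projection
  series.\<close>

lemma hom_poly_negative:
  assumes "hom_poly k p" "k < 0"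
  shows "p x = 0"
proof -
  have cont: "continuous_on UNIV p"
    using assms by (auto simp: hom_poly_def rpf_continuous_on)
  define m where "m = nat (- k)"
  have m: "m > 0" "k = - int m" using assms by (auto simp: m_def)
  have eq: "t ^ m * p (t *\<^sub>R x) = p x" if "t > 0" for t
    using assms that unfolding hom_poly_def m(2) by (simp add: power_int_minus field_simps)
  have "continuous_on UNIV (\<lambda>t::real. t ^ m * p (t *\<^sub>R x))"
    by (intro continuous_intros continuous_on_compose2[OF cont]) auto
  then have "isCont (\<lambda>t::real. t ^ m * p (t *\<^sub>R x)) 0"
    by (simp add: continuous_on_eq_continuous_at)
  then have "((\<lambda>t::real. t ^ m * p (t *\<^sub>R x)) \<longlongrightarrow> 0 ^ m * p (0 *\<^sub>R x)) (at_right 0)"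
    unfolding isCont_def by (rule tendsto_within_subset) simp
  moreover have "((\<lambda>t::real. t ^ m * p (t *\<^sub>R x)) \<longlongrightarrow> p x) (at_right 0)"
    by (rule tendsto_eventually) (use eq in \<open>auto simp: eventually_at_filter\<close>)
  ultimately have "0 ^ m * p (0 *\<^sub>R x) = p x" by (rule tendsto_unique[rotated]) simp
  then show ?thesis using m(1) by (simp add: power_0_left)
qed

text \<open>Differentiate p(t x) = t^k p(x) at t = 1 and compare with the chain rule.\<close>

lemma euler_identity:
  fixes p :: "real ^ 'n::finite \<Rightarrow> real"
  assumes "hom_poly k p"
  shows "x \<bullet> (\<chi> i. partial_deriv i p x) = of_int k * p x"
proof -
  have rpf: "real_polynomial_function p" using assms by (simp add: hom_poly_def)
  then obtain D where D: "(p has_derivative D) (at x)"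
    using differentiable_at_real_polynomial_function unfolding differentiable_def by blast
  interpret bounded_linear D using D by (rule has_derivative_bounded_linear)
  have line: "((\<lambda>t. p (y + t *\<^sub>R h)) has_real_derivative D h) (at s)" if "y + s *\<^sub>R h = x" for y h s
  proof -
    have "((\<lambda>t. y + t *\<^sub>R h) has_derivative (\<lambda>t. t *\<^sub>R h)) (at s)"
      by (auto intro!: derivative_eq_intros)
    from has_derivative_compose[OF this, of p D]
    have "((\<lambda>t. p (y + t *\<^sub>R h)) has_derivative (\<lambda>t. D (t *\<^sub>R h))) (at s)"
      using D that by simp
    then show ?thesis by (simp add: scaleR has_field_derivative_def mult_commute_abs)
  qed
  have "D (axis i 1) = partial_deriv i p x" for i
    by (rule DERIV_unique[OF line rpf_has_partial_deriv[OF rpf, of x i]]) simp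
  then have "D x = x \<bullet> (\<chi> i. partial_deriv i p x)"
  proof -
    assume *: "\<And>i. D (axis i 1) = partial_deriv i p x"
    have "D x = D (\<Sum>i\<in>UNIV. (x $ i) *\<^sub>R axis i 1)"
      using basis_expansion[of x] by (simp add: scalar_mult_eq_scaleR)
    then show ?thesis by (simp add: sum scaleR * inner_vec_def)
  qed
  moreover have "D x = of_int k * p x"
  proof -
    have 1: "((\<lambda>t. t powi k * p x) has_real_derivative of_int k * p x) (at 1)"
      by (auto intro!: derivative_eq_intros)
    have "\<forall>\<^sub>F t in nhds (1::real). t powi k * p x = p (0 + t *\<^sub>R x)"
      using eventually_nhds_in_open[of "{0<..}" "1::real"] assms
      by (auto elim!: eventually_mono simp: hom_poly_def)
    from DERIV_cong_ev[OF refl this refl, of "of_int k * p x"] 1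
    have "((\<lambda>t. p (0 + t *\<^sub>R x)) has_real_derivative of_int k * p x) (at 1)" by blast
    from DERIV_unique[OF line[of 0 1 x] this] show ?thesis by simp
  qed
  ultimately show ?thesis by simp
qed

lemma has_lap_normsq_power:
  fixes x :: "real ^ 'n::finite"
  shows "has_lap (\<lambda>x. (x \<bullet> x) ^ j) x ((2 * j * (x \<bullet> x) ^ (j - 1)) *\<^sub>R x)
    (2 * j * (2 * real j - 2 + CARD('n)) * (x \<bullet> x) ^ (j - 1))"
proof -
  have N: "has_lap (\<lambda>x::real^'n. x \<bullet> x) x (2 *\<^sub>R x) (2 * CARD('n))"
    using has_lap_normsq[of 0 x] by simp
  have "has_lap (\<lambda>x. (x \<bullet> x) ^ j) x ((j * (x \<bullet> x) ^ (j - 1)) *\<^sub>R 2 *\<^sub>R x)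
     (j * (real (j - 1) * (x \<bullet> x) ^ (j - 1 - 1)) * (2 *\<^sub>R x \<bullet> 2 *\<^sub>R x) + (j * (x \<bullet> x) ^ (j - 1)) * (2 * CARD('n)))"
  proof (rule has_lap_chain[OF N, where F="\<lambda>s. s ^ j"])
    show "\<forall>\<^sub>F s in nhds (x \<bullet> x). ((\<lambda>s. s ^ j) has_real_derivative j * s ^ (j - 1)) (at s)"
      by (rule always_eventually) (auto intro!: derivative_eq_intros)
    show "((\<lambda>s. j * s ^ (j - 1)) has_real_derivative j * (real (j - 1) * (x \<bullet> x) ^ (j - 1 - 1))) (at (x \<bullet> x))"
      by (intro DERIV_cmult) (auto intro!: derivative_eq_intros)
  qed
  then show ?thesis
  proof (rule has_lap_eq, goal_cases)
    case 1
    show ?case by (simp add: mult_ac)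
  next
    case 2
    \<comment> \<open>Truncated subtraction in \<open>j - 1 - 1\<close> is harmless, because its
      coefficient vanishes for j = 0 and j = 1.\<close>
    consider "j = 0" | "j = 1" | i where "j = Suc (Suc i)" by (metis One_nat_def not0_implies_Suc)
    then show ?case by cases (auto simp: algebra_simps)
  qed
qed

text \<open>By Euler's identity the inner product of the two gradients is again a multiple of
  |x|^(2j-2) r; it contributes the summand \<open>2 * of_int m\<close>.\<close>

lemma has_lap_normsq_power_mult:
  fixes r :: "real ^ 'n::finite \<Rightarrow> real"
  assumes "hom_poly m r"
  shows "\<exists>g. has_lap (\<lambda>x. (x \<bullet> x) ^ j * r x) x g
    ((x \<bullet> x) ^ j * laplacian r x + 2 * j * (2 * real j - 2 + CARD('n) + 2 * of_int m) * ((x \<bullet> x) ^ (j - 1) * r x))"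
proof -
  have "real_polynomial_function r" using assms by (simp add: hom_poly_def)
  note 1 = has_lap_mult[OF has_lap_normsq_power rpf_has_lap[OF this], of j x]
  have "r x * (2 * j * (2 * real j - 2 + CARD('n)) * (x \<bullet> x) ^ (j - 1)) + (x \<bullet> x) ^ j * laplacian r x
     + 2 * ((2 * j * (x \<bullet> x) ^ (j - 1)) *\<^sub>R x \<bullet> (\<chi> i. partial_deriv i r x))
    = (x \<bullet> x) ^ j * laplacian r x + 2 * j * (2 * real j - 2 + CARD('n) + 2 * of_int m) * ((x \<bullet> x) ^ (j - 1) * r x)"
    by (simp add: euler_identity[OF assms] algebra_simps)
  with 1 show ?thesis by (intro exI) (rule has_lap_eq, assumption, rule refl, simp)
qed

text \<open>The denominator is the factor from \<open>has_lap_normsq_power_mult\<close> for the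
  power j + 1 and the degree k - 2 (j + 1). With n > 0 it is positive as long as 2 (j + 1) <=
  k.\<close>

primrec harm_coeff :: "real \<Rightarrow> real \<Rightarrow> nat \<Rightarrow> real" where
  "harm_coeff n k 0 = 1"
| "harm_coeff n k (Suc j) = - harm_coeff n k j / (2 * (real j + 1) * (n + 2 * k - 2 * real j - 4))"

lemma hom_poly_laplacian_iter:
  assumes "hom_poly k p"
  shows "hom_poly (k - 2 * int j) ((laplacian ^^ j) p)"
proof (induction j)
  case (Suc j)
  from hom_poly_laplacian[OF this] show ?case by (simp add: algebra_simps)
qed (use assms in auto)

text \<open>The coefficients are chosen such that the Laplacian of the sum telescopes.\<close>

lemma has_lap_harmonic_projection:
  fixes p :: "real ^ 'n::finite \<Rightarrow> real"
  assumes p: "hom_poly (int k) p" and "2 * J \<le> k"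
  defines "c \<equiv> harm_coeff CARD('n) k"
  shows "\<exists>g. has_lap (\<lambda>x. \<Sum>j\<le>J. c j * ((x \<bullet> x) ^ j * (laplacian ^^ j) p x)) x g
     (c J * ((x \<bullet> x) ^ J * (laplacian ^^ Suc J) p x))"
  using assms(2)
proof (induction J)
  case 0
  have "real_polynomial_function p" using p by (simp add: hom_poly_def)
  then show ?case using rpf_has_lap[of p x] by (auto simp: c_def)
next
  case (Suc J)
  then obtain g where 1: "has_lap (\<lambda>x. \<Sum>j\<le>J. c j * ((x \<bullet> x) ^ j * (laplacian ^^ j) p x)) x g
     (c J * ((x \<bullet> x) ^ J * (laplacian ^^ Suc J) p x))" by auto
  define r where "r = (laplacian ^^ Suc J) p"
  have "hom_poly (int k - 2 * int (Suc J)) r"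
    unfolding r_def by (rule hom_poly_laplacian_iter[OF p])
  from has_lap_normsq_power_mult[OF this, of "Suc J" x] obtain g' where
    2: "has_lap (\<lambda>x. (x \<bullet> x) ^ Suc J * r x) x g' ((x \<bullet> x) ^ Suc J * laplacian r x +
       2 * Suc J * (2 * real (Suc J) - 2 + CARD('n) + 2 * of_int (int k - 2 * int (Suc J))) * ((x \<bullet> x) ^ J * r x))"
    by auto
  define A where "A = 2 * real (Suc J) * (CARD('n) + 2 * real k - 2 * real J - 4)"
  have "real CARD('n) > 0" by simp
  moreover have "2 * real J + 2 \<le> real k"
    using Suc.prems of_nat_mono[of "2 * Suc J" k, where 'a=real] by simp
  ultimately have "CARD('n) + 2 * real k - 2 * real J - 4 > 0" by linarith
  then have "A \<noteq> 0" unfolding A_def by simp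
  have c: "c (Suc J) = - c J / A" unfolding c_def A_def by (simp add: add.commute)
  have A: "2 * Suc J * (2 * real (Suc J) - 2 + CARD('n) + 2 * of_int (int k - 2 * int (Suc J))) = A"
    unfolding A_def by (simp add: algebra_simps)
  have "c J * ((x \<bullet> x) ^ J * r x) + c (Suc J) * ((x \<bullet> x) ^ Suc J * laplacian r x + A * ((x \<bullet> x) ^ J * r x))
    = c (Suc J) * ((x \<bullet> x) ^ Suc J * laplacian r x)"
    using \<open>A \<noteq> 0\<close> unfolding c by (simp add: field_simps)
  with has_lap_add[OF 1 has_lap_cmult[OF 2, of "c (Suc J)"]] show ?case
    unfolding A by (auto simp: r_def)
qed

lemma harm_poly_harmonic_projection:
  fixes p :: "real ^ 'n::finite \<Rightarrow> real"
  assumes p: "hom_poly (int k) p"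
  defines "c \<equiv> harm_coeff CARD('n) k"
  shows "harm_poly (\<lambda>x. \<Sum>j\<le>k div 2. c j * ((x \<bullet> x) ^ j * (laplacian ^^ j) p x))"
proof (rule harm_polyI)
  have "real_polynomial_function ((laplacian ^^ j) p)" for j
    using hom_poly_laplacian_iter[OF p, of j] by (simp add: hom_poly_def)
  moreover have "real_polynomial_function (\<lambda>x::real^'n. x \<bullet> x)"
    unfolding inner_vec_def inner_real_def
    by (intro real_polynomial_function_sum real_polynomial_function.intros(4)
        real_polynomial_function.intros(1)[OF bounded_linear_vec_nth]) auto
  ultimately show "real_polynomial_function (\<lambda>x. \<Sum>j\<le>k div 2. c j * ((x \<bullet> x) ^ j * (laplacian ^^ j) p x))"
    by (intro real_polynomial_function_sum real_polynomial_function.intros(2,4)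
        real_polynomial_function_power) auto
  fix x :: "real ^ 'n"
  \<comment> \<open>The only term left by the telescoping has degree k - 2 (k div 2 + 1) <
    0.\<close>
  have "(laplacian ^^ Suc (k div 2)) p x = 0"
    by (rule hom_poly_negative[OF hom_poly_laplacian_iter[OF p]]) presburger
  then show "\<exists>g. has_lap (\<lambda>x. \<Sum>j\<le>k div 2. c j * ((x \<bullet> x) ^ j * (laplacian ^^ j) p x)) x g 0"
    using has_lap_harmonic_projection[OF p, of "k div 2" x] by (auto simp: c_def)
qed

text \<open>On the unit sphere the factors |x|^(2j) are 1, so \<open>p\<close> is its harmonic
  projection minus multiples of its iterated Laplacians. These have smaller degree and are replaced
  by induction.\<close>

lemma hom_poly_eq_harm_poly_on_sphere:
  fixes p :: "real ^ 'n::finite \<Rightarrow> real"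
  assumes "hom_poly (int k) p"
  shows "\<exists>h. harm_poly h \<and> (\<forall>x\<in>sphere 0 1. h x = p x)"
  using assms
proof (induction k arbitrary: p rule: less_induct)
  case (less k)
  define c where "c = harm_coeff CARD('n) k"
  define T where "T j = (laplacian ^^ j) p" for j
  have "\<exists>h. harm_poly h \<and> (\<forall>x\<in>sphere 0 1. h x = T j x)" if "j \<in> {1..k div 2}" for j
  proof (rule less.IH)
    show "k - 2 * j < k" using that by auto
    show "hom_poly (int (k - 2 * j)) (T j)"
      using hom_poly_laplacian_iter[OF less.prems, of j] that by (auto simp: T_def of_nat_diff)
  qed
  then obtain h where h: "\<And>j. j \<in> {1..k div 2} \<Longrightarrow> harm_poly (h j)"
    "\<And>j x. j \<in> {1..k div 2} \<Longrightarrow> x \<in> sphere 0 1 \<Longrightarrow> h j x = T j x" by metis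
  define q where "q x = (\<Sum>j\<le>k div 2. c j * ((x \<bullet> x) ^ j * T j x))" for x
  have q: "harm_poly q"
    using harm_poly_harmonic_projection[OF less.prems] by (simp add: q_def[abs_def] c_def T_def)
  have "harm_poly (\<lambda>x. \<Sum>j\<in>{1..k div 2}. c j * h j x)"
    by (intro harm_poly_sum harm_poly_cmult h)
  from harm_poly_diff[OF q this]
  have "harm_poly (\<lambda>x. q x - (\<Sum>j\<in>{1..k div 2}. c j * h j x))" .
  moreover have "q x - (\<Sum>j\<in>{1..k div 2}. c j * h j x) = p x" if "x \<in> sphere 0 1" for x
  proof -
    have "x \<bullet> x = 1" using that by (simp add: dist_norm flip: power2_norm_eq_inner)
    then have "q x = (\<Sum>j\<in>{0..k div 2}. c j * T j x)" by (simp add: q_def atLeast0AtMost)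
    also have "\<dots> = p x + (\<Sum>j\<in>{1..k div 2}. c j * T j x)"
      by (subst sum.atLeast_Suc_atMost) (auto simp: c_def T_def)
    also have "(\<Sum>j\<in>{1..k div 2}. c j * T j x) = (\<Sum>j\<in>{1..k div 2}. c j * h j x)"
      using h(2) that by (intro sum.cong) auto
    finally show ?thesis by simp
  qed
  ultimately show ?case by (intro exI[of _ "\<lambda>x. q x - (\<Sum>j\<in>{1..k div 2}. c j * h j x)"]) auto
qed

text \<open>Decomposition into homogeneous parts without coefficients or monomials. Besides sums,
  closure under products is all that the induction over polynomial functions asks for.\<close>

inductive graded_sum :: "(real ^ 'n::finite \<Rightarrow> real) \<Rightarrow> bool" where
  base: "hom_poly (int k) p \<Longrightarrow> graded_sum p"
| add: "graded_sum p \<Longrightarrow> graded_sum q \<Longrightarrow> graded_sum (\<lambda>x. p x + q x)"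

lemma hom_poly_mult:
  assumes "hom_poly j p" "hom_poly k q"
  shows "hom_poly (j + k) (\<lambda>x. p x * q x)"
  using assms by (auto simp: hom_poly_def power_int_add)

lemma graded_sum_mult:
  assumes "graded_sum p" "graded_sum q"
  shows "graded_sum (\<lambda>x. p x * q x)"
  using assms(1)
proof induction
  case (base j p)
  from assms(2) show ?case
  proof induction
    case (base k q)
    then show ?case
      using hom_poly_mult[OF \<open>hom_poly (int j) p\<close> base] graded_sum.base[of "j + k"] by simp
  next
    case (add q r)
    from graded_sum.add[OF add.IH] show ?case by (simp add: algebra_simps)
  qed
next
  case (add p r)
  from graded_sum.add[OF add.IH] show ?case by (simp add: algebra_simps)
qed

lemma rpf_graded_sum:
  fixes p :: "real ^ 'n::finite \<Rightarrow> real"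
  assumes "real_polynomial_function p"
  shows "graded_sum p"
  using assms
proof induction
  case (linear f)
  interpret bounded_linear f by fact
  have "hom_poly (int 1) f" using real_polynomial_function.intros(1)[OF bounded_linear_axioms] by (auto simp: hom_poly_def scale)
  then show ?case by (rule graded_sum.base)
next
  case (const c)
  have "hom_poly (int 0) (\<lambda>x. c)" by (auto simp: hom_poly_def)
  then show ?case by (rule graded_sum.base)
qed (auto intro: graded_sum.add graded_sum_mult)

lemma rpf_eq_harm_poly_on_unit_sphere:
  fixes p :: "real ^ 'n::finite \<Rightarrow> real"
  assumes "real_polynomial_function p"
  shows "\<exists>h. harm_poly h \<and> (\<forall>x\<in>sphere 0 1. h x = p x)"
  using rpf_graded_sum[OF assms]
proof induction
  case (base k p)
  then show ?case by (rule hom_poly_eq_harm_poly_on_sphere)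
next
  case (add p q)
  then obtain h h' where "harm_poly h" "\<forall>x\<in>sphere 0 1. h x = p x"
    "harm_poly h'" "\<forall>x\<in>sphere 0 1. h' x = q x" by auto
  then show ?case by (intro exI[of _ "\<lambda>x. h x + h' x"]) (auto intro: harm_poly_add)
qed

lemma rpf_eq_harm_poly_on_sphere:
  fixes p :: "real ^ 'n::finite \<Rightarrow> real"
  assumes "real_polynomial_function p" "R > 0"
  shows "\<exists>h. harm_poly h \<and> (\<forall>x\<in>sphere a R. h x = p x)"
proof -
  have "real_polynomial_function (p \<circ> (\<lambda>y. a + R *\<^sub>R y))"
    by (rule real_polynomial_function_compose[OF _ assms(1)]) auto
  from rpf_eq_harm_poly_on_unit_sphere[OF this] obtain h where
    h: "harm_poly h" "\<And>y. y \<in> sphere 0 1 \<Longrightarrow> h y = p (a + R *\<^sub>R y)" by auto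
  define T where "T x = (1 / R) *\<^sub>R (x - a)" for x
  have "harm_poly (\<lambda>x. h (T x))"
  proof (rule harm_polyI)
    have "real_polynomial_function (h \<circ> T)"
      unfolding T_def
      by (rule real_polynomial_function_compose) (use h in \<open>auto simp: harm_poly_def\<close>)
    then show "real_polynomial_function (\<lambda>x. h (T x))" by (simp add: o_def)
    fix x
    have "T (x + t *\<^sub>R axis i 1) = T x + (1 / R * t) *\<^sub>R axis i 1" for i t
      unfolding T_def by (simp add: algebra_simps)
    from has_lap_compose_diag[OF harm_poly_has_lap[OF h(1)] this, of "1 / R * (1 / R)"]
    show "\<exists>g. has_lap (\<lambda>x. h (T x)) x g 0" by auto
  qed
  moreover have "h (T x) = p x" if "x \<in> sphere a R" for x
  proof -
    have "T x \<in> sphere 0 1"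
      using that assms(2) by (simp add: T_def dist_norm norm_minus_commute)
    then show ?thesis using h(2)[of "T x"] assms(2) by (simp add: T_def)
  qed
  ultimately show ?thesis by blast
qed

lemma harm_poly_approx_on_sphere:
  fixes v :: "real ^ 'n::finite \<Rightarrow> real"
  assumes "continuous_on (sphere a R) v" "R > 0" "e > 0"
  shows "\<exists>h. harm_poly h \<and> (\<forall>x\<in>sphere a R. \<bar>v x - h x\<bar> < e)"
proof -
  obtain p where "real_polynomial_function p" "\<And>x. x \<in> sphere a R \<Longrightarrow> \<bar>v x - p x\<bar> < e"
    using Stone_Weierstrass_real_polynomial_function[OF _ assms(1,3)] by auto
  then show ?thesis using rpf_eq_harm_poly_on_sphere[of p R a] assms(2) by auto
qed

lemma harm_poly_le_on_ball:
  fixes p :: "real ^ 'n::finite \<Rightarrow> real"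
  assumes "harm_poly p" "R > 0" "\<And>x. x \<in> sphere a R \<Longrightarrow> p x \<le> c" "x \<in> cball a R"
  shows "p x \<le> c"
proof -
  have "p x - c \<le> 0"
  proof (rule maximum_principle[of "ball a R"])
    show "\<exists>g L. has_lap (\<lambda>x. p x - c) x g L \<and> 0 \<le> L" for x
      using has_lap_diff[OF harm_poly_has_lap[OF assms(1)] has_lap_const[of c]] by fastforce
    show "continuous_on (closure (ball a R)) (\<lambda>x. p x - c)"
      by (intro continuous_intros harm_poly_continuous_on assms)
  qed (use assms in auto)
  then show ?thesis by simp
qed

section \<open>Uniform limits of harmonic polynomials\<close>

lemma harm_poly_partial_deriv_bound:
  fixes p :: "real ^ 'n::finite \<Rightarrow> real" and M :: real
  assumes p: "harm_poly p" and M: "\<And>y. y \<in> cball a R \<Longrightarrow> \<bar>p y\<bar> \<le> M"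
    and x: "x \<in> cball a r" and "r < R"
  shows "\<bar>partial_deriv i p x\<bar> \<le> (CARD('n))\<^sup>2 * M / (R - r)"
proof (rule harmonic_gradient_bound)
  show "\<exists>g. has_lap p y g 0" for y using harm_poly_has_lap[OF p] by blast
  show "\<bar>p y\<bar> \<le> M" if "y \<in> cball x (R - r)" for y
  proof (rule M)
    show "y \<in> cball a R"
      using that x dist_triangle[of a y x] by simp
  qed
qed (use assms in \<open>auto intro: harm_poly_continuous_on\<close>)

text \<open>The working notion of a harmonic function on a closed ball. The sequence stays visible
  because its partial derivatives converge to those of the limit, so the notion reproduces itself
  under differentiation on smaller balls.\<close>

definition hconv :: "(nat \<Rightarrow> real ^ 'n::finite \<Rightarrow> real) \<Rightarrow> (real ^ 'n \<Rightarrow> real) \<Rightarrow> real ^ 'n \<Rightarrow> real \<Rightarrow> bool"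
  where "hconv P u a R \<longleftrightarrow> (\<forall>j. harm_poly (P j)) \<and> uniform_limit (cball a R) P u sequentially"

lemma hconv_continuous_on:
  assumes "hconv P u a R"
  shows "continuous_on (cball a R) u"
  using assms unfolding hconv_def
  by (intro uniform_limit_theorem[of _ P "sequentially"])
    (auto intro!: always_eventually harm_poly_continuous_on)

lemma hconv_tendsto:
  assumes "hconv P u a R" "x \<in> cball a R"
  shows "(\<lambda>j. P j x) \<longlonglongrightarrow> u x"
  using assms unfolding hconv_def by (auto intro: tendsto_uniform_limitI)

lemma hconv_approx:
  assumes "hconv P u a R" "e > 0"
  obtains p where "harm_poly p" "\<And>x. x \<in> cball a R \<Longrightarrow> \<bar>p x - u x\<bar> < e"
proof -
  have "\<forall>\<^sub>F j in sequentially. \<forall>x\<in>cball a R. dist (P j x) (u x) < e"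
    using assms by (auto simp: hconv_def dest: uniform_limitD)
  then obtain j where "\<forall>x\<in>cball a R. dist (P j x) (u x) < e"
    by (auto simp: eventually_sequentially)
  with that[of "P j"] assms(1) show ?thesis by (auto simp: hconv_def dist_real_def)
qed

lemma harm_poly_Cauchy_partial_deriv:
  fixes P :: "nat \<Rightarrow> real ^ 'n::finite \<Rightarrow> real"
  assumes P: "\<And>j. harm_poly (P j)" and C: "uniformly_Cauchy_on (cball a R) P" and "r < R"
  shows "uniformly_Cauchy_on (cball a r) (\<lambda>j. partial_deriv i (P j))"
proof (rule uniformly_Cauchy_onI)
  fix e :: real assume "e > 0"
  define K where "K = (real CARD('n))\<^sup>2 / (R - r)"
  have "K > 0" unfolding K_def using \<open>r < R\<close> by simp
  define d where "d = e / (2 * K)"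
  have "d > 0" using \<open>e > 0\<close> \<open>K > 0\<close> by (simp add: d_def)
  with C obtain N where N: "\<And>m n x. m \<ge> N \<Longrightarrow> n \<ge> N \<Longrightarrow> x \<in> cball a R \<Longrightarrow> dist (P m x) (P n x) < d"
    unfolding uniformly_Cauchy_on_def by meson
  have "dist (partial_deriv i (P m) x) (partial_deriv i (P n) x) < e"
    if "x \<in> cball a r" "m \<ge> N" "n \<ge> N" for x m n
  proof -
    have h: "harm_poly (\<lambda>y. P m y - P n y)" by (intro harm_poly_diff P)
    have "\<bar>partial_deriv i (\<lambda>y. P m y - P n y) x\<bar> \<le> (CARD('n))\<^sup>2 * d / (R - r)"
      by (rule harm_poly_partial_deriv_bound[OF h _ that(1) \<open>r < R\<close>])
        (use N that in \<open>auto simp: dist_real_def less_imp_le\<close>)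
    also have "\<dots> = K * d" by (simp add: K_def)
    also have "\<dots> < e" using \<open>e > 0\<close> \<open>K > 0\<close> by (simp add: d_def)
    also have "partial_deriv i (\<lambda>y. P m y - P n y) x = partial_deriv i (P m) x - partial_deriv i (P n) x"
      using has_lap_imp_derivs(1)[OF has_lap_diff[OF harm_poly_has_lap[OF P] harm_poly_has_lap[OF P]], of i m n x]
      by simp
    finally show ?thesis by (simp add: dist_real_def)
  qed
  then show "\<exists>M. \<forall>x\<in>cball a r. \<forall>m\<ge>M. \<forall>n\<ge>M. dist (partial_deriv i (P m) x) (partial_deriv i (P n) x) < e"
    by blast
qed

text \<open>The gradient estimate, applied to differences of the polynomials, makes the partial
  derivatives uniformly Cauchy on a smaller ball; the limit is then differentiated term by term
  along coordinate lines.\<close>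

lemma hconv_partial_deriv:
  fixes P :: "nat \<Rightarrow> real ^ 'n::finite \<Rightarrow> real"
  assumes u: "hconv P u a R" and R: "R > 0"
  shows "hconv (\<lambda>j. partial_deriv i (P j)) (partial_deriv i u) a (R / 2)"
    and "\<And>x. x \<in> cball a (R / 2) \<Longrightarrow>
      ((\<lambda>t. u (x + t *\<^sub>R axis i 1)) has_real_derivative partial_deriv i u x) (at 0)"
proof -
  have P: "harm_poly (P j)" for j using u by (simp add: hconv_def)
  have rpf: "real_polynomial_function (P j)" for j using P by (simp add: harm_poly_def)
  have "uniformly_convergent_on (cball a R) P"
    using u unfolding hconv_def uniformly_convergent_on_def by blast
  then have "uniformly_Cauchy_on (cball a R) P" by (rule uniformly_convergent_Cauchy)
  \<comment> \<open>The radius 3R/4 leaves a segment of half-length R/4 around every point of the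
    ball of radius R/2.\<close>
  then have "uniformly_Cauchy_on (cball a (3 * R / 4)) (\<lambda>j. partial_deriv i (P j))"
    using R by (intro harm_poly_Cauchy_partial_deriv[OF P]) auto
  then have "uniformly_convergent_on (cball a (3 * R / 4)) (\<lambda>j. partial_deriv i (P j))"
    by (simp add: uniformly_convergent_eq_Cauchy)
  then obtain q where q: "uniform_limit (cball a (3 * R / 4)) (\<lambda>j. partial_deriv i (P j)) q sequentially"
    unfolding uniformly_convergent_on_def by blast
  have deriv: "((\<lambda>t. u (x + t *\<^sub>R axis i 1)) has_real_derivative q x) (at 0)" if x: "x \<in> cball a (R / 2)" for x
  proof -
    define S where "S = cball (0::real) (R / 4)"
    have in_ball: "x + t *\<^sub>R axis i 1 \<in> cball a (3 * R / 4)" if "t \<in> S" for t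
    proof -
      have "dist x (x + t *\<^sub>R axis i 1) \<le> R / 4" using that by (simp add: S_def dist_norm norm_axis_1)
      then show ?thesis using x dist_triangle[of a "x + t *\<^sub>R axis i 1" x] by simp
    qed
    have "\<exists>g. \<forall>t\<in>S. (\<lambda>j. P j (x + t *\<^sub>R axis i 1)) \<longlonglongrightarrow> g t \<and>
       (g has_derivative (\<lambda>h. q (x + t *\<^sub>R axis i 1) * h)) (at t within S)"
    proof (rule has_derivative_sequence)
      show "convex S" "0 \<in> S" using R by (auto simp: S_def)
      show "((\<lambda>t. P j (x + t *\<^sub>R axis i 1)) has_derivative (\<lambda>h. partial_deriv i (P j) (x + t *\<^sub>R axis i 1) * h)) (at t within S)" for j t
      proof -
        have "((\<lambda>t. P j (x + t *\<^sub>R axis i 1)) has_real_derivative partial_deriv i (P j) (x + t *\<^sub>R axis i 1)) (at t)"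
          by (rule line_deriv_shift)
            (use rpf_has_partial_deriv[OF rpf] in \<open>auto simp: field_differentiable_def\<close>)
        then show ?thesis by (simp add: has_field_derivative_def has_derivative_at_withinI)
      qed
      have "x + 0 *\<^sub>R axis i 1 \<in> cball a R" using x R by (simp add: mem_cball)
      then show "(\<lambda>j. P j (x + 0 *\<^sub>R axis i 1)) \<longlonglongrightarrow> u (x + 0 *\<^sub>R axis i 1)"
        by (rule hconv_tendsto[OF u])
      fix e :: real assume "e > 0"
      with q have "\<forall>\<^sub>F j in sequentially. \<forall>y\<in>cball a (3 * R / 4). dist (partial_deriv i (P j) y) (q y) < e"
        by (auto dest: uniform_limitD)
      then show "\<forall>\<^sub>F j in sequentially. \<forall>t\<in>S. \<forall>h. norm (partial_deriv i (P j) (x + t *\<^sub>R axis i 1) * h -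
          q (x + t *\<^sub>R axis i 1) * h) \<le> e * norm h"
      proof eventually_elim
        case (elim j)
        show ?case
        proof (intro ballI allI)
          fix t h assume "t \<in> S"
          then have "\<bar>partial_deriv i (P j) (x + t *\<^sub>R axis i 1) - q (x + t *\<^sub>R axis i 1)\<bar> \<le> e"
            using in_ball elim by (auto simp: dist_real_def intro: less_imp_le)
          then show "norm (partial_deriv i (P j) (x + t *\<^sub>R axis i 1) * h - q (x + t *\<^sub>R axis i 1) * h) \<le> e * norm h"
            by (simp add: abs_mult mult_right_mono flip: left_diff_distrib)
        qed
      qed
    qed
    then obtain g where g: "\<And>t. t \<in> S \<Longrightarrow> (\<lambda>j. P j (x + t *\<^sub>R axis i 1)) \<longlonglongrightarrow> g t"
      "\<And>t. t \<in> S \<Longrightarrow> (g has_derivative (\<lambda>h. q (x + t *\<^sub>R axis i 1) * h)) (at t within S)" by blast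
    have gu: "u (x + t *\<^sub>R axis i 1) = g t" if "t \<in> S" for t
    proof (rule LIMSEQ_unique[OF _ g(1)[OF that]])
      show "(\<lambda>j. P j (x + t *\<^sub>R axis i 1)) \<longlonglongrightarrow> u (x + t *\<^sub>R axis i 1)"
        using in_ball[OF that] R by (intro hconv_tendsto[OF u]) auto
    qed
    have "0 \<in> interior S" using R by (simp add: S_def)
    have "(g has_derivative (\<lambda>h. q x * h)) (at 0)"
      using g(2)[of 0] at_within_interior[OF \<open>0 \<in> interior S\<close>] R by (simp add: S_def)
    then have g_deriv: "(g has_real_derivative q x) (at 0)" by (simp add: has_field_derivative_def)
    have "\<forall>\<^sub>F t in nhds 0. g t = u (x + t *\<^sub>R axis i 1)"
      using eventually_nhds_in_open[of "interior S" 0] \<open>0 \<in> interior S\<close> interior_subset[of S] gu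
      by (auto elim!: eventually_mono)
    from DERIV_cong_ev[OF refl this refl, of "q x"] g_deriv show ?thesis by blast
  qed
  have eq: "partial_deriv i u x = q x" if "x \<in> cball a (R / 2)" for x
    unfolding partial_deriv_def by (rule DERIV_imp_deriv[OF deriv[OF that]])
  show "((\<lambda>t. u (x + t *\<^sub>R axis i 1)) has_real_derivative partial_deriv i u x) (at 0)"
    if "x \<in> cball a (R / 2)" for x
    using deriv[OF that] eq[OF that] by simp
  have "uniform_limit (cball a (R / 2)) (\<lambda>j. partial_deriv i (P j)) q sequentially"
    using q by (rule uniform_limit_on_subset) (use R in auto)
  then have "uniform_limit (cball a (R / 2)) (\<lambda>j. partial_deriv i (P j)) (partial_deriv i u) sequentially"
    by (rule uniform_limit_cong'[THEN iffD1, rotated -1]) (auto simp: eq)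
  then show "hconv (\<lambda>j. partial_deriv i (P j)) (partial_deriv i u) a (R / 2)"
    using P by (auto simp: hconv_def intro: harm_poly_partial_deriv)
qed

lemma hconv_C1_on:
  assumes u: "hconv P u a R" and R: "R > 0"
  shows "C1_on (ball a (R / 2)) u"
  unfolding C1_on_def
proof (intro conjI allI ballI)
  show "continuous_on (ball a (R / 2)) u"
    by (rule continuous_on_subset[OF hconv_continuous_on[OF u]]) (use R in auto)
  show "continuous_on (ball a (R / 2)) (partial_deriv i u)" for i
    by (rule continuous_on_subset[OF hconv_continuous_on[OF hconv_partial_deriv(1)[OF u R]]]) auto
  show "(\<lambda>t. u (x + t *\<^sub>R axis i 1)) field_differentiable at 0" if "x \<in> ball a (R / 2)" for x i
    using hconv_partial_deriv(2)[OF u R, of x i] that unfolding field_differentiable_def by auto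
qed

text \<open>Each differentiation halves the radius, hence R/4; the Laplacian is a pointwise limit of
  zeros.\<close>

lemma hconv_harmonic:
  assumes u: "hconv P u a R" and R: "R > 0"
  shows "C2_on (ball a (R / 4)) u" and "\<And>x. x \<in> ball a (R / 4) \<Longrightarrow> laplacian u x = 0"
proof -
  have R2: "R / 2 > 0" using R by simp
  have "C1_on (ball a (R / 4)) u"
    using hconv_C1_on[OF u R] R unfolding C1_on_def
    by (auto intro: continuous_on_subset)
  moreover have "C1_on (ball a (R / 4)) (partial_deriv i u)" for i
    using hconv_C1_on[OF hconv_partial_deriv(1)[OF u R, of i] R2] by simp
  ultimately show "C2_on (ball a (R / 4)) u" by (simp add: C2_on_def)
  fix x assume x: "x \<in> ball a (R / 4)"
  have "(\<lambda>j. partial_deriv i (partial_deriv i (P j)) x) \<longlonglongrightarrow> partial_deriv i (partial_deriv i u) x" for i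
    using hconv_tendsto[OF hconv_partial_deriv(1)[OF hconv_partial_deriv(1)[OF u R, of i] R2, of i], of x] x by auto
  then have "(\<lambda>j. laplacian (P j) x) \<longlonglongrightarrow> laplacian u x"
    unfolding laplacian_def by (intro tendsto_sum) auto
  moreover have "laplacian (P j) x = 0" for j using u by (auto simp: hconv_def harm_poly_def)
  ultimately show "laplacian u x = 0" by (simp add: LIMSEQ_const_iff)
qed

lemma hconv_if_approx:
  assumes "\<And>e. e > 0 \<Longrightarrow> \<exists>p. harm_poly p \<and> (\<forall>x\<in>cball a R. \<bar>p x - u x\<bar> \<le> e)"
  shows "\<exists>P. hconv P u a R"
proof -
  have "\<forall>j. \<exists>p. harm_poly p \<and> (\<forall>x\<in>cball a R. \<bar>p x - u x\<bar> \<le> 1 / real (Suc j))"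
    by (intro allI assms) simp
  then obtain P where P: "\<And>j. harm_poly (P j)"
    "\<And>j x. x \<in> cball a R \<Longrightarrow> \<bar>P j x - u x\<bar> \<le> 1 / real (Suc j)" by metis
  have "uniform_limit (cball a R) P u sequentially"
  proof (rule uniform_limitI)
    fix e :: real assume "e > 0"
    then obtain N where "1 / real (Suc N) < e" using nat_approx_posE by blast
    then have "\<forall>x\<in>cball a R. dist (P j x) (u x) < e" if "j \<ge> N" for j
      using P(2)[of _ j] that frac_le[of 1 1 "real (Suc N)" "real (Suc j)"] by (force simp: dist_real_def)
    then show "\<forall>\<^sub>F j in sequentially. \<forall>x\<in>cball a R. dist (P j x) (u x) < e"
      by (auto simp: eventually_sequentially)
  qed
  with P(1) show ?thesis by (auto simp: hconv_def)
qed

text \<open>The radius is chosen before the accuracy e: then one sequence of polynomials converges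
  uniformly on a fixed ball around each point.\<close>

lemma harmonic_if_locally_approx:
  assumes D: "open D"
    and approx: "\<And>a. a \<in> D \<Longrightarrow> \<exists>R>0. \<forall>e>0. \<exists>p. harm_poly p \<and> (\<forall>x\<in>cball a R. \<bar>p x - u x\<bar> \<le> e)"
  shows "C2_on D u" and "\<And>x. x \<in> D \<Longrightarrow> laplacian u x = 0"
proof -
  have *: "\<exists>r>0. C2_on (ball a r) u \<and> laplacian u a = 0" if a: "a \<in> D" for a
  proof -
    obtain R where R: "R > 0" "\<And>e. e > 0 \<Longrightarrow> \<exists>p. harm_poly p \<and> (\<forall>x\<in>cball a R. \<bar>p x - u x\<bar> \<le> e)"
      using approx[OF a] by blast
    obtain P where "hconv P u a R" using hconv_if_approx[OF R(2)] by blast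
    from hconv_harmonic[OF this R(1)] show ?thesis
      using R(1) by (intro exI[of _ "R / 4"]) auto
  qed
  then show "laplacian u x = 0" if "x \<in> D" for x using that by blast
  have cont: "continuous_on D f" if "\<And>a. a \<in> D \<Longrightarrow> \<exists>r>0. continuous_on (ball a r) f" for f :: "real^'a \<Rightarrow> real"
  proof -
    have "isCont f a" if a: "a \<in> D" for a
    proof -
      obtain r where "r > 0" "continuous_on (ball a r) f"
        using \<open>\<And>a. a \<in> D \<Longrightarrow> \<exists>r>0. continuous_on (ball a r) f\<close>[OF a] by blast
      then show ?thesis by (simp add: continuous_on_eq_continuous_at)
    qed
    then show ?thesis by (simp add: continuous_at_imp_continuous_on)
  qed
  have C1: "C1_on D f" if "\<And>a. a \<in> D \<Longrightarrow> \<exists>r>0. C1_on (ball a r) f" for f :: "real^'a \<Rightarrow> real"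
    unfolding C1_on_def
  proof (intro conjI allI ballI cont)
    show "\<exists>r>0. continuous_on (ball a r) f" if "a \<in> D" for a
      using \<open>\<And>a. a \<in> D \<Longrightarrow> \<exists>r>0. C1_on (ball a r) f\<close>[OF that] by (auto simp: C1_on_def)
    show "\<exists>r>0. continuous_on (ball a r) (partial_deriv i f)" if "a \<in> D" for a i
      using \<open>\<And>a. a \<in> D \<Longrightarrow> \<exists>r>0. C1_on (ball a r) f\<close>[OF that] by (auto simp: C1_on_def)
    show "(\<lambda>t. f (a + t *\<^sub>R axis i 1)) field_differentiable at 0" if "a \<in> D" for a i
      using \<open>\<And>a. a \<in> D \<Longrightarrow> \<exists>r>0. C1_on (ball a r) f\<close>[OF that] by (auto simp: C1_on_def)
  qed
  show "C2_on D u"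
    unfolding C2_on_def using * by (intro conjI allI C1) (auto simp: C2_on_def)
qed

text \<open>Two good approximations on the sphere are close to each other there, hence by the
  maximum principle in the whole ball, so the polynomials are uniformly Cauchy inside.\<close>

lemma harmonic_extension_to_ball:
  fixes v :: "real ^ 'n::finite \<Rightarrow> real"
  assumes v: "continuous_on (sphere a R) v" and R: "R > 0"
  obtains P h where "hconv P h a R" "\<And>x. x \<in> sphere a R \<Longrightarrow> h x = v x"
proof -
  have "\<forall>j. \<exists>p. harm_poly p \<and> (\<forall>x\<in>sphere a R. \<bar>v x - p x\<bar> < 1 / real (Suc j))"
    by (intro allI harm_poly_approx_on_sphere v R) simp
  then obtain P where P: "\<And>j. harm_poly (P j)"
    "\<And>j x. x \<in> sphere a R \<Longrightarrow> \<bar>v x - P j x\<bar> < 1 / real (Suc j)" by metis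
  have diff: "P i x - P j x \<le> 1 / real (Suc i) + 1 / real (Suc j)" if "x \<in> cball a R" for i j x
  proof (rule harm_poly_le_on_ball[OF harm_poly_diff[OF P(1) P(1)] R _ that])
    fix y assume "y \<in> sphere a R"
    from P(2)[OF this, of i] P(2)[OF this, of j]
    show "P i y - P j y \<le> 1 / real (Suc i) + 1 / real (Suc j)" by linarith
  qed
  have "uniformly_Cauchy_on (cball a R) P"
  proof (rule uniformly_Cauchy_onI)
    fix e :: real assume "e > 0"
    then obtain N where N: "1 / real (Suc N) < e / 2" using nat_approx_posE[of "e / 2"] by auto
    have small: "1 / real (Suc j) < e / 2" if "j \<ge> N" for j
      using N that frac_le[of 1 1 "real (Suc N)" "real (Suc j)"] by simp
    have "dist (P i x) (P j x) < e" if "x \<in> cball a R" "i \<ge> N" "j \<ge> N" for x i j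
      using diff[OF that(1), of i j] diff[OF that(1), of j i] small[OF that(2)] small[OF that(3)]
      unfolding dist_real_def by linarith
    then show "\<exists>M. \<forall>x\<in>cball a R. \<forall>m\<ge>M. \<forall>n\<ge>M. dist (P m x) (P n x) < e" by blast
  qed
  then obtain h where h: "uniform_limit (cball a R) P h sequentially"
    using uniformly_convergent_eq_Cauchy uniformly_convergent_on_def by metis
  then have hc: "hconv P h a R" using P(1) by (simp add: hconv_def)
  have "h x = v x" if "x \<in> sphere a R" for x
  proof (rule LIMSEQ_unique)
    show "(\<lambda>j. P j x) \<longlonglongrightarrow> h x" using that by (intro hconv_tendsto[OF hc]) auto
    have "(\<lambda>j. v x - P j x) \<longlonglongrightarrow> 0"
    proof (rule Lim_null_comparison)
      show "\<forall>\<^sub>F j in sequentially. norm (v x - P j x) \<le> 1 / real (Suc j)"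
        using P(2)[OF that] by (auto intro!: always_eventually less_imp_le)
      show "(\<lambda>j. 1 / real (Suc j)) \<longlonglongrightarrow> 0" using LIMSEQ_inverse_real_of_nat by (simp add: inverse_eq_divide)
    qed
    from tendsto_diff[OF tendsto_const[of "v x"] this] show "(\<lambda>j. P j x) \<longlonglongrightarrow> v x" by simp
  qed
  with hc that show ?thesis by blast
qed

section \<open>Perron's method\<close>

definition subharm :: "(real ^ 'n::finite) set \<Rightarrow> (real ^ 'n \<Rightarrow> real) \<Rightarrow> bool"
  \<comment> \<open>harmonic polynomials suffice as comparison functions, since they are dense on spheres\<close>
  where "subharm D v \<longleftrightarrow> continuous_on D v \<and>
    (\<forall>a r p. r > 0 \<longrightarrow> cball a r \<subseteq> D \<longrightarrow> harm_poly p \<longrightarrow> (\<forall>x\<in>sphere a r. v x \<le> p x) \<longrightarrow>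
      (\<forall>x\<in>cball a r. v x \<le> p x))"

definition superharm :: "(real ^ 'n::finite) set \<Rightarrow> (real ^ 'n \<Rightarrow> real) \<Rightarrow> bool"
  where "superharm D w \<longleftrightarrow>
    (\<forall>a r p. r > 0 \<longrightarrow> cball a r \<subseteq> D \<longrightarrow> harm_poly p \<longrightarrow> (\<forall>x\<in>sphere a r. p x \<le> w x) \<longrightarrow>
      (\<forall>x\<in>cball a r. p x \<le> w x))"

lemma subharmD:
  assumes "subharm D v" "r > 0" "cball a r \<subseteq> D" "harm_poly p"
    "\<And>x. x \<in> sphere a r \<Longrightarrow> v x \<le> p x" "x \<in> cball a r"
  shows "v x \<le> p x"
  using assms unfolding subharm_def by blast

lemma superharmD:
  assumes "superharm D w" "r > 0" "cball a r \<subseteq> D" "harm_poly p"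
    "\<And>x. x \<in> sphere a r \<Longrightarrow> p x \<le> w x" "x \<in> cball a r"
  shows "p x \<le> w x"
  using assms unfolding superharm_def by blast

lemma harm_poly_subharm:
  assumes "harm_poly q"
  shows "subharm D q"
  unfolding subharm_def
proof (intro conjI allI impI ballI)
  show "continuous_on D q" using assms by (rule harm_poly_continuous_on)
  fix a r p x assume "r > 0" "harm_poly p" "\<forall>x\<in>sphere a r. q x \<le> p x" "x \<in> cball a r"
  then have "q x - p x \<le> 0"
    by (intro harm_poly_le_on_ball[OF harm_poly_diff[OF assms \<open>harm_poly p\<close>] \<open>r > 0\<close> _ \<open>x \<in> cball a r\<close>]) simp
  then show "q x \<le> p x" by simp
qed

lemma superharm_of_has_lap:
  assumes cont: "continuous_on D w"
    and lap: "\<And>x. x \<in> D \<Longrightarrow> \<exists>g L. has_lap w x g L \<and> L \<le> 0"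
  shows "superharm D w"
  unfolding superharm_def
proof (intro allI impI ballI)
  fix a r p x assume r: "r > 0" "cball a r \<subseteq> D" and p: "harm_poly p"
    and le: "\<forall>x\<in>sphere a r. p x \<le> w x" and x: "x \<in> cball a r"
  have "p x - w x \<le> 0"
  proof (rule maximum_principle[of "ball a r"])
    show "continuous_on (closure (ball a r)) (\<lambda>x. p x - w x)"
      using r by (intro continuous_intros harm_poly_continuous_on p continuous_on_subset[OF cont]) auto
    show "\<exists>g L. has_lap (\<lambda>x. p x - w x) x g L \<and> 0 \<le> L" if "x \<in> ball a r" for x
    proof -
      have "x \<in> D" using that r(2) by auto
      then obtain g L where "has_lap w x g L" "L \<le> 0" using lap by blast
      with has_lap_diff[OF harm_poly_has_lap[OF p] this(1)] show ?thesis by fastforce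
    qed
  qed (use r x le in auto)
  then show "p x \<le> w x" by simp
qed

lemma subharm_max:
  assumes "subharm D v" "subharm D w"
  shows "subharm D (\<lambda>x. max (v x) (w x))"
  unfolding subharm_def
proof (intro conjI allI impI ballI)
  show "continuous_on D (\<lambda>x. max (v x) (w x))"
    using assms by (intro continuous_on_max) (auto simp: subharm_def)
  fix a r p x
  assume "r > 0" "cball a r \<subseteq> D" "harm_poly p" "\<forall>x\<in>sphere a r. max (v x) (w x) \<le> p x" "x \<in> cball a r"
  then show "max (v x) (w x) \<le> p x"
    using subharmD[OF assms(1), of r a p x] subharmD[OF assms(2), of r a p x] by auto
qed

text \<open>The Poisson modification: inside the ball \<open>v\<close> is replaced by the harmonic
  function with the same values on the sphere. The result stays below \<open>W\<close> because
  superharmonicity can be tested on this very ball.\<close>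

lemma subharm_lift:
  fixes v :: "real ^ 'n::finite \<Rightarrow> real"
  assumes v: "subharm D v" and R: "R > 0" and ball: "cball a R \<subseteq> D"
    and W: "\<And>w. w \<in> W \<Longrightarrow> superharm D w"
    and vW: "\<And>w x. w \<in> W \<Longrightarrow> x \<in> D \<Longrightarrow> v x \<le> w x"
  obtains v' P where "subharm D v'" "\<And>x. x \<in> D \<Longrightarrow> v x \<le> v' x"
    "\<And>w x. w \<in> W \<Longrightarrow> x \<in> D \<Longrightarrow> v' x \<le> w x" "hconv P v' a R"
proof -
  have cv: "continuous_on D v" using v by (simp add: subharm_def)
  obtain P h where P: "hconv P h a R" and hv: "\<And>x. x \<in> sphere a R \<Longrightarrow> h x = v x"
    using harmonic_extension_to_ball[OF continuous_on_subset[OF cv] R, of a] ball by (metis dual_order.trans sphere_cball)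
  define v' where "v' x = (if x \<in> cball a R then h x else v x)" for x
  have ch: "continuous_on (cball a R) h" using P by (rule hconv_continuous_on)
  have v_le_h: "v x \<le> h x" if x: "x \<in> cball a R" for x
  proof (rule field_le_epsilon)
    fix e :: real assume "e > 0"
    then have e': "e / 2 > 0" by simp
    obtain p where p: "harm_poly p" "\<And>x. x \<in> cball a R \<Longrightarrow> \<bar>p x - h x\<bar> < e / 2"
      using hconv_approx[OF P e'] by blast
    have "v x \<le> p x + e / 2"
    proof (rule subharmD[OF v R ball harm_poly_add[OF p(1) harm_poly_const] _ x])
      fix y assume y: "y \<in> sphere a R"
      then have "y \<in> cball a R" by simp
      from p(2)[OF this] hv[OF y] show "v y \<le> p y + e / 2" by linarith
    qed
    then show "v x \<le> h x + e" using p(2)[OF x] by linarith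
  qed
  have h_le_w: "h x \<le> w x" if x: "x \<in> cball a R" and w: "w \<in> W" for x w
  proof (rule field_le_epsilon)
    fix e :: real assume "e > 0"
    then have e': "e / 2 > 0" by simp
    obtain p where p: "harm_poly p" "\<And>x. x \<in> cball a R \<Longrightarrow> \<bar>p x - h x\<bar> < e / 2"
      using hconv_approx[OF P e'] by blast
    have "p x - e / 2 \<le> w x"
    proof (rule superharmD[OF W[OF w] R ball harm_poly_diff[OF p(1) harm_poly_const] _ x])
      fix y assume y: "y \<in> sphere a R"
      then have "y \<in> cball a R" by simp
      moreover from this have "y \<in> D" using ball by auto
      ultimately show "p y - e / 2 \<le> w y" using p(2)[of y] hv[OF y] vW[OF w, of y] by linarith
    qed
    then show "h x \<le> w x + e" using p(2)[OF x] by linarith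
  qed
  have vv': "v x \<le> v' x" for x using v_le_h by (simp add: v'_def)
  have "subharm D v'"
    unfolding subharm_def
  proof (intro conjI allI impI ballI)
    have D: "D = cball a R \<union> (D - ball a R)" using ball by auto
    have "continuous_on (cball a R \<union> (D - ball a R)) (\<lambda>x. if x \<in> cball a R then h x else v x)"
    proof (rule continuous_on_cases_local)
      show "closedin (top_of_set (cball a R \<union> (D - ball a R))) (cball a R)"
        by (rule closedin_subset_trans[of UNIV]) auto
      show "closedin (top_of_set (cball a R \<union> (D - ball a R))) (D - ball a R)"
      proof -
        have "D - ball a R = (cball a R \<union> (D - ball a R)) \<inter> - ball a R" using ball by auto
        moreover have "closed (- ball a R)" by auto
        ultimately show ?thesis by (metis closedin_closed_Int)
      qed
      show "continuous_on (D - ball a R) v" using cv by (rule continuous_on_subset) auto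
      show "h x = v x" if "x \<in> cball a R \<and> x \<notin> cball a R \<or> x \<in> D - ball a R \<and> x \<in> cball a R" for x
        using that by (intro hv) auto
    qed (rule ch)
    then show "continuous_on D v'" using D by (simp add: v'_def[abs_def])
    fix b r p x assume r: "r > 0" "cball b r \<subseteq> D" and p: "harm_poly p"
      and le: "\<forall>x\<in>sphere b r. v' x \<le> p x" and x: "x \<in> cball b r"
    have vp: "v y \<le> p y" if "y \<in> cball b r" for y
      by (rule subharmD[OF v r p _ that]) (use order_trans[OF vv'] le in blast)
    \<comment> \<open>A comparison ball may straddle the ball of replacement. A common point that is
      not in both open balls lies on \<open>sphere a R\<close>, where h = v, or on
      \<open>sphere b r\<close>, where \<open>p\<close> dominates by assumption. The maximum
      principle on the intersection does the rest.\<close>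
    have bd: "h y \<le> p y" if "y \<in> cball a R" "y \<in> cball b r" "y \<notin> ball a R \<inter> ball b r" for y
    proof (cases "y \<in> sphere a R")
      case True
      then show ?thesis using hv[of y] vp[of y] that by simp
    next
      case False
      then have "y \<in> sphere b r" using that by auto
      then have "v' y \<le> p y" using le by blast
      then show ?thesis using that by (simp add: v'_def)
    qed
    show "v' x \<le> p x"
    proof (cases "x \<in> cball a R")
      case False
      then show ?thesis using vp[OF x] by (simp add: v'_def)
    next
      case True
      have "h x \<le> p x"
      proof (cases "x \<in> ball a R \<inter> ball b r")
        case False
        then show ?thesis using bd True x by auto
      next
        case inside: True
        show ?thesis
        proof (rule field_le_epsilon)
          fix e :: real assume "e > 0"
          then have e': "e / 2 > 0" by simp
          obtain q where q: "harm_poly q" "\<And>x. x \<in> cball a R \<Longrightarrow> \<bar>q x - h x\<bar> < e / 2"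
            using hconv_approx[OF P e'] by blast
          have hp: "harm_poly (\<lambda>x. q x - p x - e / 2)"
            by (intro harm_poly_diff harm_poly_const p q)
          have "q x - p x - e / 2 \<le> 0"
          proof (rule maximum_principle[of "ball a R \<inter> ball b r"])
            show "\<exists>g L. has_lap (\<lambda>x. q x - p x - e / 2) y g L \<and> 0 \<le> L" for y
              using harm_poly_has_lap[OF hp] by blast
            show "q y - p y - e / 2 \<le> 0" if "y \<in> frontier (ball a R \<inter> ball b r)" for y
            proof -
              have "closure (ball a R \<inter> ball b r) \<subseteq> cball a R \<inter> cball b r"
                by (intro closure_minimal) auto
              then have "y \<in> cball a R" "y \<in> cball b r" "y \<notin> ball a R \<inter> ball b r"
                using that by (auto simp: frontier_def interior_open open_Int)
              from bd[OF this] q(2)[OF this(1)] show ?thesis by linarith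
            qed
            show "x \<in> closure (ball a R \<inter> ball b r)" by (rule subsetD[OF closure_subset inside])
          qed (auto intro: harm_poly_continuous_on[OF hp])
          then show "h x \<le> p x + e" using q(2)[OF True] by linarith
        qed
      qed
      then show ?thesis using True by (simp add: v'_def)
    qed
  qed
  moreover have "v' x \<le> w x" if "w \<in> W" "x \<in> D" for w x
    using h_le_w vW that by (simp add: v'_def)
  moreover have "hconv P v' a R"
  proof -
    have "uniform_limit (cball a R) P h sequentially" using P by (simp add: hconv_def)
    then have "uniform_limit (cball a R) P v' sequentially"
      by (rule uniform_limit_cong'[THEN iffD1, rotated -1]) (auto simp: v'_def)
    then show ?thesis using P by (simp add: hconv_def)
  qed
  ultimately show ?thesis using vv' that by blast
qed

lemma harm_poly_Lipschitz:
  fixes p :: "real ^ 'n::finite \<Rightarrow> real" and M :: real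
  assumes p: "harm_poly p" and M: "\<And>x. x \<in> cball a R \<Longrightarrow> \<bar>p x\<bar> \<le> M" and R: "R > 0"
    and xy: "x \<in> cball a (R / 2)" "y \<in> cball a (R / 2)"
  shows "\<bar>p x - p y\<bar> \<le> (CARD('n) * ((CARD('n))\<^sup>2 * M / (R / 2))) * norm (x - y)"
proof -
  define K where "K = (CARD('n))\<^sup>2 * M / (R / 2)"
  have rpf: "real_polynomial_function p" using p by (simp add: harm_poly_def)
  then have "\<forall>x. \<exists>D. (p has_derivative D) (at x)"
    using differentiable_at_real_polynomial_function unfolding differentiable_def by blast
  then obtain D where D: "\<And>x. (p has_derivative D x) (at x)" by metis
  have bnd: "\<bar>partial_deriv i p z\<bar> \<le> K" if "z \<in> cball a (R / 2)" for i z
    using harm_poly_partial_deriv_bound[where R=R and i=i, OF p M that] R by (simp add: K_def)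
  have "norm (p x - p y) \<le> (CARD('n) * K) * norm (x - y)"
  proof (rule differentiable_bound[of "cball a (R / 2)" p D])
    show "(p has_derivative D z) (at z within cball a (R / 2))" for z
      using D by (rule has_derivative_at_withinI)
    show "onorm (D z) \<le> CARD('n) * K" if z: "z \<in> cball a (R / 2)" for z
    proof (rule onorm_le)
      fix h :: "real ^ 'n"
      interpret bounded_linear "D z" using D by (rule has_derivative_bounded_linear)
      have pd: "D z (axis i 1) = partial_deriv i p z" for i
      proof (rule DERIV_unique[OF _ rpf_has_partial_deriv[OF rpf, of z i]])
        have "((\<lambda>t. z + t *\<^sub>R axis i 1) has_derivative (\<lambda>t. t *\<^sub>R axis i 1)) (at 0)"
          by (auto intro!: derivative_eq_intros)
        from has_derivative_compose[OF this, of p "D z"] D[of z]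
        have "((\<lambda>t. p (z + t *\<^sub>R axis i 1)) has_derivative (\<lambda>t. D z (t *\<^sub>R axis i 1))) (at 0)"
          by simp
        then show "((\<lambda>t. p (z + t *\<^sub>R axis i 1)) has_real_derivative D z (axis i 1)) (at 0)"
          by (simp add: scaleR has_field_derivative_def mult_commute_abs)
      qed
      have "D z h = D z (\<Sum>i\<in>UNIV. (h $ i) *\<^sub>R axis i 1)"
        using basis_expansion[of h] by (simp add: scalar_mult_eq_scaleR)
      also have "\<dots> = (\<Sum>i\<in>UNIV. h $ i * partial_deriv i p z)"
        by (simp add: sum scaleR pd)
      finally have "norm (D z h) \<le> (\<Sum>i\<in>UNIV. \<bar>h $ i * partial_deriv i p z\<bar>)" by simp
      also have "\<dots> \<le> (\<Sum>i\<in>(UNIV::'n set). norm h * K)"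
        unfolding abs_mult by (intro sum_mono mult_mono bnd z component_le_norm_cart) auto
      finally show "norm (D z h) \<le> CARD('n) * K * norm h" by (simp add: mult_ac)
    qed
  qed (use xy in auto)
  then show ?thesis by (simp add: K_def)
qed

text \<open>The constant depends only on the bound \<open>M\<close>, which makes all lifted
  functions in Perron's method equicontinuous. M + 1 bounds the approximating polynomial.\<close>

lemma hconv_Lipschitz:
  fixes v :: "real ^ 'n::finite \<Rightarrow> real" and M :: real
  assumes v: "hconv P v a R" and M: "\<And>x. x \<in> cball a R \<Longrightarrow> \<bar>v x\<bar> \<le> M" and R: "R > 0"
    and xy: "x \<in> cball a (R / 2)" "y \<in> cball a (R / 2)"
  shows "\<bar>v x - v y\<bar> \<le> (CARD('n) * ((CARD('n))\<^sup>2 * (M + 1) / (R / 2))) * norm (x - y)"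
proof (rule field_le_epsilon)
  fix e :: real assume "e > 0"
  then have e': "min 1 (e / 2) > 0" by simp
  obtain p where p: "harm_poly p" "\<And>x. x \<in> cball a R \<Longrightarrow> \<bar>p x - v x\<bar> < min 1 (e / 2)"
    using hconv_approx[OF v e'] by blast
  have "\<bar>p z\<bar> \<le> M + 1" if "z \<in> cball a R" for z using M[OF that] p(2)[OF that] by linarith
  from harm_poly_Lipschitz[OF p(1) this R xy]
  have "\<bar>p x - p y\<bar> \<le> (CARD('n) * ((CARD('n))\<^sup>2 * (M + 1) / (R / 2))) * norm (x - y)" .
  moreover have "x \<in> cball a R" "y \<in> cball a R" using xy R by auto
  ultimately show "\<bar>v x - v y\<bar> \<le> (CARD('n) * ((CARD('n))\<^sup>2 * (M + 1) / (R / 2))) * norm (x - y) + e"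
    using p(2)[of x] p(2)[of y] by linarith
qed

text \<open>Boundary values do not occur: \<open>W\<close> holds the upper barriers, and lower
  barriers enter through the last conclusion. Harmonicity is obtained without monotone sequences:
  lifted competitors share a Lipschitz constant on a ball, so the maximum of finitely many, one for
  each point of a net, is after lifting uniformly close to the supremum and is itself a limit of
  harmonic polynomials.\<close>

theorem perron:
  fixes D :: "(real ^ 'n::finite) set" and W :: "(real ^ 'n \<Rightarrow> real) set"
  assumes D: "open D"
    and W: "\<And>w. w \<in> W \<Longrightarrow> superharm D w"
    and w0: "w0 \<in> W" "continuous_on D w0"
    and v0: "subharm D v0" "\<And>w x. w \<in> W \<Longrightarrow> x \<in> D \<Longrightarrow> v0 x \<le> w x"
  obtains u where "C2_on D u" "\<And>x. x \<in> D \<Longrightarrow> laplacian u x = 0"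
    "\<And>w x. w \<in> W \<Longrightarrow> x \<in> D \<Longrightarrow> u x \<le> w x"
    "\<And>v x. subharm D v \<Longrightarrow> (\<And>w y. w \<in> W \<Longrightarrow> y \<in> D \<Longrightarrow> v y \<le> w y) \<Longrightarrow> x \<in> D \<Longrightarrow> v x \<le> u x"
proof -
  define F where "F = {v. subharm D v \<and> (\<forall>w\<in>W. \<forall>x\<in>D. v x \<le> w x)}"
  define u where "u x = (SUP v\<in>F. v x)" for x
  have F0: "v0 \<in> F" using v0 by (auto simp: F_def)
  have bdd: "bdd_above ((\<lambda>v. v x) ` F)" if "x \<in> D" for x
    using w0(1) that by (intro bdd_aboveI2[of _ _ "w0 x"]) (auto simp: F_def)
  have upper: "v x \<le> u x" if "v \<in> F" "x \<in> D" for v x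
    unfolding u_def using bdd that by (intro cSUP_upper) auto
  have least: "u x \<le> c" if "\<And>v. v \<in> F \<Longrightarrow> v x \<le> c" for x c
    unfolding u_def using F0 that by (intro cSUP_least) auto
  have approached: "\<exists>v\<in>F. u x - e < v x" if "x \<in> D" "e > 0" for x e
    using less_cSUP_iff[OF _ bdd[OF that(1)], of "u x - e"] F0 that(2) by (auto simp: u_def)
  have F_max: "(\<lambda>x. max (v x) (w x)) \<in> F" if "v \<in> F" "w \<in> F" for v w
    using that subharm_max by (auto simp: F_def)
  have F_Max: "\<exists>v\<in>F. \<forall>z\<in>K. \<forall>x. f z x \<le> v x" if "finite K" "\<And>z. z \<in> K \<Longrightarrow> f z \<in> F"
    for K :: "(real^'n) set" and f
    using that
  proof (induction K rule: finite_induct)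
    case empty
    then show ?case using F0 by blast
  next
    case (insert z K)
    have "\<exists>v\<in>F. \<forall>z\<in>K. \<forall>x. f z x \<le> v x" using insert.IH insert.prems by simp
    then obtain v where v: "v \<in> F" "\<And>z x. z \<in> K \<Longrightarrow> f z x \<le> v x" by blast
    show ?case
    proof (rule bexI)
      show "\<forall>z'\<in>insert z K. \<forall>x. f z' x \<le> max (f z x) (v x)" using v(2) by (simp add: le_max_iff_disj)
      show "(\<lambda>x. max (f z x) (v x)) \<in> F" using v(1) insert.prems by (intro F_max) auto
    qed
  qed
  have "\<exists>R>0. \<forall>e>0. \<exists>p. harm_poly p \<and> (\<forall>x\<in>cball a R. \<bar>p x - u x\<bar> \<le> e)" if a: "a \<in> D" for a
  proof -
    obtain R where R: "R > 0" "cball a R \<subseteq> D" using D a open_contains_cball by blast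
    define S where "S = cball a (R / 2)"
    have S: "S \<subseteq> cball a R" "S \<subseteq> D" using R by (auto simp: S_def)
    have "compact (w0 ` cball a R)" "compact (v0 ` cball a R)"
      using w0(2) v0(1) R(2) by (auto intro!: compact_continuous_image simp: subharm_def intro: continuous_on_subset)
    then obtain B1 B2 where B: "\<And>x. x \<in> cball a R \<Longrightarrow> \<bar>w0 x\<bar> \<le> B1" "\<And>x. x \<in> cball a R \<Longrightarrow> \<bar>v0 x\<bar> \<le> B2"
      by (metis bounded_iff compact_imp_bounded imageI real_norm_def)
    define M where "M = max B1 B2"
    define L where "L = CARD('n) * ((CARD('n))\<^sup>2 * (M + 1) / (R / 2))"
    have "M \<ge> 0" using B(1)[of a] R by (auto simp: M_def)
    then have "L \<ge> 0" using R by (simp add: L_def)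
    \<comment> \<open>Taking the maximum with \<open>v0\<close> first bounds the lifted function
      from below, so that \<open>M\<close> bounds its absolute value independently of
      \<open>v\<close>.\<close>
    have lift: "\<exists>v'\<in>F. (\<forall>x\<in>D. v x \<le> v' x) \<and> (\<exists>P. hconv P v' a R) \<and>
        (\<forall>x\<in>S. \<forall>y\<in>S. \<bar>v' x - v' y\<bar> \<le> L * norm (x - y))" if "v \<in> F" for v
    proof -
      have "(\<lambda>x. max (v x) (v0 x)) \<in> F" using F_max[OF that F0] .
      then have sub: "subharm D (\<lambda>x. max (v x) (v0 x))"
        and le: "\<And>w x. w \<in> W \<Longrightarrow> x \<in> D \<Longrightarrow> max (v x) (v0 x) \<le> w x"
        unfolding F_def by blast+
      obtain v' P where v': "subharm D v'" "\<And>x. x \<in> D \<Longrightarrow> max (v x) (v0 x) \<le> v' x"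
        "\<And>w x. w \<in> W \<Longrightarrow> x \<in> D \<Longrightarrow> v' x \<le> w x" "hconv P v' a R"
        by (rule subharm_lift[where v="\<lambda>x. max (v x) (v0 x)" and W=W, OF sub R W])
          (use le in blast)+
      have "\<bar>v' x\<bar> \<le> M" if "x \<in> cball a R" for x
      proof -
        have "x \<in> D" using R that by auto
        then show ?thesis
          using v'(2)[of x] v'(3)[OF w0(1), of x] B[OF that] unfolding M_def by auto
      qed
      from hconv_Lipschitz[OF v'(4) this R(1)]
      have "\<forall>x\<in>S. \<forall>y\<in>S. \<bar>v' x - v' y\<bar> \<le> L * norm (x - y)" by (simp add: S_def L_def)
      then show ?thesis using v' by (intro bexI[of _ v']) (auto simp: F_def)
    qed
    have u_lip: "u x \<le> u y + L * norm (x - y)" if "x \<in> S" "y \<in> S" for x y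
    proof (rule least)
      fix v assume "v \<in> F"
      from lift[OF this] obtain v' where v': "v' \<in> F" "\<And>x. x \<in> D \<Longrightarrow> v x \<le> v' x"
        "\<bar>v' x - v' y\<bar> \<le> L * norm (x - y)" using \<open>x \<in> S\<close> \<open>y \<in> S\<close> by blast
      have "v x \<le> v' x" "v' y \<le> u y" using v' upper that S by auto
      then show "v x \<le> u y + L * norm (x - y)" using v'(3) by linarith
    qed
    have "\<exists>p. harm_poly p \<and> (\<forall>x\<in>S. \<bar>p x - u x\<bar> \<le> e)" if e: "e > 0" for e
    proof -
      \<comment> \<open>Four errors of e/4: moving between \<open>x\<close> and a net point costs
        one for \<open>u\<close> and one for the lifted function, the choice of \<open>f\<close> and
        the polynomial one each. The summand 1 in L + 1 avoids division by zero.\<close>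
      define d where "d = e / 4 / (L + 1)"
      have "d > 0" using e \<open>L \<ge> 0\<close> by (simp add: d_def)
      have Ld: "L * d \<le> e / 4"
      proof -
        have "L * d \<le> (L + 1) * d" using \<open>d > 0\<close> by (simp add: mult_right_mono)
        also have "\<dots> = e / 4"
        proof -
          have "L + 1 \<noteq> 0" using \<open>L \<ge> 0\<close> by linarith
          then show ?thesis unfolding d_def by (metis mult.commute nonzero_eq_divide_eq)
        qed
        finally show ?thesis .
      qed
      have "compact S" by (simp add: S_def)
      moreover have "S \<subseteq> (\<Union>z\<in>S. ball z d)" using \<open>d > 0\<close> by auto
      ultimately obtain K where K: "K \<subseteq> S" "finite K" "S \<subseteq> (\<Union>z\<in>K. ball z d)"
        by (rule compactE_image[of S S "\<lambda>z. ball z d", OF _ open_ball])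
      have "\<forall>z\<in>K. \<exists>v\<in>F. u z - e / 4 < v z"
        using K S e by (intro ballI approached subsetD[OF S(2)]) auto
      then obtain f where f: "\<And>z. z \<in> K \<Longrightarrow> f z \<in> F" "\<And>z. z \<in> K \<Longrightarrow> u z - e / 4 < f z z" by metis
      obtain v where v: "v \<in> F" "\<And>z x. z \<in> K \<Longrightarrow> f z x \<le> v x" using F_Max[where f=f, OF K(2) f(1)] by blast
      obtain v' P where v': "v' \<in> F" "\<And>x. x \<in> D \<Longrightarrow> v x \<le> v' x" "hconv P v' a R"
        "\<And>x y. x \<in> S \<Longrightarrow> y \<in> S \<Longrightarrow> \<bar>v' x - v' y\<bar> \<le> L * norm (x - y)" using lift[OF v(1)] by blast
      obtain p where p: "harm_poly p" "\<And>x. x \<in> cball a R \<Longrightarrow> \<bar>p x - v' x\<bar> < e / 4"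
        using hconv_approx[OF v'(3) divide_pos_pos[OF e zero_less_numeral]] by blast
      have "\<bar>p x - u x\<bar> \<le> e" if x: "x \<in> S" for x
      proof -
        obtain z where z: "z \<in> K" "dist z x < d" using K(3) x by auto
        have zS: "z \<in> S" "z \<in> D" using z K S by auto
        have "L * norm (x - z) \<le> e / 4"
          using mult_left_mono[of "norm (x - z)" d L] z(2) \<open>L \<ge> 0\<close> Ld by (simp add: dist_norm norm_minus_commute)
        moreover have "u x \<le> u z + L * norm (x - z)" using u_lip[OF x zS(1)] .
        moreover have "u z - e / 4 < v' z" using f(2)[OF z(1)] v(2)[OF z(1), of z] v'(2)[OF zS(2)] by linarith
        moreover have "\<bar>v' x - v' z\<bar> \<le> L * norm (x - z)" using v'(4)[OF x zS(1)] .
        moreover have "v' x \<le> u x" using upper v'(1) x S by auto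
        moreover have "\<bar>p x - v' x\<bar> < e / 4" using p(2) x S by auto
        ultimately show ?thesis by linarith
      qed
      then show ?thesis using p(1) by blast
    qed
    then show ?thesis using R(1) unfolding S_def by (intro exI[of _ "R / 2"]) auto
  qed
  note harmonic_if_locally_approx[OF D this]
  moreover have "u x \<le> w x" if "w \<in> W" "x \<in> D" for w x
    by (rule least) (use that in \<open>auto simp: F_def\<close>)
  moreover have "v x \<le> u x"
    if "subharm D v" "\<And>w y. w \<in> W \<Longrightarrow> y \<in> D \<Longrightarrow> v y \<le> w y" "x \<in> D" for v x
    using that by (intro upper) (auto simp: F_def)
  ultimately show ?thesis using that[of u] by blast
qed

section \<open>Barriers\<close>

lemma normsq_tangential:
  fixes x :: "real ^ 'n::finite"
  shows "(norm (tangential l x - tangential l a))\<^sup>2 = (x - a) \<bullet> (x - a) - (x $ l - a $ l)\<^sup>2"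
proof -
  have "(norm (tangential l x - tangential l a))\<^sup>2 = (\<Sum>i\<in>UNIV. if i = l then 0 else (x $ i - a $ i)\<^sup>2)"
    unfolding power2_norm_eq_inner inner_vec_def
    by (intro sum.cong) (auto simp: tangential_def power2_eq_square)
  also have "\<dots> = (\<Sum>i\<in>UNIV - {l}. (x $ i - a $ i)\<^sup>2)"
    by (intro sum.mono_neutral_cong_right) auto
  also have "\<dots> = (\<Sum>i\<in>UNIV. (x $ i - a $ i)\<^sup>2) - (x $ l - a $ l)\<^sup>2"
    by (subst sum_diff1) auto
  finally show ?thesis by (simp add: inner_vec_def power2_eq_square)
qed

lemma eventually_DERIV_powr:
  assumes "(x::real) > 0"
  shows "\<forall>\<^sub>F t in nhds x. ((\<lambda>t. t powr a) has_real_derivative a * t powr (a - 1)) (at t)"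
proof -
  have "\<forall>\<^sub>F t in nhds x. t \<in> {0<..}" using assms by (intro eventually_nhds_in_open) auto
  then show ?thesis by eventually_elim (simp add: has_real_derivative_powr)
qed

text \<open>The function 2 \<rho> / |x' - a'|, smoothed at its axis by
  \<open>\<rho>\<^sup>2\<close>. The factor 2 exceeds sqrt 2, which makes the value at least 1 up to
  distance \<rho>.\<close>

definition spike_barrier :: "'n::finite \<Rightarrow> real ^ 'n \<Rightarrow> real \<Rightarrow> real ^ 'n \<Rightarrow> real"
  where "spike_barrier l a \<rho> x =
    2 * \<rho> * ((norm (tangential l x - tangential l a))\<^sup>2 + \<rho>\<^sup>2) powr (- (1 / 2))"

text \<open>This is where at least four dimensions are needed: \<open>|x'|\<^sup>-\<^sup>1\<close> is superharmonic in at least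
  three variables \<open>x'\<close>.\<close>

lemma has_lap_spike_barrier:
  fixes a :: "real ^ 'n::finite"
  assumes "CARD('n) \<ge> 4" "\<rho> > 0" "x $ l \<ge> 0"
  shows "\<exists>g L. has_lap (\<lambda>x. x $ l * spike_barrier l a \<rho> x) x g L \<and> L \<le> 0"
proof -
  define n where "n = real CARD('n)"
  have n: "n \<ge> 4" using assms(1) by (simp add: n_def)
  define \<sigma> where "\<sigma> x = (x - a) \<bullet> (x - a) - (x $ l - a $ l) * (x $ l - a $ l) + \<rho>\<^sup>2" for x
  have \<sigma>_eq: "\<sigma> x = (norm (tangential l x - tangential l a))\<^sup>2 + \<rho>\<^sup>2" for x
    unfolding \<sigma>_def normsq_tangential by (simp add: power2_eq_square)
  have \<sigma>_pos: "\<sigma> x > 0" for x unfolding \<sigma>_eq using assms(2) by (simp add: add_nonneg_pos)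
  define g where "g = 2 *\<^sub>R (x - a) - ((x $ l - a $ l) *\<^sub>R axis l 1 + (x $ l - a $ l) *\<^sub>R axis l 1)"
  have 1: "has_lap (\<lambda>x. x $ l - a $ l) x (axis l 1) 0"
    using has_lap_diff[OF has_lap_coord has_lap_const] by simp
  have \<sigma>_lap: "has_lap \<sigma> x g (2 * n - 2)"
    unfolding \<sigma>_def
    using has_lap_add[OF has_lap_diff[OF has_lap_normsq[of a x] has_lap_mult[OF 1 1]] has_lap_const[of "\<rho>\<^sup>2"]]
    by (simp add: inner_axis_axis n_def g_def)
  \<comment> \<open>The barrier does not depend on the l-th coordinate, so multiplication by
    \<open>x $ l\<close> produces no cross term.\<close>
  have g_l: "g $ l = 0" by (simp add: g_def axis_def)
  have gen: "(2 *\<^sub>R v - (t *\<^sub>R axis l 1 + t *\<^sub>R axis l 1)) \<bullet> (2 *\<^sub>R v - (t *\<^sub>R axis l 1 + t *\<^sub>R axis l 1))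
      = 4 * (v \<bullet> v) - 8 * t * v $ l + 4 * t * t" for v :: "real ^ 'n" and t :: real
  proof -
    have "t *\<^sub>R axis l 1 + t *\<^sub>R axis l 1 = (2 * t) *\<^sub>R (axis l 1 :: real ^ 'n)"
      by (simp only: scaleR_add_left[symmetric] mult_2)
    then show ?thesis
      by (simp add: inner_diff_left inner_diff_right inner_axis inner_axis' inner_axis_axis algebra_simps)
  qed
  have gg: "g \<bullet> g = 4 * (\<sigma> x - \<rho>\<^sup>2)"
    unfolding g_def gen \<sigma>_def by (simp add: algebra_simps)
  define s where "s = \<sigma> x"
  have s: "s > 0" unfolding s_def by (rule \<sigma>_pos)
  have "has_lap (\<lambda>x. \<sigma> x powr (- (1 / 2))) x ((- (1 / 2) * \<sigma> x powr (- (1 / 2) - 1)) *\<^sub>R g)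
     ((- (1 / 2) * ((- (1 / 2) - 1) * \<sigma> x powr (- (1 / 2) - 1 - 1))) * (g \<bullet> g) + (- (1 / 2) * \<sigma> x powr (- (1 / 2) - 1)) * (2 * n - 2))"
  proof (rule has_lap_chain[OF \<sigma>_lap, where F="\<lambda>t. t powr (- (1 / 2))"])
    show "\<forall>\<^sub>F t in nhds (\<sigma> x). ((\<lambda>t. t powr (- (1 / 2))) has_real_derivative - (1 / 2) * t powr (- (1 / 2) - 1)) (at t)"
      by (rule eventually_DERIV_powr[OF \<sigma>_pos])
    show "((\<lambda>t. - (1 / 2) * t powr (- (1 / 2) - 1)) has_real_derivative
        - (1 / 2) * ((- (1 / 2) - 1) * \<sigma> x powr (- (1 / 2) - 1 - 1))) (at (\<sigma> x))"
      by (intro DERIV_cmult has_real_derivative_powr \<sigma>_pos)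
  qed
  note has_lap_mult[OF has_lap_coord[of l x] has_lap_cmult[OF this, of "2 * \<rho>"]]
  then have 2: "\<exists>g. has_lap (\<lambda>x. x $ l * (2 * \<rho> * \<sigma> x powr (- (1 / 2)))) x g
     (x $ l * (2 * \<rho> * (3 / 4 * s powr (- 5 / 2) * (4 * (s - \<rho>\<^sup>2)) - 1 / 2 * s powr (- 3 / 2) * (2 * n - 2))))"
    by (auto simp: gg s_def[symmetric] inner_axis' g_l)
  have "s powr (- 3 / 2) = s powr (- 5 / 2) * s"
    using s powr_add[of s "- 5 / 2" 1] by simp
  then have "3 / 4 * s powr (- 5 / 2) * (4 * (s - \<rho>\<^sup>2)) - 1 / 2 * s powr (- 3 / 2) * (2 * n - 2)
    = s powr (- 5 / 2) * (3 * (s - \<rho>\<^sup>2) - (n - 1) * s)" by (simp add: field_simps)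
  also have "\<dots> \<le> 0"
  proof (rule mult_nonneg_nonpos)
    \<comment> \<open>The dimension enters as n - 1 >= 3; the smoothing contributes -3 \<rho>^2,
      which has the right sign.\<close>
    have "3 * s \<le> (n - 1) * s" using s n by (intro mult_right_mono) auto
    moreover have "\<rho>\<^sup>2 \<ge> 0" by simp
    ultimately show "3 * (s - \<rho>\<^sup>2) - (n - 1) * s \<le> 0" unfolding right_diff_distrib by linarith
  qed simp
  finally have "x $ l * (2 * \<rho> * (3 / 4 * s powr (- 5 / 2) * (4 * (s - \<rho>\<^sup>2)) - 1 / 2 * s powr (- 3 / 2) * (2 * n - 2))) \<le> 0"
    using assms(2,3) by (intro mult_nonneg_nonpos) auto
  note 3 = this
  have "(\<lambda>x. x $ l * (2 * \<rho> * \<sigma> x powr (- (1 / 2)))) = (\<lambda>x. x $ l * spike_barrier l a \<rho> x)"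
    unfolding spike_barrier_def \<sigma>_eq ..
  from 2[unfolded this] 3 show ?thesis by blast
qed

lemma continuous_on_tangential [continuous_intros]: "continuous_on S (tangential l)"
proof -
  have "continuous_on S (\<lambda>x. if i = l then 0 else x $ i)" for i
    by (cases "i = l") (auto intro!: continuous_intros)
  then show ?thesis unfolding tangential_def by (intro continuous_on_vec_lambda)
qed

lemma spike_barrier_arg_pos:
  assumes "\<rho> > 0"
  shows "(norm (tangential l x - tangential l a))\<^sup>2 + \<rho>\<^sup>2 > 0"
  using assms by (simp add: add_nonneg_pos)

lemma continuous_on_spike_barrier:
  assumes "\<rho> > 0"
  shows "continuous_on S (spike_barrier l a \<rho>)"
  unfolding spike_barrier_def
  using spike_barrier_arg_pos[OF assms] by (intro continuous_intros) (auto simp: less_le)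

lemma spike_barrier_nonneg: "\<rho> > 0 \<Longrightarrow> spike_barrier l a \<rho> x \<ge> 0"
  by (simp add: spike_barrier_def)

lemma spike_barrier_eq:
  assumes "\<rho> > 0"
  shows "spike_barrier l a \<rho> x = 2 * \<rho> / sqrt ((norm (tangential l x - tangential l a))\<^sup>2 + \<rho>\<^sup>2)"
proof -
  have "s powr (- (1 / 2)) = 1 / sqrt s" if "s > 0" for s :: real
    using that by (simp only: powr_minus_divide powr_half_sqrt less_imp_le)
  note this[OF spike_barrier_arg_pos[OF assms, of l x a]]
  then show ?thesis
    unfolding spike_barrier_def by (simp only: times_divide_eq_right mult_1_right)
qed

lemma spike_barrier_ge_1:
  assumes "\<rho> > 0" "norm (tangential l x - tangential l a) \<le> \<rho>"
  shows "spike_barrier l a \<rho> x \<ge> 1"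
proof -
  have "(norm (tangential l x - tangential l a))\<^sup>2 \<le> \<rho>\<^sup>2" using assms by (intro power_mono) auto
  moreover have "(2 * \<rho>)\<^sup>2 = 4 * \<rho>\<^sup>2" by (simp add: power_mult_distrib)
  ultimately have "(norm (tangential l x - tangential l a))\<^sup>2 + \<rho>\<^sup>2 \<le> (2 * \<rho>)\<^sup>2"
    using zero_le_power2[of \<rho>] by linarith
  then have "sqrt ((norm (tangential l x - tangential l a))\<^sup>2 + \<rho>\<^sup>2) \<le> 2 * \<rho>"
    using assms by (intro real_le_lsqrt) auto
  moreover have "sqrt ((norm (tangential l x - tangential l a))\<^sup>2 + \<rho>\<^sup>2) > 0"
    using spike_barrier_arg_pos[OF assms(1), of l x a] by simp
  ultimately show ?thesis by (simp add: spike_barrier_eq[OF assms(1)])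
qed

lemma spike_barrier_le:
  assumes "\<rho> > 0" "d > 0" "d \<le> norm (tangential l x - tangential l a)"
  shows "spike_barrier l a \<rho> x \<le> 2 * \<rho> / d"
  unfolding spike_barrier_eq[OF assms(1)]
proof (rule divide_left_mono)
  have "d\<^sup>2 \<le> (norm (tangential l x - tangential l a))\<^sup>2" using assms by (intro power_mono) auto
  then show "d \<le> sqrt ((norm (tangential l x - tangential l a))\<^sup>2 + \<rho>\<^sup>2)"
    by (intro real_le_rsqrt) (simp add: add_increasing2)
  show "0 < sqrt ((norm (tangential l x - tangential l a))\<^sup>2 + \<rho>\<^sup>2) * d"
    using spike_barrier_arg_pos[OF assms(1), of l x a] assms(2) by simp
qed (use assms in auto)

section \<open>The barrier for an exterior cone\<close>

lemma has_lap_norm: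
  fixes \<xi> :: "real ^ 'n::finite"
  assumes "x \<noteq> \<xi>"
  defines "r \<equiv> norm (x - \<xi>)"
  shows "has_lap (\<lambda>x. norm (x - \<xi>)) x ((1 / r) *\<^sub>R (x - \<xi>)) ((real CARD('n) - 1) / r)"
proof -
  define \<sigma> where "\<sigma> x = (x - \<xi>) \<bullet> (x - \<xi>)" for x
  have pos: "\<sigma> x > 0" using assms(1) by (simp add: \<sigma>_def)
  have r: "r > 0" "sqrt (\<sigma> x) = r" "\<sigma> x = r * r" using assms(1)
    by (simp_all add: r_def \<sigma>_def norm_eq_sqrt_inner)
  have "has_lap (\<lambda>x. sqrt (\<sigma> x)) x ((inverse (sqrt (\<sigma> x)) / 2) *\<^sub>R (2 *\<^sub>R (x - \<xi>)))
    ((- (inverse (sqrt (\<sigma> x)) * (inverse (sqrt (\<sigma> x)) / 2) * inverse (sqrt (\<sigma> x))) / 2) * ((2 *\<^sub>R (x - \<xi>)) \<bullet> (2 *\<^sub>R (x - \<xi>)))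
      + (inverse (sqrt (\<sigma> x)) / 2) * (2 * CARD('n)))"
  proof (rule has_lap_chain[where F=sqrt and F'="\<lambda>t. inverse (sqrt t) / 2"])
    show "has_lap \<sigma> x (2 *\<^sub>R (x - \<xi>)) (2 * CARD('n))"
      unfolding \<sigma>_def by (rule has_lap_normsq)
    show "\<forall>\<^sub>F t in nhds (\<sigma> x). (sqrt has_real_derivative inverse (sqrt t) / 2) (at t)"
      using eventually_nhds_in_open[of "{0<..}" "\<sigma> x"] pos
      by (auto elim!: eventually_mono intro: DERIV_real_sqrt)
    show "((\<lambda>t. inverse (sqrt t) / 2) has_real_derivative
        - (inverse (sqrt (\<sigma> x)) * (inverse (sqrt (\<sigma> x)) / 2) * inverse (sqrt (\<sigma> x))) / 2) (at (\<sigma> x))"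
      by (rule DERIV_cdivide[OF DERIV_inverse'[OF DERIV_real_sqrt]]) (use pos in auto)
  qed
  moreover have "(2 *\<^sub>R (x - \<xi>)) \<bullet> (2 *\<^sub>R (x - \<xi>)) = 4 * (r * r)"
    using r(3) by (simp add: \<sigma>_def)
  ultimately have "has_lap (\<lambda>x. sqrt (\<sigma> x)) x ((inverse r / 2) *\<^sub>R (2 *\<^sub>R (x - \<xi>)))
    ((- (inverse r * (inverse r / 2) * inverse r) / 2) * (4 * (r * r)) + (inverse r / 2) * (2 * CARD('n)))"
    unfolding r(2) by (simp only:)
  then have "has_lap (\<lambda>x. sqrt (\<sigma> x)) x ((1 / r) *\<^sub>R (x - \<xi>)) ((real CARD('n) - 1) / r)"
    by (rule has_lap_eq) (use r(1) in \<open>auto simp: field_simps\<close>)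
  then show ?thesis by (simp add: \<sigma>_def norm_eq_sqrt_inner)
qed

lemma has_lap_powr:
  assumes w: "has_lap w x g L" and pos: "w x > 0"
  shows "has_lap (\<lambda>x. w x powr a) x ((a * w x powr a / w x) *\<^sub>R g)
    (a * (w x powr a / w x) * ((a - 1) / w x * (g \<bullet> g) + L))"
proof (rule has_lap_eq[OF has_lap_chain[OF w, where F="\<lambda>t. t powr a" and F'="\<lambda>t. a * t powr (a - 1)"]])
  show "\<forall>\<^sub>F t in nhds (w x). ((\<lambda>t. t powr a) has_real_derivative a * t powr (a - 1)) (at t)"
    by (rule eventually_DERIV_powr[OF pos])
  show "((\<lambda>t. a * t powr (a - 1)) has_real_derivative a * ((a - 1) * w x powr (a - 1 - 1))) (at (w x))"
    by (intro DERIV_cmult has_real_derivative_powr pos)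
qed (use pos in \<open>auto simp: powr_diff power2_eq_square algebra_simps\<close>)

text \<open>The function \<open>s = |y| + y\<^sub>l\<close> vanishes on the negative \<open>l\<close>-axis and satisfies
  \<open>|\<nabla>s|\<^sup>2 = 2 s / r\<close> and \<open>\<Delta>s = (n - 1) / r\<close>, so that products of powers of \<open>r\<close> and \<open>s\<close> have explicit
  Laplacians.\<close>

lemma has_lap_axis_power:
  fixes \<xi> :: "real ^ 'n::finite"
  assumes s_pos: "norm (x - \<xi>) + (x - \<xi>) $ l > 0"
  defines "r \<equiv> norm (x - \<xi>)" and "s \<equiv> norm (x - \<xi>) + (x - \<xi>) $ l" and "n \<equiv> real CARD('n)"
  shows "\<exists>g. has_lap (\<lambda>x. norm (x - \<xi>) powr a * (norm (x - \<xi>) + (x - \<xi>) $ l) powr (- q)) x g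
    (r powr a * s powr (- q) / r\<^sup>2 * (a * (a + n - 2) - 2 * a * q + q * (2 * q + 3 - n) * (r / s)))"
proof -
  have "x \<noteq> \<xi>" using s_pos by auto
  then have r: "r > 0" by (simp add: r_def)
  have s: "s > 0" using s_pos by (simp add: s_def)
  have yy: "(x - \<xi>) \<bullet> (x - \<xi>) = r * r" by (simp add: r_def flip: power2_norm_eq_inner power2_eq_square)
  have yl: "(x - \<xi>) $ l = s - r" by (simp add: r_def s_def)
  note 1 = has_lap_norm[OF \<open>x \<noteq> \<xi>\<close>, folded r_def n_def]
  have A: "has_lap (\<lambda>x. norm (x - \<xi>) powr a) x ((a * r powr a / r) *\<^sub>R ((1 / r) *\<^sub>R (x - \<xi>)))
     (a * (r powr a / r) * ((a - 1) / r * 1 + (n - 1) / r))"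
    by (rule has_lap_eq[OF has_lap_powr[OF 1]])
      (use r in \<open>auto simp: r_def[symmetric] yy\<close>)
  define gs where "gs = (1 / r) *\<^sub>R (x - \<xi>) + axis l 1"
  have "has_lap (\<lambda>x. norm (x - \<xi>) + (x $ l - \<xi> $ l)) x ((1 / r) *\<^sub>R (x - \<xi>) + (axis l 1 - 0)) ((n - 1) / r + (0 - 0))"
    by (intro has_lap_add has_lap_diff 1 has_lap_coord has_lap_const)
  then have S: "has_lap (\<lambda>x. norm (x - \<xi>) + (x - \<xi>) $ l) x gs ((n - 1) / r)" by (simp add: gs_def)
  have gsgs: "gs \<bullet> gs = 2 * s / r"
  proof -
    have "((1 / r) *\<^sub>R v + axis l 1) \<bullet> ((1 / r) *\<^sub>R v + axis l 1) = (1 / r) * (1 / r) * (v \<bullet> v) + 2 * (1 / r) * v $ l + 1"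
      for v :: "real ^ 'n"
      by (simp add: inner_add_left inner_add_right inner_axis inner_axis' inner_axis_axis add_divide_distrib)
    then have "gs \<bullet> gs = (1 / r) * (1 / r) * ((x - \<xi>) \<bullet> (x - \<xi>)) + 2 * (1 / r) * (x - \<xi>) $ l + 1"
      unfolding gs_def .
    also have "\<dots> = 2 * s / r" unfolding yy yl using r by (simp add: field_simps)
    finally show ?thesis .
  qed
  have ygs: "(x - \<xi>) \<bullet> gs = s"
  proof -
    have "(x - \<xi>) \<bullet> gs = (1 / r) * ((x - \<xi>) \<bullet> (x - \<xi>)) + (x - \<xi>) $ l"
      by (simp add: gs_def inner_add_right inner_axis)
    also have "\<dots> = s" unfolding yy yl using r by simp
    finally show ?thesis .
  qed
  have B: "has_lap (\<lambda>x. (norm (x - \<xi>) + (x - \<xi>) $ l) powr (- q)) x ((- q * s powr (- q) / s) *\<^sub>R gs)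
     (- q * (s powr (- q) / s) * ((- q - 1) / s * (2 * s / r) + (n - 1) / r))"
    using has_lap_powr[OF S s_pos, of "- q"] unfolding s_def[symmetric] gsgs .
  define X Y where "X = r powr a" and "Y = s powr (- q)"
  have 2: "Y * (a * (X / r) * ((a - 1) / r * 1 + (n - 1) / r))
     + X * (- q * (Y / s) * ((- q - 1) / s * (2 * s / r) + (n - 1) / r))
     + 2 * ((a * X / r) * (1 / r) * (- q * Y / s) * s)
    = X * Y / r\<^sup>2 * (a * (a + n - 2) - 2 * a * q + q * (2 * q + 3 - n) * (r / s))"
    using r s by (simp add: field_simps power2_eq_square)
  have 3: "((a * X / r) *\<^sub>R ((1 / r) *\<^sub>R (x - \<xi>))) \<bullet> ((- q * Y / s) *\<^sub>R gs) =
     (a * X / r) * (1 / r) * (- q * Y / s) * s"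
    using ygs by simp
  show ?thesis
  proof (rule exI, rule has_lap_eq[OF has_lap_mult[OF A B] refl])
    show "(norm (x - \<xi>) + (x - \<xi>) $ l) powr (- q) * (a * (r powr a / r) * ((a - 1) / r * 1 + (n - 1) / r))
     + norm (x - \<xi>) powr a * (- q * (s powr (- q) / s) * ((- q - 1) / s * (2 * s / r) + (n - 1) / r))
     + 2 * (((a * r powr a / r) *\<^sub>R ((1 / r) *\<^sub>R (x - \<xi>))) \<bullet> ((- q * s powr (- q) / s) *\<^sub>R gs))
    = r powr a * s powr (- q) / r\<^sup>2 * (a * (a + n - 2) - 2 * a * q + q * (2 * q + 3 - n) * (r / s))"
      unfolding s_def[symmetric] unfolding r_def[symmetric] X_def[symmetric] Y_def[symmetric] 3
      by (rule 2)
  qed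
qed

text \<open>With y = x - \<xi>, r = |y| and \<tau> = r / (r + y_l) this is r^\<alpha> (C -
  \<tau>^n). The angular quantity \<tau> is bounded off every cone around the negative l-axis and
  blows up only at that axis, inside the removed cone. Relative to r^(\<alpha>-2), the Laplacian of
  r^\<alpha> tends to 0 with \<alpha> while that of the second term stays bounded below, so a small
  \<alpha> gives superharmonicity without eigenfunctions on the sphere.\<close>

definition cone_barrier :: "'n::finite \<Rightarrow> real ^ 'n \<Rightarrow> real \<Rightarrow> real \<Rightarrow> real ^ 'n \<Rightarrow> real"
  where "cone_barrier l \<xi> \<alpha> C x = C * norm (x - \<xi>) powr \<alpha> -
    norm (x - \<xi>) powr (\<alpha> + real CARD('n)) * (norm (x - \<xi>) + (x - \<xi>) $ l) powr (- real CARD('n))"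

lemma cone_barrier_eq:
  fixes \<xi> :: "real ^ 'n::finite"
  assumes "norm (x - \<xi>) + (x - \<xi>) $ l > 0"
  defines "\<tau> \<equiv> norm (x - \<xi>) / (norm (x - \<xi>) + (x - \<xi>) $ l)"
  shows "norm (x - \<xi>) powr (\<alpha> + real CARD('n)) * (norm (x - \<xi>) + (x - \<xi>) $ l) powr (- real CARD('n)) =
    norm (x - \<xi>) powr \<alpha> * \<tau> ^ CARD('n)"
    and "\<tau> \<ge> 1 / 2"
proof -
  define r s where "r = norm (x - \<xi>)" and "s = norm (x - \<xi>) + (x - \<xi>) $ l"
  have s: "s > 0" using assms(1) by (simp add: s_def)
  have "s \<le> 2 * r" using component_le_norm_cart[of "x - \<xi>" l] unfolding r_def s_def by linarith
  then have r: "r > 0" using s by linarith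
  have "r powr (\<alpha> + real CARD('n)) * s powr (- real CARD('n)) = r powr \<alpha> * (r / s) ^ CARD('n)"
    using r s by (simp add: powr_add powr_minus powr_realpow power_mult_distrib power_inverse divide_inverse)
  then show "norm (x - \<xi>) powr (\<alpha> + real CARD('n)) * (norm (x - \<xi>) + (x - \<xi>) $ l) powr (- real CARD('n)) =
    norm (x - \<xi>) powr \<alpha> * \<tau> ^ CARD('n)" by (simp add: r_def s_def \<tau>_def)
  show "\<tau> \<ge> 1 / 2" unfolding \<tau>_def s_def[symmetric] unfolding r_def[symmetric]
    using \<open>s \<le> 2 * r\<close> s by (simp add: field_simps)
qed

text \<open>In units of r^(\<alpha>-2) the first term has Laplacian at most C \<alpha> (n - 1) and
  the second at least 2^(-n) n (n - 1) / 2, because \<tau> >= 1/2 everywhere. The last hypothesis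
  says that the second wins.\<close>

lemma has_lap_cone_barrier:
  fixes \<xi> :: "real ^ 'n::finite" and \<alpha> C :: real
  assumes n: "CARD('n) \<ge> 2" and s_pos: "norm (x - \<xi>) + (x - \<xi>) $ l > 0"
    and \<alpha>: "0 < \<alpha>" "\<alpha> \<le> 1" and C: "C > 0" "2 * C * \<alpha> * 2 ^ CARD('n) \<le> CARD('n)"
  shows "\<exists>g L. has_lap (cone_barrier l \<xi> \<alpha> C) x g L \<and> L \<le> 0"
proof -
  define n where "n = real CARD('n)"
  have n2: "n \<ge> 2" using assms(1) by (simp add: n_def)
  define r s where "r = norm (x - \<xi>)" and "s = norm (x - \<xi>) + (x - \<xi>) $ l"
  have "x \<noteq> \<xi>" using s_pos by auto
  then have r: "r > 0" by (simp add: r_def)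
  have yy: "(x - \<xi>) \<bullet> (x - \<xi>) = r * r" by (simp add: r_def flip: power2_norm_eq_inner power2_eq_square)
  define \<tau> where "\<tau> = r / s"
  have tau: "r powr (\<alpha> + n) * s powr (- n) = r powr \<alpha> * \<tau> ^ CARD('n)" "\<tau> \<ge> 1 / 2"
    using cone_barrier_eq(1)[OF s_pos, of \<alpha>] cone_barrier_eq(2)[OF s_pos] by (auto simp: r_def s_def n_def \<tau>_def)
  have 1: "has_lap (\<lambda>x. norm (x - \<xi>) powr \<alpha>) x ((\<alpha> * r powr \<alpha> / r) *\<^sub>R ((1 / r) *\<^sub>R (x - \<xi>)))
     (r powr \<alpha> / r\<^sup>2 * (\<alpha> * (\<alpha> + n - 2)))"
  proof (rule has_lap_eq[OF has_lap_powr[OF has_lap_norm[OF \<open>x \<noteq> \<xi>\<close>]]])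
    show "0 < norm (x - \<xi>)" using r by (simp add: r_def)
    have unit: "((1 / r) *\<^sub>R (x - \<xi>)) \<bullet> ((1 / r) *\<^sub>R (x - \<xi>)) = 1" using r by (simp add: yy)
    show "\<alpha> * (norm (x - \<xi>) powr \<alpha> / norm (x - \<xi>)) * ((\<alpha> - 1) / norm (x - \<xi>) *
      (((1 / norm (x - \<xi>)) *\<^sub>R (x - \<xi>)) \<bullet> ((1 / norm (x - \<xi>)) *\<^sub>R (x - \<xi>))) + (real CARD('n) - 1) / norm (x - \<xi>))
      = r powr \<alpha> / r\<^sup>2 * (\<alpha> * (\<alpha> + n - 2))"
      unfolding r_def[symmetric] n_def[symmetric] unit using r by (simp add: field_simps power2_eq_square)
  qed (simp add: r_def)
  define K where "K = (\<alpha> + n) * ((\<alpha> + n) + n - 2) - 2 * (\<alpha> + n) * n + n * (2 * n + 3 - n) * \<tau>"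
  from has_lap_axis_power[OF s_pos, of "\<alpha> + n" n] obtain g where
    g: "has_lap (\<lambda>x. norm (x - \<xi>) powr (\<alpha> + n) * (norm (x - \<xi>) + (x - \<xi>) $ l) powr (- n)) x g
     (r powr (\<alpha> + n) * s powr (- n) / r\<^sup>2 * K)"
    unfolding K_def \<tau>_def r_def s_def n_def by blast
  have 2: "has_lap (\<lambda>x. norm (x - \<xi>) powr (\<alpha> + n) * (norm (x - \<xi>) + (x - \<xi>) $ l) powr (- n)) x g
     (r powr \<alpha> / r\<^sup>2 * (\<tau> ^ CARD('n) * K))"
    by (rule has_lap_eq[OF g refl]) (simp add: tau)
  have K: "K \<ge> n * (n - 1) / 2"
  proof -
    have "n * (n + 3) * (1 / 2) \<le> n * (n + 3) * \<tau>" using tau(2) n2 by (intro mult_left_mono) auto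
    moreover have "\<alpha> * \<alpha> + (n - 2) * \<alpha> \<ge> 0" using n2 \<alpha> by simp
    moreover have "K = (\<alpha> * \<alpha> + (n - 2) * \<alpha>) - 2 * n + n * (n + 3) * \<tau>"
      unfolding K_def by (simp add: algebra_simps)
    moreover have "n * (n + 3) * (1 / 2) - 2 * n = n * (n - 1) / 2" by (simp add: field_simps)
    ultimately show ?thesis by linarith
  qed
  have "C * (\<alpha> * (\<alpha> + n - 2)) \<le> \<tau> ^ CARD('n) * K"
  proof -
    have "C * (\<alpha> * (\<alpha> + n - 2)) \<le> C * (\<alpha> * (n - 1))"
      using C(1) \<alpha> n2 by (intro mult_left_mono) auto
    also have "\<dots> \<le> (1 / 2) ^ CARD('n) * (n * (n - 1) / 2)"
    proof -
      have "2 * C * \<alpha> * 2 ^ CARD('n) * (n - 1) \<le> n * (n - 1)"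
        using C(2) n2 unfolding n_def[symmetric] by (intro mult_right_mono) auto
      then show ?thesis by (simp add: field_simps power_divide)
    qed
    also have "\<dots> \<le> \<tau> ^ CARD('n) * K"
      using tau(2) K n2 by (intro mult_mono power_mono) auto
    finally show ?thesis .
  qed
  then have le: "r powr \<alpha> / r\<^sup>2 * (C * (\<alpha> * (\<alpha> + n - 2)) - \<tau> ^ CARD('n) * K) \<le> 0"
    by (intro mult_nonneg_nonpos) auto
  have "C * (r powr \<alpha> / r\<^sup>2 * (\<alpha> * (\<alpha> + n - 2))) - r powr \<alpha> / r\<^sup>2 * (\<tau> ^ CARD('n) * K) \<le> 0"
  proof -
    have "X * (C * P - Q) = C * (X * P) - X * Q" for X P Q :: real by (simp add: algebra_simps)
    from this[of "r powr \<alpha> / r\<^sup>2"] le show ?thesis by metis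
  qed
  moreover note has_lap_diff[OF has_lap_cmult[OF 1, of C] 2]
  ultimately show ?thesis unfolding cone_barrier_def[abs_def] n_def by blast
qed

text \<open>Outside the cone \<tau> is at most 1 / \<kappa>, so \<open>C - 1\<close> absorbs
  \<tau>^n and one full r^\<alpha> is left over.\<close>

lemma cone_barrier_bounds:
  fixes \<xi> :: "real ^ 'n::finite"
  assumes \<kappa>: "\<kappa> > 0" and s: "\<kappa> * norm (x - \<xi>) \<le> norm (x - \<xi>) + (x - \<xi>) $ l" and "x \<noteq> \<xi>"
    and C: "C \<ge> (1 / \<kappa>) ^ CARD('n) + 1"
  shows "norm (x - \<xi>) powr \<alpha> \<le> cone_barrier l \<xi> \<alpha> C x"
    and "cone_barrier l \<xi> \<alpha> C x \<le> C * norm (x - \<xi>) powr \<alpha>"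
proof -
  define r \<sigma> where "r = norm (x - \<xi>)" and "\<sigma> = norm (x - \<xi>) + (x - \<xi>) $ l"
  have r: "r > 0" using assms by (simp add: r_def)
  have "0 < \<kappa> * r" using \<kappa> r by simp
  also have s': "\<kappa> * r \<le> \<sigma>" using s by (simp add: r_def \<sigma>_def)
  finally have \<sigma>: "\<sigma> > 0" .
  have eq: "cone_barrier l \<xi> \<alpha> C x = C * r powr \<alpha> - r powr \<alpha> * (r / \<sigma>) ^ CARD('n)"
    using cone_barrier_eq(1)[of x \<xi> l \<alpha>] \<sigma> unfolding cone_barrier_def r_def \<sigma>_def by simp
  have "r / \<sigma> \<le> 1 / \<kappa>" using s' \<sigma> \<kappa> by (simp add: field_simps)
  then have "(r / \<sigma>) ^ CARD('n) \<le> (1 / \<kappa>) ^ CARD('n)"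
    using r \<sigma> by (intro power_mono) auto
  then have "r powr \<alpha> * (r / \<sigma>) ^ CARD('n) \<le> r powr \<alpha> * (C - 1)"
    using C by (intro mult_left_mono) auto
  then show "norm (x - \<xi>) powr \<alpha> \<le> cone_barrier l \<xi> \<alpha> C x"
    unfolding eq r_def[symmetric] by (simp add: algebra_simps)
  have "r powr \<alpha> * (r / \<sigma>) ^ CARD('n) \<ge> 0" using r \<sigma> by simp
  then show "cone_barrier l \<xi> \<alpha> C x \<le> C * norm (x - \<xi>) powr \<alpha>"
    unfolding eq r_def[symmetric] by linarith
qed

lemma continuous_on_cone_barrier:
  fixes \<xi> :: "real ^ 'n::finite"
  assumes "\<And>x. x \<in> D \<Longrightarrow> norm (x - \<xi>) + (x - \<xi>) $ l > 0"
  shows "continuous_on D (cone_barrier l \<xi> \<alpha> C)"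
proof -
  have "norm (x - \<xi>) \<noteq> 0" if "x \<in> D" for x using assms[OF that] by auto
  then show ?thesis unfolding cone_barrier_def[abs_def] using assms
    by (intro continuous_intros) (auto simp: less_le)
qed

text \<open>The opening of the cone fixes \<open>C\<close> first; then \<alpha> is the value with
  equality in \<open>2 * C * \<alpha> * 2 ^ n \<le> real n\<close>. It is at most 1 because n <= 2^n
  and C >= 1.\<close>

lemma cone_barrier_parameters:
  fixes \<kappa> :: real
  assumes "\<kappa> > 0" "n \<ge> 1"
  obtains \<alpha> C :: real where "0 < \<alpha>" "\<alpha> \<le> 1" "C > 0" "2 * C * \<alpha> * 2 ^ n \<le> real n" "C \<ge> (1 / \<kappa>) ^ n + 1"
proof -
  define C where "C = (1 / \<kappa>) ^ n + 1"
  have C: "C \<ge> 1" using assms by (simp add: C_def)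
  define \<alpha> where "\<alpha> = real n / (2 * C * 2 ^ n)"
  have "real n \<le> 2 ^ n" using less_exp[of n] by (metis less_imp_le of_nat_le_iff of_nat_numeral of_nat_power)
  also have "\<dots> \<le> 2 * C * 2 ^ n" using C by simp
  finally have "\<alpha> \<le> 1" unfolding \<alpha>_def using C by (simp add: divide_le_eq)
  moreover have "\<alpha> > 0" unfolding \<alpha>_def using C assms by simp
  moreover have "2 * C * \<alpha> * 2 ^ n \<le> real n" unfolding \<alpha>_def using C by simp
  ultimately show ?thesis using that[of \<alpha> C] C by (simp add: C_def)
qed

lemma outside_cone:
  fixes y :: "real ^ 'n::finite"
  assumes "\<theta> > 0" "- \<theta> * y $ l \<le> norm (tangential l y)"
  shows "\<theta>\<^sup>2 / (2 * (1 + \<theta>\<^sup>2)) * norm y \<le> norm y + y $ l"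
proof (cases "y $ l \<ge> 0")
  case True
  have "\<theta>\<^sup>2 / (2 * (1 + \<theta>\<^sup>2)) \<le> 1"
    by (simp add: divide_le_eq add_pos_nonneg)
  then have "\<theta>\<^sup>2 / (2 * (1 + \<theta>\<^sup>2)) * norm y \<le> 1 * norm y" by (intro mult_right_mono) auto
  then show ?thesis using True by linarith
next
  case False
  define z r p where "z = - y $ l" and "r = norm y" and "p = norm (tangential l y)"
  have z: "z > 0" using False by (simp add: z_def)
  have zr: "z \<le> r" using component_le_norm_cart[of y l] unfolding z_def r_def by linarith
  have "tangential l (0::real^'n) = 0" by (simp add: tangential_def vec_eq_iff)
  then have p2: "p\<^sup>2 = r\<^sup>2 - z\<^sup>2"
    using normsq_tangential[of l y 0] by (simp add: p_def r_def z_def power2_norm_eq_inner)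
  have "(\<theta> * z)\<^sup>2 \<le> p\<^sup>2" using assms z by (intro power_mono) (auto simp: z_def p_def intro: mult_nonneg_nonpos)
  then have "\<theta>\<^sup>2 * z\<^sup>2 \<le> r\<^sup>2 - z\<^sup>2" by (simp add: power_mult_distrib p2)
  then have "\<theta>\<^sup>2 * r\<^sup>2 \<le> (1 + \<theta>\<^sup>2) * (r\<^sup>2 - z\<^sup>2)" by (simp add: algebra_simps)
  also have "\<dots> = (1 + \<theta>\<^sup>2) * ((r - z) * (r + z))" by (simp add: power2_eq_square algebra_simps)
  \<comment> \<open>The estimate r + z <= 2 r is the source of the factor 2 in the constant.\<close>
  also have "\<dots> \<le> (1 + \<theta>\<^sup>2) * ((r - z) * (2 * r))" using zr z by (intro mult_left_mono) auto
  finally have "r * (\<theta>\<^sup>2 * r) \<le> r * (2 * (1 + \<theta>\<^sup>2) * (r - z))" by (simp add: power2_eq_square algebra_simps)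
  then have "\<theta>\<^sup>2 * r \<le> 2 * (1 + \<theta>\<^sup>2) * (r - z)" using z zr by (subst (asm) mult_le_cancel_left_pos) auto
  moreover have "2 * (1 + \<theta>\<^sup>2) > 0" by (simp add: add_pos_nonneg)
  ultimately have "\<theta>\<^sup>2 / (2 * (1 + \<theta>\<^sup>2)) * r \<le> r - z" by (simp add: field_simps)
  then show ?thesis by (simp add: r_def z_def)
qed

lemma tangential_diff: "tangential l x - tangential l y = tangential l (x - y)"
  by (simp add: vec_eq_iff tangential_def)

lemma mem_V_iff:
  "x \<in> V l a \<theta> \<longleftrightarrow> norm (tangential l x - tangential l a) \<le> \<theta> * (norm a + a $ l - x $ l)"
proof -
  have "x \<in> V l a \<theta> \<longleftrightarrow> x - norm a *\<^sub>R axis l 1 \<in> V_tilde l a \<theta>"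
    unfolding V_def by (auto simp: image_iff intro!: bexI[of _ "x - norm a *\<^sub>R axis l 1"])
  moreover have "tangential l (x - norm a *\<^sub>R axis l 1) = tangential l x"
    by (simp add: vec_eq_iff tangential_def axis_def)
  moreover have "(x - norm a *\<^sub>R axis l 1) $ l = x $ l - norm a" by (simp add: axis_def)
  ultimately show ?thesis by (auto simp: V_tilde_def algebra_simps)
qed

lemma norm_base: "norm ((1 / 4 ^ m) *\<^sub>R axis f (1::real)) = 1 / 4 ^ m"
  by simp

text \<open>Calibrated to \<open>partial_deriv_step\<close>: gradient constant n^2, difference of
  the solutions at most 3 \<theta>, radius 4^-m / 4. The quotient 12 n^2 \<theta> 4^m equals 4^-m
  precisely for this value.\<close>

definition aperture :: "nat \<Rightarrow> nat \<Rightarrow> real"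
  where "aperture n m = 1 / (12 * (real n)\<^sup>2 * 16 ^ m)"

lemma aperture_pos: "n > 0 \<Longrightarrow> aperture n m > 0"
  by (simp add: aperture_def)

lemma aperture_le:
  assumes "n \<ge> 2"
  shows "16 * aperture n m \<le> 1 / 4 ^ m"
proof -
  have "(2::real)\<^sup>2 \<le> (real n)\<^sup>2" using assms by (intro power_mono) auto
  moreover have "(4::real) ^ m \<le> 16 ^ m" by (intro power_mono) auto
  ultimately have "(12::real) * 2\<^sup>2 * 4 ^ m \<le> 12 * (real n)\<^sup>2 * 16 ^ m"
    by (intro mult_mono) auto
  moreover have "(16::real) * 4 ^ m \<le> 12 * 2\<^sup>2 * 4 ^ m" by simp
  ultimately have "16 * 4 ^ m \<le> 12 * (real n)\<^sup>2 * (16::real) ^ m" by linarith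
  then show ?thesis unfolding aperture_def using assms by (simp add: field_simps)
qed

section \<open>The Dirichlet problem in the spiked cube\<close>

lemma partial_deriv_cong_open:
  assumes "open D" "\<And>x. x \<in> D \<Longrightarrow> u x = v x" "x \<in> D"
  shows "partial_deriv i u x = partial_deriv i v x"
    and "((\<lambda>t. u (x + t *\<^sub>R axis i 1)) has_real_derivative d) (at 0) \<longleftrightarrow>
      ((\<lambda>t. v (x + t *\<^sub>R axis i 1)) has_real_derivative d) (at 0)"
proof -
  have "\<forall>\<^sub>F t in nhds (0::real). x + t *\<^sub>R axis i 1 \<in> D"
    using tendsto_coord_line assms(1,3) by (rule topological_tendstoD)
  then have ev: "\<forall>\<^sub>F t in nhds (0::real). u (x + t *\<^sub>R axis i 1) = v (x + t *\<^sub>R axis i 1)"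
    by eventually_elim (rule assms(2))
  show "partial_deriv i u x = partial_deriv i v x"
    unfolding partial_deriv_def using ev by (rule deriv_cong_ev) simp
  show "((\<lambda>t. u (x + t *\<^sub>R axis i 1)) has_real_derivative d) (at 0) \<longleftrightarrow>
      ((\<lambda>t. v (x + t *\<^sub>R axis i 1)) has_real_derivative d) (at 0)"
    by (rule DERIV_cong_ev[OF refl ev refl])
qed

lemma C1_on_cong_open:
  assumes "open D" "\<And>x. x \<in> D \<Longrightarrow> u x = v x"
  shows "C1_on D u \<longleftrightarrow> C1_on D v"
  unfolding C1_on_def field_differentiable_def
  using partial_deriv_cong_open[where u=u and v=v, OF assms] assms(2) by (simp cong: continuous_on_cong)

lemma harmonic_cong_open:
  assumes "open D" "\<And>x. x \<in> D \<Longrightarrow> u x = v x" "C2_on D u" "\<And>x. x \<in> D \<Longrightarrow> laplacian u x = 0"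
  shows "C2_on D v" "\<And>x. x \<in> D \<Longrightarrow> laplacian v x = 0"
proof -
  have pd: "partial_deriv i u x = partial_deriv i v x" if "x \<in> D" for i x
    using partial_deriv_cong_open(1)[OF assms(1,2) that] by simp
  show "C2_on D v"
    using assms(3) C1_on_cong_open[OF assms(1,2)] C1_on_cong_open[OF assms(1) pd] by (simp add: C2_on_def)
  show "laplacian v x = 0" if "x \<in> D" for x
    using assms(4)[OF that] partial_deriv_cong_open(1)[OF assms(1) pd that] by (simp add: laplacian_def)
qed

lemma dirichlet_solution_has_lap:
  assumes "dirichlet_solution D g u" "open D" "x \<in> D"
  shows "\<exists>h. has_lap u x h 0"
  using C2_on_has_lap[of D u x] assms by (auto simp: dirichlet_solution_def)

lemma dirichlet_solution_unique:
  assumes "dirichlet_solution D g u" "dirichlet_solution D g v" "open D" "bounded D" "x \<in> closure D"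
  shows "v x \<le> u x"
proof -
  have "v x - u x \<le> 0"
  proof (rule maximum_principle[OF assms(3,4) _ _ _ assms(5)])
    show "continuous_on (closure D) (\<lambda>x. v x - u x)"
      using assms(1,2) by (intro continuous_intros) (auto simp: dirichlet_solution_def)
    show "\<exists>g L. has_lap (\<lambda>x. v x - u x) x g L \<and> L \<ge> 0" if x: "x \<in> D" for x
    proof -
      obtain h1 h2 where "has_lap u x h1 0" "has_lap v x h2 0"
        using assms(1-3) x dirichlet_solution_has_lap by metis
      from has_lap_diff[OF this(2,1)] show ?thesis by fastforce
    qed
    show "v x - u x \<le> 0" if "x \<in> frontier D" for x
      using assms(1,2) that by (simp add: dirichlet_solution_def)
  qed
  then show ?thesis by simp
qed

lemma the_dirichlet_solutionI:
  assumes "dirichlet_solution D g u" "open D" "bounded D"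
  shows "the_dirichlet_solution D g u"
  unfolding the_dirichlet_solution_def
  using dirichlet_solution_unique[OF assms(1) _ assms(2,3)] dirichlet_solution_unique[OF _ assms(1) assms(2,3)]
    assms(1) by (auto intro: antisym)

section \<open>Geometry of the spiked cube\<close>

locale spiked_cube =
  fixes f l :: "'n::finite"
  assumes card: "CARD('n) \<ge> 4" and fl: "f \<noteq> l"
begin

definition base :: "nat \<Rightarrow> real ^ 'n"
  where "base m = (1 / 4 ^ m) *\<^sub>R axis f 1"

definition \<theta> :: "nat \<Rightarrow> real"
  where "\<theta> m = aperture CARD('n) m"

definition spike :: "nat \<Rightarrow> (real ^ 'n) set"
  where "spike m = V l (base m) (\<theta> m)"

text \<open>An arbitrary index set treats at once \<open>{1..k}\<close>, the infinite family
  \<open>{1..}\<close> and the half cube without spikes, from which the induction over k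
  starts.\<close>

definition spiked :: "nat set \<Rightarrow> (real ^ 'n) set"
  where "spiked M = Q1_plus l - (\<Union>m\<in>M. spike m)"

lemma theta_pos: "\<theta> m > 0"
  by (simp add: \<theta>_def aperture_pos)

lemma theta_le: "16 * \<theta> m \<le> 1 / 4 ^ m"
  using aperture_le[of "CARD('n)" m] card by (simp add: \<theta>_def)

lemma theta_small: "16 * \<theta> m \<le> 1"
  using theta_le[of m] power_increasing[of 0 m "4::real"] by (simp add: divide_le_eq order_trans)

lemma mem_spike: "x \<in> spike m \<longleftrightarrow> norm (tangential l x - tangential l (base m)) \<le> \<theta> m * (1 / 4 ^ m - x $ l)"
  using fl norm_base[of m f] by (simp add: spike_def mem_V_iff base_def axis_def)

lemma tangential_component_le: "\<bar>x $ f - 1 / 4 ^ m\<bar> \<le> norm (tangential l x - tangential l (base m))"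
  using component_le_norm_cart[of "tangential l x - tangential l (base m)" f] fl
  by (simp add: tangential_def base_def axis_def)

lemma spike_bounds:
  assumes "x \<in> spike m" "x $ l \<ge> 0"
  shows "x $ l \<le> 1 / 4 ^ m" "norm (tangential l x - tangential l (base m)) \<le> \<theta> m / 4 ^ m"
proof -
  have 1: "norm (tangential l x - tangential l (base m)) \<le> \<theta> m * (1 / 4 ^ m - x $ l)"
    using assms(1) by (simp add: mem_spike)
  then have "0 \<le> \<theta> m * (1 / 4 ^ m - x $ l)" using norm_ge_zero order_trans by blast
  then show "x $ l \<le> 1 / 4 ^ m" using theta_pos[of m] by (simp add: zero_le_mult_iff)
  have "\<theta> m * (1 / 4 ^ m - x $ l) \<le> \<theta> m * (1 / 4 ^ m)"
    using theta_pos[of m] assms(2) by (intro mult_left_mono) auto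
  with 1 show "norm (tangential l x - tangential l (base m)) \<le> \<theta> m / 4 ^ m" by simp
qed

lemma quarter_power_le: "m \<ge> 1 \<Longrightarrow> 1 / (4::real) ^ m \<le> 1 / 4"
  using power_increasing[of 1 m "4::real"] by (simp add: divide_le_eq)

text \<open>Keeps the spikes away from the side walls and the top: on them
  \<open>x $ l - 1 + \<bar>x $ i\<bar>\<close> is at most -1/4, so the lower barriers of the walls
  do not interfere.\<close>

lemma spike_component_bound:
  assumes "x \<in> spike m" "x $ l \<ge> 0" "m \<ge> 1"
  shows "x $ l \<le> 1 / 4" "\<bar>x $ i\<bar> \<le> 1 / 2"
proof -
  note b = spike_bounds[OF assms(1,2)] and q = quarter_power_le[OF assms(3)]
  show xl: "x $ l \<le> 1 / 4" using b(1) q by linarith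
  have "\<theta> m / 4 ^ m \<le> 1 / 16"
  proof -
    have "\<theta> m * (1 / 4 ^ m) \<le> (1 / 16) * 1"
      using theta_small[of m] q theta_pos[of m] by (intro mult_mono) auto
    then show ?thesis by simp
  qed
  then have n: "norm (tangential l x - tangential l (base m)) \<le> 1 / 16" using b(2) by linarith
  show "\<bar>x $ i\<bar> \<le> 1 / 2"
  proof (cases "i = l")
    case True
    then show ?thesis using xl assms(2) by simp
  next
    case False
    have "\<bar>x $ i - base m $ i\<bar> \<le> 1 / 16"
      using component_le_norm_cart[of "tangential l x - tangential l (base m)" i] False n
      by (simp add: tangential_def)
    moreover have "\<bar>base m $ i\<bar> \<le> 1 / 4" using q by (auto simp: base_def axis_def)
    ultimately show ?thesis by linarith
  qed
qed

text \<open>Above height 0 the radius of a spike is less than a sixteenth of its height 4^-m, so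
  being half that height away in the f-coordinate alone suffices.\<close>

lemma not_in_spike:
  assumes "x $ l > 0" "(1 / 4 ^ m) / 2 \<le> \<bar>x $ f - 1 / 4 ^ m\<bar>"
  shows "x \<notin> spike m"
proof
  assume "x \<in> spike m"
  then have "(1 / 4 ^ m) / 2 \<le> \<theta> m * (1 / 4 ^ m - x $ l)"
    using assms(2) tangential_component_le[of x m] by (simp add: mem_spike)
  also have "\<dots> < \<theta> m * (1 / 4 ^ m)" using assms(1) theta_pos[of m] by (intro mult_strict_left_mono) auto
  also have "\<dots> \<le> (1 / 16) * (1 / 4 ^ m)" using theta_small[of m] by (intro mult_right_mono) auto
  finally have "(1 / 4 ^ m) / 2 < (1 / 16) * (1 / 4 ^ m :: real)" .
  moreover have "\<not> q / 2 < (1 / 16) * q" if "q > 0" for q :: real using that by linarith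
  ultimately show False by (metis zero_less_divide_1_iff zero_less_numeral zero_less_power)
qed

lemma open_Q1_plus: "open (Q1_plus l :: (real ^ 'n) set)"
proof -
  have "open ((\<Inter>i. {x::real^'n. -1 < x $ i \<and> x $ i < 1}) \<inter> {x. 0 < x $ l})"
    by (auto intro!: open_Int open_INT open_Collect_conj open_Collect_less continuous_intros)
  also have "\<dots> = Q1_plus l" by (auto simp: Q1_plus_def Q1_def upper_half_space_def)
  finally show ?thesis .
qed

lemma closed_spike: "closed (spike m)"
proof -
  have "spike m = {x. norm (tangential l x - tangential l (base m)) \<le> \<theta> m * (1 / 4 ^ m - x $ l)}"
    by (auto simp: mem_spike)
  then show ?thesis by (auto intro!: closed_Collect_le continuous_intros)
qed

lemma spikedI:
  assumes "x \<in> Q1_plus l" "\<And>m. m \<in> M \<Longrightarrow> x \<notin> spike m"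
  shows "x \<in> spiked M"
  using assms by (auto simp: spiked_def)

lemma spiked_pos: "x \<in> spiked M \<Longrightarrow> x $ l > 0"
  by (simp add: spiked_def Q1_plus_def upper_half_space_def)

text \<open>The spikes accumulate only at the origin, because they become short.\<close>

lemma open_spiked: "open (spiked M)"
proof (rule openI)
  fix x assume x: "x \<in> spiked M"
  obtain N where N: "(1 / 4 :: real) ^ N < x $ l"
    using real_arch_pow_inv[OF spiked_pos[OF x], of "1 / 4"] by auto
  define U where "U = (Q1_plus l \<inter> {y. (1 / 4) ^ N < y $ l}) - (\<Union>m\<in>M \<inter> {..N}. spike m)"
  have "open U" unfolding U_def
    by (intro open_Diff open_Int open_Q1_plus open_Collect_less continuous_intros closed_UN)
      (auto intro: closed_spike)
  moreover have "x \<in> U" using x N by (auto simp: U_def spiked_def)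
  moreover have "U \<subseteq> spiked M"
  proof
    fix y assume y: "y \<in> U"
    show "y \<in> spiked M"
    proof (rule spikedI)
      show "y \<in> Q1_plus l" using y by (simp add: U_def)
      fix m assume "m \<in> M"
      show "y \<notin> spike m"
      proof (cases "m \<le> N")
        case True
        then show ?thesis using y \<open>m \<in> M\<close> by (auto simp: U_def)
      next
        case False
        show ?thesis
        proof
          assume "y \<in> spike m"
          moreover have "y $ l > (1 / 4) ^ N" using y by (simp add: U_def)
          moreover from this have "y $ l \<ge> 0" by (smt (verit) zero_le_power zero_le_divide_1_iff)
          ultimately have "y $ l \<le> (1 / 4) ^ m" using spike_bounds(1)[of y m] by (simp add: power_divide)
          also have "\<dots> \<le> (1 / 4) ^ N" using False by (intro power_decreasing) auto
          finally show False using \<open>y $ l > (1 / 4) ^ N\<close> by simp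
        qed
      qed
    qed
  qed
  ultimately show "\<exists>e>0. ball x e \<subseteq> spiked M"
    by (meson open_contains_ball order_trans)
qed

lemma closure_spiked_bounds:
  assumes "x \<in> closure (spiked M)"
  shows "x $ l \<ge> 0" "\<bar>x $ i\<bar> \<le> 1"
proof -
  have "closed ({x::real^'n. 0 \<le> x $ l} \<inter> {x. \<bar>x $ i\<bar> \<le> 1})"
    by (intro closed_Int closed_Collect_le continuous_intros)
  moreover have "spiked M \<subseteq> {x::real^'n. 0 \<le> x $ l} \<inter> {x. \<bar>x $ i\<bar> \<le> 1}"
    by (force simp: spiked_def Q1_plus_def Q1_def upper_half_space_def abs_le_iff dest: spec[of _ i])
  ultimately have "closure (spiked M) \<subseteq> {x::real^'n. 0 \<le> x $ l} \<inter> {x. \<bar>x $ i\<bar> \<le> 1}"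
    by (intro closure_minimal)
  with assms show "x $ l \<ge> 0" "\<bar>x $ i\<bar> \<le> 1" by auto
qed

lemma bounded_spiked: "bounded (spiked M)"
proof -
  have "norm x \<le> CARD('n) * (1::real)" if "x \<in> spiked M" for x
    by (intro norm_le_card_mult closure_spiked_bounds(2)[OF subsetD[OF closure_subset that]])
  then show ?thesis by (auto simp: bounded_iff)
qed

lemma closure_minus_spiked:
  assumes "x \<in> closure (spiked M)" "x \<notin> spiked M"
  shows "(\<exists>m\<in>M. x \<in> spike m \<and> x \<in> Q1_plus l) \<or> x \<notin> Q1_plus l"
  using assms by (auto simp: spiked_def)

lemma frontier_spiked: "frontier (spiked M) = closure (spiked M) - spiked M"
  using open_spiked by (simp add: frontier_def interior_open)

text \<open>By the triangle inequality the cone with vertex \<xi> and the opening of the spike lies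
  in the spike. The domain is therefore outside it, and \<open>cone_barrier\<close> works at every
  point of the spike, not only at its tip. The bound by \<open>x $ l - 1 + \<bar>x $ i\<bar>\<close>
  keeps \<open>w\<close> above the lower barriers of the walls, as membership in the Perron family
  of \<open>solution_exists\<close> demands.\<close>

lemma spike_upper_barrier:
  assumes m: "m \<ge> 1" "m \<in> M" and \<xi>: "\<xi> \<in> spike m" "\<xi> $ l > 0"
  obtains w c \<alpha> where "superharm (spiked M) w" "\<And>x. x \<in> spiked M \<Longrightarrow> 0 \<le> w x"
    "\<And>x i. x \<in> spiked M \<Longrightarrow> x $ l - 1 + \<bar>x $ i\<bar> \<le> w x"
    "\<alpha> > 0" "c \<ge> 0" "\<And>x. x \<in> spiked M \<Longrightarrow> w x \<le> c * norm (x - \<xi>) powr \<alpha>"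
proof -
  define \<kappa> where "\<kappa> = (\<theta> m)\<^sup>2 / (2 * (1 + (\<theta> m)\<^sup>2))"
  have \<kappa>: "\<kappa> > 0" unfolding \<kappa>_def using theta_pos[of m] by (simp add: add_pos_nonneg)
  obtain \<alpha> C :: real where p: "0 < \<alpha>" "\<alpha> \<le> 1" "C > 0" "2 * C * \<alpha> * 2 ^ CARD('n) \<le> CARD('n)"
    "C \<ge> (1 / \<kappa>) ^ CARD('n) + 1"
    using cone_barrier_parameters[OF \<kappa>, of "CARD('n)"] card by auto
  define \<beta> where "\<beta> = cone_barrier l \<xi> \<alpha> C"
  have "\<xi> \<notin> spiked M" using m(2) \<xi>(1) by (auto simp: spiked_def)
  have cone: "\<kappa> * norm (x - \<xi>) \<le> norm (x - \<xi>) + (x - \<xi>) $ l" "x \<noteq> \<xi>" if x: "x \<in> spiked M" for x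
  proof -
    have "\<not> norm (tangential l x - tangential l (base m)) \<le> \<theta> m * (1 / 4 ^ m - x $ l)"
      using x m(2) by (auto simp: spiked_def mem_spike)
    moreover have "norm (tangential l \<xi> - tangential l (base m)) \<le> \<theta> m * (1 / 4 ^ m - \<xi> $ l)"
      using \<xi>(1) by (simp add: mem_spike)
    moreover have "norm (tangential l x - tangential l (base m)) \<le>
        norm (tangential l (x - \<xi>)) + norm (tangential l \<xi> - tangential l (base m))"
      unfolding tangential_diff[symmetric, of l x \<xi>] using norm_triangle_ineq[of "tangential l x - tangential l \<xi>" "tangential l \<xi> - tangential l (base m)"] by simp
    ultimately have "- \<theta> m * (x - \<xi>) $ l \<le> norm (tangential l (x - \<xi>))"
      by (simp add: algebra_simps)
    from outside_cone[OF theta_pos this]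
    show "\<kappa> * norm (x - \<xi>) \<le> norm (x - \<xi>) + (x - \<xi>) $ l" by (simp add: \<kappa>_def)
    show "x \<noteq> \<xi>" using x \<open>\<xi> \<notin> spiked M\<close> by auto
  qed
  have s_pos: "norm (x - \<xi>) + (x - \<xi>) $ l > 0" if "x \<in> spiked M" for x
  proof -
    have "0 < \<kappa> * norm (x - \<xi>)" using \<kappa> cone(2)[OF that] by simp
    then show ?thesis using cone(1)[OF that] by linarith
  qed
  have bounds: "norm (x - \<xi>) powr \<alpha> \<le> \<beta> x" "\<beta> x \<le> C * norm (x - \<xi>) powr \<alpha>" if "x \<in> spiked M" for x
    unfolding \<beta>_def using cone_barrier_bounds[OF \<kappa> cone(1)[OF that] cone(2)[OF that] p(5)] by auto
  \<comment> \<open>Makes \<open>w\<close> at least 1 at distance 1/8 or more from \<xi>; the wall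
    function never exceeds 1. Closer to \<xi> the wall function is at most 1/4 + 1/8 - 1 + 1/2 + 1/8
    = 0.\<close>
  define K where "K = (1 / 8) powr (- \<alpha>)"
  have K: "K > 0" by (simp add: K_def)
  define w where "w x = K * \<beta> x" for x
  have w0: "0 \<le> w x" if "x \<in> spiked M" for x
    unfolding w_def using K order_trans[OF powr_ge_zero bounds(1)[OF that]] by simp
  show ?thesis
  proof (rule that)
    show "superharm (spiked M) w"
    proof (rule superharm_of_has_lap)
      show "continuous_on (spiked M) w" unfolding w_def \<beta>_def
        by (intro continuous_intros continuous_on_cone_barrier s_pos)
      show "\<exists>g L. has_lap w x g L \<and> L \<le> 0" if x: "x \<in> spiked M" for x
      proof -
        obtain g L where "has_lap \<beta> x g L" "L \<le> 0"
          unfolding \<beta>_def using has_lap_cone_barrier[OF _ s_pos[OF x] p(1-4)] card by auto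
        moreover from this have "K * L \<le> 0" using K by (simp add: mult_nonneg_nonpos)
        ultimately show ?thesis unfolding w_def using has_lap_cmult by blast
      qed
    qed
    show "0 \<le> w x" if "x \<in> spiked M" for x using w0[OF that] .
    show "x $ l - 1 + \<bar>x $ i\<bar> \<le> w x" if x: "x \<in> spiked M" for x i
    proof (cases "norm (x - \<xi>) \<ge> 1 / 8")
      case True
      have "1 = K * (1 / 8) powr \<alpha>" by (simp add: K_def powr_minus)
      also have "\<dots> \<le> K * norm (x - \<xi>) powr \<alpha>" using K True p(1) by (intro mult_left_mono powr_mono2) auto
      also have "\<dots> \<le> w x" unfolding w_def using K bounds(1)[OF x] by (intro mult_left_mono) auto
      finally have "1 \<le> w x" .
      moreover have "\<bar>x $ i\<bar> \<le> 1" "\<bar>x $ l\<bar> \<le> 1" using closure_spiked_bounds(2) x closure_subset by blast+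
      ultimately show ?thesis by linarith
    next
      case False
      have "\<bar>x $ i - \<xi> $ i\<bar> \<le> 1 / 8" "\<bar>x $ l - \<xi> $ l\<bar> \<le> 1 / 8"
        using component_le_norm_cart[of "x - \<xi>" i] component_le_norm_cart[of "x - \<xi>" l] False by auto
      moreover have "\<xi> $ l \<le> 1 / 4" "\<bar>\<xi> $ i\<bar> \<le> 1 / 2"
        using spike_component_bound[OF \<xi>(1) _ m(1)] \<xi>(2) by auto
      ultimately show ?thesis using w0[OF x] by linarith
    qed
    show "\<alpha> > 0" by (rule p(1))
    show "K * C \<ge> 0" using K p(3) by simp
    show "w x \<le> K * C * norm (x - \<xi>) powr \<alpha>" if "x \<in> spiked M" for x
      unfolding w_def using mult_left_mono[OF bounds(2)[OF that], of K] K by (simp add: mult.assoc)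
  qed
qed

section \<open>Existence of solutions\<close>

abbreviation solves :: "nat set \<Rightarrow> (real ^ 'n \<Rightarrow> real) \<Rightarrow> bool"
  where "solves M u \<equiv> dirichlet_solution (spiked M) (boundary_data l) u"

lemma boundary_data_bounds:
  assumes "x \<in> closure (spiked M)"
  shows "0 \<le> boundary_data l x" "boundary_data l x \<le> x $ l"
  using closure_spiked_bounds(1)[OF assms] by (auto simp: boundary_data_def)

text \<open>Lower barriers are 0 and the harmonic functions \<open>x $ l - 1 + c * x $ i\<close>
  with c = 1 or -1, which attain the data on the wall c x_i = 1. Upper barriers are x_l, which fits
  wherever the data are x_l, and everything superharmonic above all lower barriers; in this way the
  cone barriers of all spike points enter at once.\<close>

lemma solution_exists:
  assumes M: "M \<subseteq> {1..}"
  shows "\<exists>u. the_dirichlet_solution (spiked M) (boundary_data l) u"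
proof -
  define W where "W = insert (\<lambda>x. x $ l) {w. superharm (spiked M) w \<and>
    (\<forall>x\<in>spiked M. 0 \<le> w x \<and> (\<forall>i. x $ l - 1 + \<bar>x $ i\<bar> \<le> w x))}"
  have "superharm (spiked M) (\<lambda>x. x $ l)"
    by (rule superharm_of_has_lap) (use has_lap_coord in \<open>auto intro!: continuous_intros\<close>)
  then have W: "superharm (spiked M) w" if "w \<in> W" for w
    using that by (auto simp: W_def)
  have zero_le_W: "0 \<le> w x" if "w \<in> W" "x \<in> spiked M" for w x
    using that spiked_pos[of x M] by (auto simp: W_def)
  have wall_le_W: "x $ l - 1 + \<bar>x $ i\<bar> \<le> w x" if w: "w \<in> W" and x: "x \<in> spiked M" for w x i
  proof (cases "w = (\<lambda>x. x $ l)")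
    case True
    then show ?thesis using closure_spiked_bounds(2)[OF subsetD[OF closure_subset x], of i] by simp
  qed (use w x in \<open>auto simp: W_def\<close>)
  have coord_cont: "continuous_on (spiked M) (\<lambda>x. x $ l)" by (intro continuous_intros)
  have coord_W: "(\<lambda>x. x $ l) \<in> W" by (simp add: W_def)
  obtain u0 where u0: "C2_on (spiked M) u0" "\<And>x. x \<in> spiked M \<Longrightarrow> laplacian u0 x = 0"
    "\<And>w x. w \<in> W \<Longrightarrow> x \<in> spiked M \<Longrightarrow> u0 x \<le> w x"
    "\<And>v x. subharm (spiked M) v \<Longrightarrow> (\<And>w y. w \<in> W \<Longrightarrow> y \<in> spiked M \<Longrightarrow> v y \<le> w y) \<Longrightarrow> x \<in> spiked M \<Longrightarrow> v x \<le> u0 x"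
    by (rule perron[of "spiked M" W "\<lambda>x. x $ l" "\<lambda>x. 0", OF open_spiked W coord_W coord_cont
          harm_poly_subharm[OF harm_poly_const[of 0]]]) (use zero_le_W in blast)+
  define u where "u x = (if x \<in> spiked M then u0 x else boundary_data l x)" for x
  have C2: "C2_on (spiked M) u" and lap: "\<And>x. x \<in> spiked M \<Longrightarrow> laplacian u x = 0"
    using harmonic_cong_open[OF open_spiked _ u0(1,2), of u] by (auto simp: u_def)
  have upper: "u x \<le> x $ l" if "x \<in> closure (spiked M)" for x
    using u0(3)[OF coord_W] boundary_data_bounds[OF that] by (auto simp: u_def)
  have lower: "0 \<le> u x" if "x \<in> closure (spiked M)" for x
  proof (cases "x \<in> spiked M")
    case True
    have "0 \<le> u0 x"
      by (rule u0(4)[of "\<lambda>x. 0", OF harm_poly_subharm[OF harm_poly_const[of 0]] _ True]) (rule zero_le_W)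
    then show ?thesis using True by (simp add: u_def)
  qed (use boundary_data_bounds[OF that] in \<open>simp add: u_def\<close>)
  have wall: "x $ l - 1 + c * x $ i \<le> u x" if x: "x \<in> closure (spiked M)" and c: "c = 1 \<or> c = -1" for x i c
  proof -
    have abs: "c * y \<le> \<bar>y\<bar>" for y :: real using c by auto
    show ?thesis
    proof (cases "x \<in> spiked M")
      case True
      have "subharm (spiked M) (\<lambda>x. x $ l - 1 + c * x $ i)"
        by (intro harm_poly_subharm harm_poly_add harm_poly_diff harm_poly_coord harm_poly_const harm_poly_cmult)
      from u0(4)[OF this _ True] have "x $ l - 1 + c * x $ i \<le> u0 x"
        using wall_le_W abs by (meson add_left_mono order_trans)
      then show ?thesis using True by (simp add: u_def)
    next
      case False
      consider m where "m \<in> M" "x \<in> spike m" "x \<in> Q1_plus l" | "x \<notin> Q1_plus l"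
        using closure_minus_spiked[OF x False] by blast
      then show ?thesis
      proof cases
        case 1
        then have "x $ l \<le> 1 / 4" "\<bar>x $ i\<bar> \<le> 1 / 2"
          using spike_component_bound[of x m] closure_spiked_bounds(1)[OF x] M by auto
        then show ?thesis using abs[of "x $ i"] lower[OF x] by linarith
      next
        case 2
        then have "u x = x $ l" using False by (simp add: u_def boundary_data_def)
        then show ?thesis using abs[of "x $ i"] closure_spiked_bounds(2)[OF x, of i] by linarith
      qed
    qed
  qed
  have "continuous (at \<xi> within closure (spiked M)) u" if \<xi>: "\<xi> \<in> closure (spiked M)" for \<xi>
  proof (cases "\<xi> \<in> spiked M")
    case True
    then have "isCont u \<xi>"
      using C2 open_spiked by (simp add: C2_on_def C1_on_def continuous_on_eq_continuous_at)
    then show ?thesis by (rule continuous_at_imp_continuous_at_within)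
  next
    case False
    define F where "F = at \<xi> within closure (spiked M)"
    have ev_cl: "\<forall>\<^sub>F x in F. x \<in> closure (spiked M)"
      unfolding F_def by (simp add: eventually_at_filter)
    have lim_id: "((\<lambda>x. x) \<longlongrightarrow> \<xi>) F" unfolding F_def by (rule tendsto_ident_at)
    have lim_coord: "((\<lambda>x. x $ i) \<longlongrightarrow> \<xi> $ i) F" for i by (intro tendsto_intros lim_id)
    have "(u \<longlongrightarrow> u \<xi>) F"
    proof -
      consider m where "m \<in> M" "\<xi> \<in> spike m" "\<xi> \<in> Q1_plus l" | "\<xi> \<notin> Q1_plus l"
        using closure_minus_spiked[OF \<xi> False] by blast
      then show ?thesis
      proof cases
        case 1
        have u\<xi>: "u \<xi> = 0" using False 1(3) by (simp add: u_def boundary_data_def)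
        have "\<xi> $ l > 0" using 1(3) by (simp add: Q1_plus_def upper_half_space_def)
        moreover have "m \<ge> 1" using 1(1) M by auto
        ultimately obtain w c \<alpha> where w: "superharm (spiked M) w" "\<And>x. x \<in> spiked M \<Longrightarrow> 0 \<le> w x"
          "\<And>x i. x \<in> spiked M \<Longrightarrow> x $ l - 1 + \<bar>x $ i\<bar> \<le> w x"
          "\<alpha> > 0" "c \<ge> 0" "\<And>x. x \<in> spiked M \<Longrightarrow> w x \<le> c * norm (x - \<xi>) powr \<alpha>"
          using spike_upper_barrier[OF _ 1(1,2)] by metis
        have "w \<in> W" using w(1-3) by (simp add: W_def)
        have "\<forall>\<^sub>F x in F. x \<in> Q1_plus l"
          using topological_tendstoD[OF lim_id open_Q1_plus 1(3)] .
        then have ev_upper: "\<forall>\<^sub>F x in F. u x \<le> c * norm (x - \<xi>) powr \<alpha>"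
        proof eventually_elim
          case (elim x)
          show ?case
          proof (cases "x \<in> spiked M")
            case True
            then show ?thesis using u0(3)[OF \<open>w \<in> W\<close> True] w(6)[OF True] by (simp add: u_def)
          next
            case False
            then show ?thesis using elim w(5) by (simp add: u_def boundary_data_def)
          qed
        qed
        have ev_lower: "\<forall>\<^sub>F x in F. 0 \<le> u x" using ev_cl by eventually_elim (rule lower)
        have "((\<lambda>x. norm (x - \<xi>)) \<longlongrightarrow> norm (\<xi> - \<xi>)) F" by (intro tendsto_intros lim_id)
        then have "((\<lambda>x. norm (x - \<xi>) powr \<alpha>) \<longlongrightarrow> 0) F"
          using tendsto_zero_powrI[of "\<lambda>x. norm (x - \<xi>)" F "\<lambda>_. \<alpha>" \<alpha>] w(4) by auto
        from tendsto_mult_right_zero[OF this, of c]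
        show ?thesis unfolding u\<xi> by (rule tendsto_sandwich[OF ev_lower ev_upper tendsto_const])
      next
        case 2
        then have u\<xi>: "u \<xi> = \<xi> $ l" using False by (simp add: u_def boundary_data_def)
        have ev_upper: "\<forall>\<^sub>F x in F. u x \<le> x $ l" using ev_cl by eventually_elim (rule upper)
        show ?thesis
        proof (cases "\<xi> $ l = 0")
          \<comment> \<open>The flat part, including the origin where spikes may accumulate:
            squeezing between 0 and \<open>x $ l\<close> takes the place of a cone
            condition.\<close>
          case True
          have ev_lower: "\<forall>\<^sub>F x in F. 0 \<le> u x" using ev_cl by eventually_elim (rule lower)
          show ?thesis unfolding u\<xi>
            using tendsto_sandwich[OF ev_lower ev_upper, of "\<xi> $ l"] lim_coord[of l] True by simp
        next
          case False
          then have "\<xi> \<notin> Q1" using 2 closure_spiked_bounds(1)[OF \<xi>] by (auto simp: Q1_plus_def upper_half_space_def)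
          then obtain i where "\<not> (-1 < \<xi> $ i \<and> \<xi> $ i < 1)" by (auto simp: Q1_def)
          then have "\<xi> $ i = 1 \<or> \<xi> $ i = -1" using closure_spiked_bounds(2)[OF \<xi>, of i] by (auto simp: abs_le_iff)
          then obtain c where c: "c = 1 \<or> c = (-1::real)" "c * \<xi> $ i = 1" by auto
          have ev_lower: "\<forall>\<^sub>F x in F. x $ l - 1 + c * x $ i \<le> u x"
            using ev_cl by eventually_elim (rule wall[OF _ c(1)])
          have "((\<lambda>x. x $ l - 1 + c * x $ i) \<longlongrightarrow> \<xi> $ l - 1 + c * \<xi> $ i) F"
            by (intro tendsto_intros lim_coord)
          then have "((\<lambda>x. x $ l - 1 + c * x $ i) \<longlongrightarrow> \<xi> $ l) F" using c(2) by simp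
          then show ?thesis unfolding u\<xi> by (rule tendsto_sandwich[OF ev_lower ev_upper _ lim_coord])
        qed
      qed
    qed
    then show ?thesis by (simp add: continuous_within F_def)
  qed
  then have "continuous_on (closure (spiked M)) u" by (simp add: continuous_on_eq_continuous_within)
  then have "solves M u"
    using C2 lap by (auto simp: dirichlet_solution_def frontier_spiked u_def)
  then show ?thesis using the_dirichlet_solutionI open_spiked bounded_spiked by blast
qed

section \<open>Comparison with the spike barriers\<close>

lemma solution_comparison:
  assumes u: "solves M u"
    and cont: "continuous_on (closure (spiked M)) w"
    and lap: "\<And>x. x \<in> spiked M \<Longrightarrow> \<exists>g L. has_lap w x g L \<and> 0 \<le> L"
    and bd: "\<And>x. x \<in> frontier (spiked M) \<Longrightarrow> w x \<le> boundary_data l x"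
    and x: "x \<in> closure (spiked M)"
  shows "w x \<le> u x"
proof -
  have "w x - u x \<le> 0"
  proof (rule maximum_principle[OF open_spiked bounded_spiked _ _ _ x])
    show "continuous_on (closure (spiked M)) (\<lambda>x. w x - u x)"
      using cont u by (intro continuous_intros) (auto simp: dirichlet_solution_def)
    show "\<exists>g L. has_lap (\<lambda>x. w x - u x) x g L \<and> 0 \<le> L" if x: "x \<in> spiked M" for x
    proof -
      obtain g L where 1: "has_lap w x g L" "0 \<le> L" using lap[OF x] by blast
      obtain h where "has_lap u x h 0" using dirichlet_solution_has_lap[OF u open_spiked x] by blast
      from has_lap_diff[OF 1(1) this] 1(2) show ?thesis by fastforce
    qed
    show "w x - u x \<le> 0" if "x \<in> frontier (spiked M)" for x
      using bd[OF that] u that by (simp add: dirichlet_solution_def)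
  qed
  then show ?thesis by simp
qed

lemma solution_nonneg:
  assumes "solves M u" "x \<in> closure (spiked M)"
  shows "0 \<le> u x"
  using solution_comparison[OF assms(1) continuous_on_const[of _ 0] _ _ assms(2)]
    has_lap_const boundary_data_bounds(1) by (fastforce simp: frontier_spiked)

lemma solution_le:
  assumes u: "solves M u" and x: "x \<in> closure (spiked M)"
  shows "u x \<le> x $ l"
proof -
  have "u x - x $ l \<le> 0"
  proof (rule maximum_principle[OF open_spiked bounded_spiked _ _ _ x])
    show "continuous_on (closure (spiked M)) (\<lambda>x. u x - x $ l)"
      using u by (intro continuous_intros) (auto simp: dirichlet_solution_def)
    show "\<exists>g L. has_lap (\<lambda>x. u x - x $ l) x g L \<and> 0 \<le> L" if x: "x \<in> spiked M" for x
      using dirichlet_solution_has_lap[OF u open_spiked x] has_lap_diff[OF _ has_lap_coord[of l x]] by fastforce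
    show "u x - x $ l \<le> 0" if "x \<in> frontier (spiked M)" for x
      using that u boundary_data_bounds(2)[of x M] by (simp add: dirichlet_solution_def frontier_spiked)
  qed
  then show ?thesis by simp
qed

text \<open>The radius is that of the spike at the bottom, its widest place in the closed half
  space.\<close>

definition spike_weight :: "nat \<Rightarrow> real ^ 'n \<Rightarrow> real"
  where "spike_weight m = spike_barrier l (base m) (\<theta> m / 4 ^ m)"

lemma radius_pos: "\<theta> m / 4 ^ m > 0"
  using theta_pos[of m] by simp

lemma spike_weight_nonneg: "spike_weight m x \<ge> 0"
  unfolding spike_weight_def by (rule spike_barrier_nonneg[OF radius_pos])

lemma spike_weight_ge_1: "x \<in> spike m \<Longrightarrow> x $ l \<ge> 0 \<Longrightarrow> spike_weight m x \<ge> 1"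
  unfolding spike_weight_def using spike_barrier_ge_1[OF radius_pos spike_bounds(2)] by simp

lemma spike_weight_le:
  assumes "\<bar>x $ f - 1 / 4 ^ m\<bar> \<ge> d" "d > 0"
  shows "spike_weight m x \<le> 2 * (\<theta> m / 4 ^ m) / d"
  unfolding spike_weight_def using assms tangential_component_le[of x m] by (intro spike_barrier_le[OF radius_pos]) auto

lemma continuous_on_spike_weight [continuous_intros]: "continuous_on S (spike_weight m)"
  unfolding spike_weight_def by (rule continuous_on_spike_barrier[OF radius_pos])

lemma has_lap_spike_weight:
  assumes "x $ l \<ge> 0"
  shows "\<exists>g L. has_lap (\<lambda>x. x $ l * spike_weight m x) x g L \<and> L \<le> 0"
  unfolding spike_weight_def by (rule has_lap_spike_barrier[OF card radius_pos assms])

text \<open>The error term \<open>1 / 4 ^ N\<close> absorbs all spikes of index larger than \<open>N\<close>, so that finitely many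
  barriers suffice for the infinite family.\<close>

lemma solution_lower_bound:
  assumes u: "solves M u" and M: "M \<subseteq> {1..}"
    and x: "x \<in> closure (spiked M)"
  shows "x $ l - (\<Sum>m=1..N. x $ l * spike_weight m x) - 1 / 4 ^ N \<le> u x"
proof (rule solution_comparison[OF u _ _ _ x])
  show "continuous_on (closure (spiked M)) (\<lambda>x. x $ l - (\<Sum>m=1..N. x $ l * spike_weight m x) - 1 / 4 ^ N)"
    by (intro continuous_intros)
  show "\<exists>g L. has_lap (\<lambda>x. x $ l - (\<Sum>m=1..N. x $ l * spike_weight m x) - 1 / 4 ^ N) x g L \<and> 0 \<le> L" if "x \<in> spiked M" for x
  proof -
    have "\<forall>m. \<exists>g L. has_lap (\<lambda>x. x $ l * spike_weight m x) x g L \<and> L \<le> 0"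
      using has_lap_spike_weight spiked_pos[OF that] by (auto intro: less_imp_le)
    then obtain G L where GL: "\<And>m. has_lap (\<lambda>x. x $ l * spike_weight m x) x (G m) (L m)" "\<And>m. L m \<le> 0" by metis
    from has_lap_diff[OF has_lap_diff[OF has_lap_coord[of l x] has_lap_sum[where J="{1..N}", OF GL(1)]] has_lap_const[of "1 / 4 ^ N"]]
    show ?thesis using GL(2) by (intro exI conjI) (assumption, simp add: sum_nonpos)
  qed
  fix x assume x: "x \<in> frontier (spiked M)"
  then have xc: "x \<in> closure (spiked M)" "x \<notin> spiked M" by (auto simp: frontier_spiked)
  have xl: "x $ l \<ge> 0" using closure_spiked_bounds(1)[OF xc(1)] .
  have sum: "(\<Sum>m=1..N. x $ l * spike_weight m x) \<ge> 0" by (intro sum_nonneg mult_nonneg_nonneg xl spike_weight_nonneg)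
  have pos: "(1::real) / 4 ^ N \<ge> 0" by simp
  consider m where "m \<in> M" "x \<in> spike m" "x \<in> Q1_plus l" | "x \<notin> Q1_plus l"
    using closure_minus_spiked[OF xc] by blast
  then show "x $ l - (\<Sum>m=1..N. x $ l * spike_weight m x) - 1 / 4 ^ N \<le> boundary_data l x"
  proof cases
    case 1
    have "x $ l - (\<Sum>m=1..N. x $ l * spike_weight m x) - 1 / 4 ^ N \<le> 0"
    proof (cases "m \<le> N")
      case True
      have "x $ l \<le> x $ l * spike_weight m x" using spike_weight_ge_1[OF 1(2) xl] xl by (simp add: mult_le_cancel_left1)
      also have "\<dots> \<le> (\<Sum>m=1..N. x $ l * spike_weight m x)"
        using True 1(1) M by (intro member_le_sum mult_nonneg_nonneg xl spike_weight_nonneg) auto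
      finally show ?thesis using pos by linarith
    next
      case False
      have "x $ l \<le> 1 / 4 ^ m" using spike_bounds(1)[OF 1(2) xl] .
      also have "(1::real) / 4 ^ m \<le> 1 / 4 ^ N" using False by (intro divide_left_mono power_increasing) auto
      finally show ?thesis using sum by linarith
    qed
    then show ?thesis using 1(3) by (simp add: boundary_data_def)
  next
    case 2
    then have "boundary_data l x = x $ l" by (simp add: boundary_data_def)
    then show ?thesis using sum pos by linarith
  qed
qed

lemma sum_quarter_powers: "(\<Sum>m=1..N. 1 / (4::real) ^ m) = (1 - 1 / 4 ^ N) / 3"
proof (induction N)
  case (Suc N)
  have "(\<Sum>m=1..Suc N. 1 / (4::real) ^ m) = (\<Sum>m=1..N. 1 / 4 ^ m) + 1 / 4 ^ Suc N" by simp
  also have "\<dots> = (1 - 1 / 4 ^ Suc N) / 3" unfolding Suc.IH by (simp add: field_simps)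
  finally show ?case .
qed simp

lemma axis_point_in_spiked:
  assumes "0 < t" "t \<le> 1 / 2"
  shows "t *\<^sub>R axis l 1 \<in> spiked M"
proof (rule spikedI)
  show "t *\<^sub>R axis l 1 \<in> Q1_plus l"
    using assms by (auto simp: Q1_plus_def Q1_def upper_half_space_def axis_def)
  show "t *\<^sub>R axis l 1 \<notin> spike m" for m
    using fl assms by (intro not_in_spike) (auto simp: axis_def divide_simps)
qed

text \<open>The m-th spike axis is 4^-m away, so its weight is at most 2 \<theta> <= 4^-m / 8. The
  weights sum to at most 1/8, and thanks to the factor \<open>x $ l\<close> the loss is at most t/8.
  The error 4^-N disappears because t is fixed while N grows.\<close>

lemma solution_on_axis_lower_bound:
  assumes u: "solves M u" and M: "M \<subseteq> {1..}"
    and t: "0 < t" "t \<le> 1 / 2"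
  shows "3 / 4 * t \<le> u (t *\<^sub>R axis l 1)"
proof -
  define x where "x = t *\<^sub>R axis l (1::real)"
  have xl: "x $ l = t" and xf: "x $ f = 0" using fl by (simp_all add: x_def axis_def)
  have x: "x \<in> closure (spiked M)" unfolding x_def using axis_point_in_spiked[OF t] closure_subset by blast
  have h: "spike_weight m x \<le> (1 / 8) * (1 / 4 ^ m)" for m
  proof -
    have "spike_weight m x \<le> 2 * (\<theta> m / 4 ^ m) / (1 / 4 ^ m)" by (rule spike_weight_le) (auto simp: xf)
    also have "\<dots> = 2 * \<theta> m" by simp
    also have "\<dots> \<le> (1 / 8) * (1 / 4 ^ m)" using theta_le[of m] by linarith
    finally show ?thesis .
  qed
  have bound: "3 / 4 * t - 1 / 4 ^ N \<le> u x" for N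
  proof -
    have "(\<Sum>m=1..N. x $ l * spike_weight m x) \<le> (\<Sum>m=1..N. t * ((1 / 8) * (1 / 4 ^ m)))"
      unfolding xl using t h by (intro sum_mono mult_left_mono) auto
    also have "\<dots> = t / 8 * (\<Sum>m=1..N. 1 / 4 ^ m)" by (simp add: sum_distrib_left)
    also have "\<dots> \<le> t / 8 * 1"
    proof (rule mult_left_mono)
      have "(1 - q) / 3 \<le> 1" if "0 \<le> q" for q :: real using that by simp
      from this[of "1 / 4 ^ N"] show "(\<Sum>m=1..N. 1 / 4 ^ m) \<le> (1::real)"
        unfolding sum_quarter_powers by simp
    qed (use t in simp)
    finally have "(\<Sum>m=1..N. x $ l * spike_weight m x) \<le> t / 8" by simp
    then show ?thesis using solution_lower_bound[OF u M x, of N] t unfolding xl by linarith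
  qed
  have "(\<lambda>N. 3 / 4 * t - (1 / 4) ^ N) \<longlonglongrightarrow> 3 / 4 * t - 0"
    by (intro tendsto_intros LIMSEQ_power_zero) auto
  then have "3 / 4 * t - 0 \<le> u x"
    by (rule LIMSEQ_le_const2) (use bound in \<open>auto simp: power_divide\<close>)
  then show ?thesis by (simp add: x_def)
qed

end

section \<open>Normal derivatives on the axis\<close>

lemma harm_poly_reflect:
  fixes p :: "real ^ 'n::finite \<Rightarrow> real"
  assumes "harm_poly p"
  shows "harm_poly (\<lambda>x. p (reflect l 0 x))"
proof (rule harm_polyI)
  have "reflect l 0 = (\<lambda>x. x - (2 * x $ l) *\<^sub>R axis l (1::real))"
    by (auto simp: fun_eq_iff vec_eq_iff reflect_nth axis_def)
  moreover have "bounded_linear (\<lambda>x. x - (2 * x $ l) *\<^sub>R axis l (1::real))"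
    by (intro bounded_linear_intros bounded_linear_vec_nth)
  ultimately have "polynomial_function (reflect l 0)" by (simp add: polynomial_function_bounded_linear)
  from real_polynomial_function_compose[OF this, of p] assms
  show "real_polynomial_function (\<lambda>x. p (reflect l 0 x))" by (simp add: harm_poly_def o_def)
  show "\<exists>g. has_lap (\<lambda>x. p (reflect l 0 x)) x g 0" for x
    using has_lap_reflect[OF harm_poly_has_lap[OF assms]] by blast
qed

text \<open>The boundary points needed later, namely the origin, points of the flat part and the
  tips, are all reached vertically from inside.\<close>

lemma closure_if_shift:
  assumes "\<delta> > 0" "\<And>s. 0 < s \<Longrightarrow> s < \<delta> \<Longrightarrow> x + s *\<^sub>R axis l 1 \<in> S"
  shows "x \<in> closure (S :: (real ^ 'n::finite) set)"
  unfolding closure_approachable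
proof (intro allI impI)
  fix e :: real assume "e > 0"
  define s where "s = min \<delta> e / 2"
  have "0 < s" "s < \<delta>" "s < e" using assms(1) \<open>e > 0\<close> by (auto simp: s_def min_def)
  then show "\<exists>y\<in>S. dist y x < e"
    using assms(2)[of s] by (intro bexI[of _ "x + s *\<^sub>R axis l 1"]) (auto simp: dist_norm)
qed

context spiked_cube
begin

text \<open>Within half of 4^-k of the origin none of the first k spikes is met, so the domain is a
  half ball there. This is the room for the reflection.\<close>

lemma near_origin_in_spiked:
  assumes "norm x \<le> (1 / 4 ^ k) / 2" "x $ l > 0"
  shows "x \<in> spiked {1..k}"
proof (rule spikedI)
  have c: "\<bar>x $ i\<bar> \<le> (1 / 4 ^ k) / 2" for i
    using component_le_norm_cart[of x i] assms(1) by linarith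
  define q where "q = (1 / 4 ^ k :: real)"
  have "q \<le> 1" by (simp add: q_def)
  then have "\<bar>x $ i\<bar> \<le> 1 / 2" for i using c[of i] unfolding q_def[symmetric] by linarith
  then have "-1 < x $ i \<and> x $ i < 1" for i by (smt (verit) field_sum_of_halves)
  then show "x \<in> Q1_plus l" using assms(2) by (auto simp: Q1_plus_def Q1_def upper_half_space_def)
  fix m assume "m \<in> {1..k}"
  then have "q \<le> 1 / 4 ^ m" unfolding q_def by (intro divide_left_mono power_increasing) auto
  moreover have "p / 2 \<le> \<bar>x $ f - p\<bar>" if "q \<le> p" for p
    using that c[of f] unfolding q_def[symmetric] by linarith
  ultimately have "(1 / 4 ^ m) / 2 \<le> \<bar>x $ f - 1 / 4 ^ m\<bar>" by blast
  then show "x \<notin> spike m" using assms(2) by (intro not_in_spike)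
qed

text \<open>On the new spike the old solution is at most \<open>x $ l\<close>, by
  \<open>solution_le\<close>, and hence at most the barrier. The old solution minus the barrier is
  thus a subsolution for the new domain.\<close>

lemma solution_step:
  assumes u: "solves {1..Suc j} u"
    and v: "solves {1..j} v"
    and x: "x \<in> closure (spiked {1..Suc j})"
  shows "u x \<le> v x" "v x - x $ l * spike_weight (Suc j) x \<le> u x"
proof -
  have sub: "spiked {1..Suc j} \<subseteq> spiked {1..j}" by (auto simp: spiked_def)
  then have sub_cl: "closure (spiked {1..Suc j}) \<subseteq> closure (spiked {1..j})" by (rule closure_mono)
  have cv: "continuous_on (closure (spiked {1..Suc j})) v"
    using v sub_cl by (auto simp: dirichlet_solution_def intro: continuous_on_subset)
  have bd: "u x \<le> v x \<and> v x - x $ l * spike_weight (Suc j) x \<le> boundary_data l x"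
    if x: "x \<in> frontier (spiked {1..Suc j})" for x
  proof -
    have xc: "x \<in> closure (spiked {1..Suc j})" "x \<notin> spiked {1..Suc j}" using x by (auto simp: frontier_spiked)
    have xl: "x $ l \<ge> 0" using closure_spiked_bounds(1)[OF xc(1)] .
    have xh: "x $ l * spike_weight (Suc j) x \<ge> 0" by (intro mult_nonneg_nonneg xl spike_weight_nonneg)
    have ux: "u x = boundary_data l x" using u x by (simp add: dirichlet_solution_def)
    show ?thesis
    proof (cases "x \<in> spiked {1..j}")
      case False
      then have "x \<in> frontier (spiked {1..j})" using xc(1) sub_cl by (auto simp: frontier_spiked)
      then have "v x = boundary_data l x" using v by (simp add: dirichlet_solution_def)
      then show ?thesis using ux xh by simp
    next
      case True
      then have "x \<in> Q1_plus l" by (simp add: spiked_def)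
      then have "x \<in> spike (Suc j)" using xc(2) True by (auto simp: spiked_def atLeastAtMostSuc_conv)
      from spike_weight_ge_1[OF this xl] have "x $ l \<le> x $ l * spike_weight (Suc j) x" using xl by (simp add: mult_le_cancel_left1)
      moreover have "boundary_data l x = 0" using \<open>x \<in> Q1_plus l\<close> by (simp add: boundary_data_def)
      moreover have "0 \<le> v x" "v x \<le> x $ l"
        using solution_nonneg[OF v] solution_le[OF v] True closure_subset by blast+
      ultimately show ?thesis using ux by linarith
    qed
  qed
  show "v x - x $ l * spike_weight (Suc j) x \<le> u x"
  proof (rule solution_comparison[OF u _ _ _ x])
    show "continuous_on (closure (spiked {1..Suc j})) (\<lambda>x. v x - x $ l * spike_weight (Suc j) x)"
      by (intro continuous_intros cv)
    show "\<exists>g L. has_lap (\<lambda>x. v x - x $ l * spike_weight (Suc j) x) x g L \<and> 0 \<le> L" if x: "x \<in> spiked {1..Suc j}" for x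
    proof -
      obtain g where g: "has_lap v x g 0" using dirichlet_solution_has_lap[OF v open_spiked subsetD[OF sub x]] by blast
      obtain g' L where g': "has_lap (\<lambda>x. x $ l * spike_weight (Suc j) x) x g' L" "L \<le> 0"
        using has_lap_spike_weight[of x "Suc j"] spiked_pos[OF x] by auto
      from has_lap_diff[OF g g'(1)] g'(2) show ?thesis by fastforce
    qed
  qed (use bd in blast)
  have "u x - v x \<le> 0"
  proof (rule maximum_principle[OF open_spiked bounded_spiked _ _ _ x])
    show "continuous_on (closure (spiked {1..Suc j})) (\<lambda>x. u x - v x)"
      using u by (intro continuous_intros cv) (auto simp: dirichlet_solution_def)
    show "\<exists>g L. has_lap (\<lambda>x. u x - v x) x g L \<and> 0 \<le> L" if x: "x \<in> spiked {1..Suc j}" for x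
    proof -
      obtain g where g: "has_lap v x g 0" using dirichlet_solution_has_lap[OF v open_spiked subsetD[OF sub x]] by blast
      obtain g' where g': "has_lap u x g' 0" using dirichlet_solution_has_lap[OF u open_spiked x] by blast
      from has_lap_diff[OF g' g] show ?thesis by fastforce
    qed
  qed (use bd in auto)
  then show "u x \<le> v x" by simp
qed

text \<open>The gradient estimate for the difference of two consecutive solutions on a ball around
  the axis point, with \<open>solution_step\<close> supplying the bound.\<close>

lemma partial_deriv_step:
  assumes u: "solves {1..Suc j} u"
    and v: "solves {1..j} v"
    and t: "0 < t" "t \<le> 1 / 2"
  shows "partial_deriv l v (t *\<^sub>R axis l 1) - 1 / 4 ^ Suc j \<le> partial_deriv l u (t *\<^sub>R axis l 1)"
proof -
  define k where "k = Suc j"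
  define x where "x = t *\<^sub>R axis l (1::real)"
  define q where "q = (1 / 4 ^ k :: real)"
  have q: "q > 0" "q \<le> 1 / 4" using quarter_power_le[of k] by (auto simp: q_def k_def)
  \<comment> \<open>R <= t/2 keeps the ball at heights between t/2 and 3t/2; R <= q/4 keeps it at
    distance at least 3q/4 from the axis of spike k and off all earlier spikes.\<close>
  define R where "R = min (t / 2) (q / 4)"
  have R: "R > 0" "R \<le> t / 2" "R \<le> q / 4" using t q by (auto simp: R_def)
  define n where "n = real CARD('n)"
  have n: "n > 0" by (simp add: n_def)
  have "\<theta> k = 1 / (12 * n\<^sup>2 * 16 ^ k)" by (simp add: \<theta>_def aperture_def n_def)
  moreover have "(16::real) ^ k = 4 ^ k * 4 ^ k" by (simp flip: power_mult_distrib)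
  ultimately have \<theta>k: "12 * n\<^sup>2 * \<theta> k = q * q" using n by (simp add: q_def field_simps)
  have sub: "spiked {1..k} \<subseteq> spiked {1..j}" by (auto simp: spiked_def k_def)
  have comp: "\<bar>y $ l - t\<bar> \<le> R" "\<bar>y $ i\<bar> \<le> R" if "y \<in> cball x R" "i \<noteq> l" for y i
    using component_le_norm_cart[of "y - x" l] component_le_norm_cart[of "y - x" i] that
    by (auto simp: x_def axis_def dist_norm norm_minus_commute)
  have ball: "y \<in> spiked {1..k}" and yl: "0 < y $ l" "y $ l \<le> 3 / 2 * t" "y $ l \<le> 1"
    and yf: "3 / 4 * q \<le> \<bar>y $ f - q\<bar>" if y: "y \<in> cball x R" for y
  proof -
    have l: "\<bar>y $ l - t\<bar> \<le> R" using comp(1)[OF y fl] .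
    then show yl: "0 < y $ l" "y $ l \<le> 3 / 2 * t" "y $ l \<le> 1" using R t q by linarith+
    have f: "\<bar>y $ f\<bar> \<le> R" using comp(2)[OF y fl] .
    then show "3 / 4 * q \<le> \<bar>y $ f - q\<bar>" using R q by linarith
    show "y \<in> spiked {1..k}"
    proof (rule spikedI)
      have "-1 < y $ i \<and> y $ i < 1" for i
        using l comp(2)[OF y, of i] R t q by (cases "i = l") (auto simp: abs_le_iff)
      then show "y \<in> Q1_plus l" using yl(1) by (auto simp: Q1_plus_def Q1_def upper_half_space_def)
      fix m assume "m \<in> {1..k}"
      then have "q \<le> 1 / 4 ^ m" unfolding q_def by (intro divide_left_mono power_increasing) auto
      moreover have "p / 2 \<le> \<bar>y $ f - p\<bar>" if "q \<le> p" for p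
        using that f R q by linarith
      ultimately have "(1 / 4 ^ m) / 2 \<le> \<bar>y $ f - 1 / 4 ^ m\<bar>" by blast
      then show "y \<notin> spike m" using yl(1) by (intro not_in_spike)
    qed
  qed
  \<comment> \<open>Distance 3q/4 and radius \<theta> q give a weight of at most 8/3 \<theta>,
    rounded up to 3 \<theta>. The first factor bounds the height, in the two forms used by the cases
    below.\<close>
  define B where "B = min (3 / 2 * t) 1 * (3 * \<theta> k)"
  have d_bound: "\<bar>v y - u y\<bar> \<le> B" if y: "y \<in> cball x R" for y
  proof -
    have yc: "y \<in> closure (spiked {1..Suc j})" using ball[OF y] closure_subset unfolding k_def by blast
    have "spike_weight k y \<le> 2 * (\<theta> k / 4 ^ k) / (3 / 4 * q)"
      using yf[OF y] q by (intro spike_weight_le) (auto simp: q_def)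
    also have "\<dots> = 8 / 3 * \<theta> k" by (simp add: q_def)
    also have "\<dots> \<le> 3 * \<theta> k" using theta_pos[of k] by simp
    finally have "y $ l * spike_weight k y \<le> B"
      unfolding B_def using yl[OF y] spike_weight_nonneg t by (intro mult_mono) auto
    then show ?thesis using solution_step[OF u v yc] by (simp add: k_def)
  qed
  have lap: "\<exists>g. has_lap u y g 0" "\<exists>g. has_lap v y g 0" if "y \<in> cball x R" for y
    using dirichlet_solution_has_lap[OF u open_spiked] dirichlet_solution_has_lap[OF v open_spiked] ball[OF that] sub
    unfolding k_def by blast+
  have "\<bar>partial_deriv l (\<lambda>y. v y - u y) x\<bar> \<le> (CARD('n))\<^sup>2 * B / R"
  proof (rule harmonic_gradient_bound[OF R(1) _ _ d_bound])
    have "continuous_on (spiked {1..k}) u" "continuous_on (spiked {1..j}) v"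
      using u v by (auto simp: dirichlet_solution_def C2_on_def C1_on_def k_def)
    moreover have "cball x R \<subseteq> spiked {1..k}" "cball x R \<subseteq> spiked {1..j}" using ball sub by blast+
    ultimately have "continuous_on (cball x R) u" "continuous_on (cball x R) v"
      using continuous_on_subset by blast+
    then show "continuous_on (cball x R) (\<lambda>y. v y - u y)" by (intro continuous_intros)
    show "\<exists>g. has_lap (\<lambda>y. v y - u y) y g 0" if "y \<in> cball x R" for y
      using lap[OF that] has_lap_diff by fastforce
  qed
  also have "(CARD('n))\<^sup>2 * B / R \<le> q"
  \<comment> \<open>Near the bottom the radius shrinks with t, but so does \<open>B\<close>. Higher
    up both are independent of t, and the calibration of \<open>aperture\<close> is used up
    exactly.\<close>
  proof (cases "t / 2 \<le> q / 4")
    case True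
    then have "R = t / 2" by (simp add: R_def)
    have "(CARD('n))\<^sup>2 * B \<le> n\<^sup>2 * (3 / 2 * t * (3 * \<theta> k))"
      unfolding B_def n_def using theta_pos[of k] by (simp add: mult_left_mono mult_right_mono)
    also have "\<dots> = 3 / 8 * t * (12 * n\<^sup>2 * \<theta> k)" by simp
    also have "\<dots> \<le> q * R"
      unfolding \<theta>k \<open>R = t / 2\<close> using q t mult_right_mono[of q 1 "q * t"] by (simp add: mult_ac)
    finally show ?thesis using R(1) by (simp add: divide_le_eq)
  next
    case False
    then have "R = q / 4" by (simp add: R_def)
    have "(CARD('n))\<^sup>2 * B \<le> n\<^sup>2 * (1 * (3 * \<theta> k))"
      unfolding B_def n_def using theta_pos[of k] by (simp add: mult_left_mono mult_right_mono)
    also have "\<dots> = 1 / 4 * (12 * n\<^sup>2 * \<theta> k)" by simp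
    also have "\<dots> = q * R" unfolding \<theta>k \<open>R = q / 4\<close> by simp
    finally show ?thesis using R(1) by (simp add: divide_le_eq)
  qed
  finally have "\<bar>partial_deriv l (\<lambda>y. v y - u y) x\<bar> \<le> q" .
  moreover obtain g1 g2 where g: "has_lap u x g1 0" "has_lap v x g2 0" using lap[of x] R(1) by auto
  ultimately show ?thesis
    using has_lap_imp_derivs(1)[OF has_lap_diff[OF g(2,1)], of l] has_lap_imp_derivs(1)[OF g(1), of l]
      has_lap_imp_derivs(1)[OF g(2), of l] by (simp add: x_def q_def k_def)
qed

text \<open>Telescoping over the spikes, the m-th costing at most 4^-m. The induction runs over all
  \<open>u\<close>, because the solution with one spike less is supplied by
  \<open>solution_exists\<close>.\<close>

lemma partial_deriv_lower_bound:
  assumes t: "0 < t" "t \<le> 1 / 2"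
  shows "solves {1..k} u \<Longrightarrow>
    1 - (\<Sum>m=1..k. 1 / 4 ^ m) \<le> partial_deriv l u (t *\<^sub>R axis l 1)"
proof (induction k arbitrary: u)
  case 0
  have "real_polynomial_function (\<lambda>x::real^'n. x $ l)" "\<And>x::real^'n. laplacian (\<lambda>x. x $ l) x = 0"
    using harm_poly_coord[of l] by (auto simp: harm_poly_def)
  \<comment> \<open>Without spikes the data are \<open>x $ l\<close> on the whole frontier, so the
    solution is \<open>x $ l\<close> itself, with derivative 1.\<close>
  moreover have "x \<notin> Q1_plus l" if "x \<in> frontier (spiked {1..0})" for x
    using frontier_spiked[of "{1..0}"] that by (auto simp: spiked_def)
  ultimately have "dirichlet_solution (spiked {1..0}) (boundary_data l) (\<lambda>x. x $ l)"
    by (auto simp: dirichlet_solution_def C2_on_def boundary_data_def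
        intro!: rpf_C1_on rpf_partial_deriv continuous_intros)
  then have "u x = x $ l" if "x \<in> spiked {1..0}" for x
    using dirichlet_solution_unique[OF _ _ open_spiked bounded_spiked] 0 that closure_subset
    by (meson antisym subsetD)
  from partial_deriv_cong_open(1)[OF open_spiked this axis_point_in_spiked[OF t]]
  show ?case using has_lap_imp_derivs(1)[OF has_lap_coord[of l "t *\<^sub>R axis l 1"], of l] by simp
next
  case (Suc j)
  obtain v where "solves {1..j} v"
    using solution_exists[of "{1..j}"] by (auto simp: the_dirichlet_solution_def)
  with partial_deriv_step[OF Suc.prems this t] Suc.IH show ?case by fastforce
qed

text \<open>Schwarz reflection: the odd extension of \<open>u\<close> is a uniform limit of harmonic polynomials,
  because an approximation on the sphere is almost odd, hence small on the plane \<open>x\<^sub>l = 0\<close>.\<close>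

lemma odd_extension_approx:
  assumes u: "solves {1..k} u"
    and r: "r = (1 / 4 ^ k) / 4"
  defines "\<psi> \<equiv> \<lambda>x. if x $ l \<ge> 0 then u x else - u (reflect l 0 x)"
  shows "\<exists>P. hconv P \<psi> 0 r"
proof (rule hconv_if_approx)
  define rf where "rf = reflect l (0::real)"
  have rf_nth: "rf x $ i = (if i = l then - x $ i else x $ i)" for x i
    by (simp add: rf_def reflect_nth)
  have "rf 0 = 0" by (simp add: vec_eq_iff rf_nth)
  then have norm_rf: "norm (rf x) = norm x" for x
    using dist_reflect[of l 0 0 x] by (simp add: rf_def dist_norm)
  have rf_rf: "rf (rf x) = x" for x by (simp add: rf_def)
  \<comment> \<open>The half ball of radius 2r is free of spikes; the factor 2 leaves room for the
    upward shifts by less than r in \<open>in_closure\<close>.\<close>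
  have r_pos: "r > 0" and r2: "2 * r = (1 / 4 ^ k) / 2" by (auto simp: r)
  have in_spiked: "x \<in> spiked {1..k}" if "norm x \<le> r" "x $ l > 0" for x
    using near_origin_in_spiked[of x k] that r_pos r2 by linarith
  have in_closure: "x \<in> closure (spiked {1..k})" if x: "norm x \<le> r" "x $ l \<ge> 0" for x
  proof (rule closure_if_shift[OF r_pos])
    fix s assume s: "0 < s" "s < r"
    have "norm (x + s *\<^sub>R axis l 1) \<le> norm x + norm (s *\<^sub>R axis l (1::real))" by (rule norm_triangle_ineq)
    then have "norm (x + s *\<^sub>R axis l 1) \<le> 2 * r" using x(1) s by simp
    then show "x + s *\<^sub>R axis l 1 \<in> spiked {1..k}"
      unfolding r2 using x(2) s by (intro near_origin_in_spiked) (auto simp: axis_def)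
  qed
  have u_flat: "u x = 0" if "norm x \<le> r" "x $ l = 0" for x
  proof -
    have "x \<notin> spiked {1..k}" using spiked_pos[of x] that(2) by auto
    then have "x \<in> frontier (spiked {1..k})" using in_closure that by (simp add: frontier_spiked)
    then show ?thesis using u that(2) by (simp add: dirichlet_solution_def boundary_data_def)
  qed
  have cu: "continuous_on (closure (spiked {1..k})) u" using u by (simp add: dirichlet_solution_def)
  have \<psi>_cont: "continuous_on (cball 0 r) \<psi>"
  proof -
    define A B where "A = cball 0 r \<inter> {x::real^'n. 0 \<le> x $ l}" and "B = cball 0 r \<inter> {x::real^'n. x $ l \<le> 0}"
    have "continuous_on (A \<union> B) (\<lambda>x. if x $ l \<ge> 0 then u x else - u (rf x))"
    proof (rule continuous_on_cases)
      show "closed A" "closed B" unfolding A_def B_def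
        by (intro closed_Int closed_cball closed_Collect_le continuous_intros)+
      show "continuous_on A u"
        using cu by (rule continuous_on_subset) (use in_closure in \<open>auto simp: A_def\<close>)
      have "continuous_on B (\<lambda>x. u (rf x))"
        unfolding rf_def
        by (rule continuous_on_compose2[OF cu continuous_on_reflect])
          (use in_closure norm_rf rf_nth in \<open>auto simp: B_def rf_def\<close>)
      then show "continuous_on B (\<lambda>x. - u (rf x))" by (intro continuous_intros)
      show "\<forall>x. x \<in> A \<and> \<not> 0 \<le> x $ l \<or> x \<in> B \<and> 0 \<le> x $ l \<longrightarrow> u x = - u (rf x)"
      proof (intro allI impI)
        fix x assume "x \<in> A \<and> \<not> 0 \<le> x $ l \<or> x \<in> B \<and> 0 \<le> x $ l"
        then have "norm x \<le> r" "x $ l = 0" by (auto simp: A_def B_def)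
        then show "u x = - u (rf x)" using u_flat[of x] u_flat[of "rf x"] norm_rf rf_nth by simp
      qed
    qed
    moreover have "A \<union> B = cball 0 r" by (auto simp: A_def B_def)
    ultimately show ?thesis unfolding \<psi>_def rf_def by simp
  qed
  fix e :: real assume "e > 0"
  \<comment> \<open>In the lower half the error is the defect of oddness, at most 2e/3, plus the
    error e/3 at the reflected point.\<close>
  then have "e / 3 > 0" by simp
  from harm_poly_approx_on_sphere[OF continuous_on_subset[OF \<psi>_cont sphere_cball] r_pos this]
  obtain p where p: "harm_poly p" and p_sphere: "\<And>x. x \<in> sphere 0 r \<Longrightarrow> \<bar>\<psi> x - p x\<bar> < e / 3" by blast
  have odd: "\<psi> (rf x) = - \<psi> x" if "norm x \<le> r" for x
    using u_flat[of x] u_flat[of "rf x"] that norm_rf rf_nth[of x l] rf_rf[of x]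
    by (auto simp: \<psi>_def rf_def[symmetric])
  \<comment> \<open>Twice the even part of \<open>p\<close>, measuring how far \<open>p\<close> is
    from odd; on the plane x_l = 0 it equals 2 p. Being small on the sphere, it is small in the
    ball.\<close>
  define q where "q x = p x + p (rf x)" for x
  have q: "harm_poly q"
    unfolding q_def rf_def by (intro harm_poly_add harm_poly_reflect p)
  have q_sphere: "\<bar>q x\<bar> \<le> 2 * (e / 3)" if x: "x \<in> sphere 0 r" for x
  proof -
    have "rf x \<in> sphere 0 r" using x norm_rf by simp
    moreover have "\<psi> (rf x) = - \<psi> x" using odd x by simp
    ultimately show ?thesis using p_sphere[OF x] p_sphere[of "rf x"] unfolding q_def by linarith
  qed
  have q_ball: "\<bar>q x\<bar> \<le> 2 * (e / 3)" if x: "x \<in> cball 0 r" for x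
  proof -
    have "q y \<le> 2 * (e / 3)" "-1 * q y \<le> 2 * (e / 3)" if "y \<in> sphere 0 r" for y
      using q_sphere[OF that] by linarith+
    then have "q x \<le> 2 * (e / 3)" "-1 * q x \<le> 2 * (e / 3)"
      using harm_poly_le_on_ball[OF q r_pos _ x] harm_poly_le_on_ball[OF harm_poly_cmult[OF q, of "-1"] r_pos _ x]
      by blast+
    then show ?thesis by linarith
  qed
  \<comment> \<open>On the upper half ball \<open>p\<close> and \<open>u\<close> are both harmonic;
    they differ by at most e/3 on the cap and on the flat side, hence throughout.\<close>
  define H where "H = ball 0 r \<inter> {x::real^'n. 0 < x $ l}"
  have H: "open H" "bounded H"
    unfolding H_def by (auto intro!: open_Int open_Collect_less continuous_intros)
  have clH: "closure H \<subseteq> cball 0 r \<inter> {x. 0 \<le> x $ l}"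
    by (rule closure_minimal) (auto simp: H_def intro!: closed_Int closed_Collect_le continuous_intros)
  have half: "\<bar>p x - u x\<bar> \<le> e / 3" if x: "x \<in> cball 0 r" "x $ l \<ge> 0" for x
  proof -
    have edge: "\<bar>p x - u x\<bar> \<le> e / 3" if x: "x \<in> cball 0 r" "x $ l \<ge> 0" "x \<notin> H" for x
    proof (cases "x $ l = 0")
      case True
      then have "rf x = x" by (simp add: vec_eq_iff rf_nth)
      then have "\<bar>p x\<bar> \<le> e / 3" using q_ball[OF x(1)] by (simp add: q_def)
      then show ?thesis using u_flat[of x] x(1) True by simp
    next
      case False
      then have "x \<in> sphere 0 r" using x by (auto simp: H_def)
      from p_sphere[OF this] show ?thesis using x(2) by (simp add: \<psi>_def abs_minus_commute)
    qed
    show ?thesis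
    proof (cases "x \<in> H")
      case False
      then show ?thesis using edge x by blast
    next
      case True
      have cpu: "continuous_on (closure H) (\<lambda>x. p x - u x)"
      proof (intro continuous_intros harm_poly_continuous_on[OF p] continuous_on_subset[OF cu] subsetI)
        fix y assume "y \<in> closure H"
        then have "y \<in> cball 0 r \<inter> {x. 0 \<le> x $ l}" using clH by blast
        then show "y \<in> closure (spiked {1..k})" using in_closure by simp
      qed
      have frH: "\<bar>p y - u y\<bar> \<le> e / 3" if "y \<in> frontier H" for y
        using that clH H(1) by (intro edge) (auto simp: frontier_def interior_open)
      have lapH: "\<exists>g. has_lap (\<lambda>x. p x - u x) y g 0" if y: "y \<in> H" for y
      proof -
        have "y \<in> spiked {1..k}" using in_spiked[of y] y by (auto simp: H_def)
        then obtain g where "has_lap u y g 0" using dirichlet_solution_has_lap[OF u open_spiked] by blast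
        from has_lap_diff[OF harm_poly_has_lap[OF p] this] show ?thesis by auto
      qed
      have xc: "x \<in> closure H" using True closure_subset by blast
      have "(p x - u x) - e / 3 \<le> 0"
      proof (rule maximum_principle[OF H _ _ _ xc])
        show "\<exists>g L. has_lap (\<lambda>x. p x - u x - e / 3) y g L \<and> 0 \<le> L" if "y \<in> H" for y
          using lapH[OF that] has_lap_diff[OF _ has_lap_const[of "e / 3"]] by fastforce
        show "p y - u y - e / 3 \<le> 0" if "y \<in> frontier H" for y using frH[OF that] by linarith
      qed (intro continuous_intros cpu)
      moreover have "- (p x - u x) - e / 3 \<le> 0"
      proof (rule maximum_principle[OF H _ _ _ xc])
        show "\<exists>g L. has_lap (\<lambda>x. - (p x - u x) - e / 3) y g L \<and> 0 \<le> L" if "y \<in> H" for y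
        proof -
          obtain g where "has_lap (\<lambda>x. p x - u x) y g 0" using lapH[OF \<open>y \<in> H\<close>] by blast
          from has_lap_diff[OF has_lap_uminus[OF this] has_lap_const[of "e / 3"]]
          show ?thesis by (intro exI conjI, assumption) simp
        qed
        show "- (p y - u y) - e / 3 \<le> 0" if "y \<in> frontier H" for y using frH[OF that] by linarith
      qed (intro continuous_intros cpu)
      ultimately show ?thesis by linarith
    qed
  qed
  have "\<bar>p x - \<psi> x\<bar> \<le> e" if x: "x \<in> cball 0 r" for x
  proof (cases "x $ l \<ge> 0")
    case True
    then show ?thesis using half[OF x True] \<open>e > 0\<close> by (simp add: \<psi>_def)
  next
    case False
    have "\<bar>p (rf x) - u (rf x)\<bar> \<le> e / 3" using False x norm_rf[of x] rf_nth[of x l] by (intro half) auto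
    moreover have "\<psi> x = - u (rf x)" using False by (simp add: \<psi>_def rf_def)
    ultimately show ?thesis using q_ball[OF x] unfolding q_def by linarith
  qed
  then show "\<exists>p. harm_poly p \<and> (\<forall>x\<in>cball 0 r. \<bar>p x - \<psi> x\<bar> \<le> e)" using p by blast
qed

lemma zero_in_frontier_spiked: "0 \<in> frontier (spiked M)"
proof -
  have "0 \<in> closure (spiked M)"
    by (rule closure_if_shift[of "1 / 2" _ l]) (auto intro: axis_point_in_spiked)
  then show ?thesis using spiked_pos[of 0 M] by (auto simp: frontier_spiked)
qed

lemma solution_zero:
  assumes "solves M u"
  shows "u 0 = 0"
  using assms zero_in_frontier_spiked by (simp add: dirichlet_solution_def boundary_data_def)

text \<open>Existence comes from differentiability of the odd extension at the origin. The lower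
  bound is not a limit of \<open>partial_deriv_lower_bound\<close>; it is read off from u(t e_l) >=
  3t/4.\<close>

lemma partial_deriv_at_zero:
  assumes u: "solves {1..k} u"
  shows "\<exists>d\<ge>3 / 4. has_partial_deriv_upto (spiked {1..k}) l u 0 d"
proof -
  define r :: real where "r = (1 / 4 ^ k) / 4"
  have r: "r > 0" by (simp add: r_def)
  define \<psi> where "\<psi> x = (if x $ l \<ge> 0 then u x else - u (reflect l 0 x))" for x
  obtain P where P: "hconv P \<psi> 0 r"
    using odd_extension_approx[OF u r_def] unfolding \<psi>_def[abs_def] by blast
  define d where "d = partial_deriv l \<psi> 0"
  have d: "((\<lambda>t. \<psi> (0 + t *\<^sub>R axis l 1)) has_real_derivative d) (at 0)"
    unfolding d_def using r by (intro hconv_partial_deriv(2)[OF P r]) auto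
  define T where "T = {t. 0 + t *\<^sub>R axis l 1 \<in> closure (spiked {1..k})}"
  have T_nonneg: "t \<ge> 0" if "t \<in> T" for t
    using closure_spiked_bounds(1)[of "0 + t *\<^sub>R axis l 1" "{1..k}"] that by (simp add: T_def axis_def)
  have T_pos: "t \<in> T" if "0 < t" "t \<le> 1 / 2" for t
    using axis_point_in_spiked[OF that] closure_subset by (auto simp: T_def)
  have zero: "0 \<in> closure (spiked {1..k})" using zero_in_frontier_spiked by (simp add: frontier_def)
  \<comment> \<open>Only t >= 0 occurs in \<open>T\<close>, and there \<psi> is \<open>u\<close>, so
    the two-sided derivative of \<psi> is the one-sided derivative of \<open>u\<close>.\<close>
  have "((\<lambda>t. u (0 + t *\<^sub>R axis l 1)) has_real_derivative d) (at 0 within T)"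
    by (rule has_field_derivative_transform_within[OF has_field_derivative_at_within[OF d] zero_less_one])
      (use zero T_nonneg in \<open>auto simp: \<psi>_def T_def\<close>)
  moreover have "0 islimpt T"
    unfolding islimpt_approachable
  proof (intro allI impI)
    fix e :: real assume "e > 0"
    then have "min (1 / 2) (e / 2) \<in> T" by (intro T_pos) auto
    then show "\<exists>t\<in>T. t \<noteq> 0 \<and> dist t 0 < e"
      using \<open>e > 0\<close> by (intro bexI[of _ "min (1 / 2) (e / 2)"]) (auto simp: min_def)
  qed
  ultimately have "has_partial_deriv_upto (spiked {1..k}) l u 0 d"
    using zero by (simp add: has_partial_deriv_upto_def Let_def T_def)
  moreover have "- d \<le> - (3 / 4)"
  proof (rule deriv_le_of_linear_bound)
    show "((\<lambda>t. - \<psi> (0 + t *\<^sub>R axis l 1)) has_real_derivative - d) (at 0 within {0<..})"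
      by (rule has_field_derivative_at_within[OF DERIV_minus[OF d]])
    show "- \<psi> (0 + 0 *\<^sub>R axis l 1) = 0" using solution_zero[OF u] by (simp add: \<psi>_def)
    show "- \<psi> (0 + t *\<^sub>R axis l 1) \<le> - (3 / 4) * t" if "0 < t" "t < 1 / 2" for t
      using solution_on_axis_lower_bound[OF u _ that(1)] that by (simp add: \<psi>_def axis_def)
  qed simp
  ultimately show ?thesis by (intro exI[of _ d]) auto
qed

lemma partial_deriv_on_K1:
  assumes u: "solves {1..k} u" and k: "k \<ge> 1" and y: "y \<in> K1 l"
  shows "\<exists>d. has_partial_deriv_upto (spiked {1..k}) l u y d \<and> d \<ge> 1 - (\<Sum>m=1..k. 1 / 4 ^ m)"
proof -
  define t where "t = y $ l"
  have "y $ i = 0" if "i \<noteq> l" for i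
    using y that by (auto simp: K1_def tangential_def vec_eq_iff dest: spec[of _ i])
  then have y_eq: "y = t *\<^sub>R axis l 1" by (simp add: vec_eq_iff axis_def t_def)
  have t: "0 \<le> t" "t \<le> 1 / 2" using y by (auto simp: K1_def t_def)
  show ?thesis
  proof (cases "t = 0")
    case True
    obtain d where d: "d \<ge> 3 / 4" "has_partial_deriv_upto (spiked {1..k}) l u 0 d"
      using partial_deriv_at_zero[OF u] by blast
    \<comment> \<open>3/4 suffices at the origin, since the term m = 1 alone already takes off
      1/4.\<close>
    have "1 / (4::real) ^ 1 \<le> (\<Sum>m=1..k. 1 / 4 ^ m)"
      using k by (intro member_le_sum) auto
    then have "d \<ge> 1 - (\<Sum>m=1..k. 1 / 4 ^ m)" using d(1) by simp
    then show ?thesis using d(2) y_eq True by auto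
  next
    case False
    then have t0: "0 < t" using t by simp
    have yD: "y \<in> spiked {1..k}" unfolding y_eq by (rule axis_point_in_spiked[OF t0 t(2)])
    have "((\<lambda>s. u (y + s *\<^sub>R axis l 1)) has_real_derivative partial_deriv l u y) (at 0)"
      using u yD unfolding dirichlet_solution_def C2_on_def C1_on_def partial_deriv_def
      by (auto simp: field_differentiable_derivI)
    moreover have "0 islimpt {s. y + s *\<^sub>R axis l 1 \<in> closure (spiked {1..k})}"
    proof -
      have "\<forall>\<^sub>F s in nhds (0::real). y + s *\<^sub>R axis l 1 \<in> spiked {1..k}"
        using tendsto_coord_line open_spiked yD by (rule topological_tendstoD)
      then obtain S where S: "open S" "0 \<in> S" "\<And>s::real. s \<in> S \<Longrightarrow> y + s *\<^sub>R axis l 1 \<in> spiked {1..k}"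
        unfolding eventually_nhds by blast
      have "0 islimpt S" using S by (metis interior_limit_point interior_open)
      moreover have "S \<subseteq> {s. y + s *\<^sub>R axis l 1 \<in> closure (spiked {1..k})}"
        using S(3) closure_subset by blast
      ultimately show ?thesis by (rule islimpt_subset)
    qed
    ultimately have "has_partial_deriv_upto (spiked {1..k}) l u y (partial_deriv l u y)"
      using yD closure_subset[of "spiked {1..k}"]
      by (auto simp: has_partial_deriv_upto_def Let_def intro: has_field_derivative_at_within)
    moreover have "1 - (\<Sum>m=1..k. 1 / 4 ^ m) \<le> partial_deriv l u y"
      unfolding y_eq by (rule partial_deriv_lower_bound[OF t0 t(2) u])
    ultimately show ?thesis by blast
  qed
qed

section \<open>Failure of differentiability in the limit domain\<close>

lemma tip_in_closure:
  assumes "m \<ge> 1"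
  shows "(1 / 4 ^ m) *\<^sub>R (axis f 1 + axis l 1) \<in> closure (spiked M)"
proof (rule closure_if_shift[of "1 / 2" _ l])
  fix s :: real assume s: "0 < s" "s < 1 / 2"
  define p where "p = (1 / 4 ^ m :: real)"
  have p: "0 < p" "p \<le> 1 / 4" using quarter_power_le[OF assms] by (auto simp: p_def)
  define x where "x = p *\<^sub>R (axis f 1 + axis l (1::real)) + s *\<^sub>R axis l 1"
  have xl: "x $ l = p + s" and xf: "x $ f = p" and xi: "\<And>i. i \<noteq> l \<Longrightarrow> i \<noteq> f \<Longrightarrow> x $ i = 0"
    using fl by (auto simp: x_def axis_def)
  have "x \<in> spiked M"
  proof (rule spikedI)
    have "-1 < x $ i \<and> x $ i < 1" for i
      using xl xf xi[of i] p s by (cases "i = l"; cases "i = f") auto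
    then show "x \<in> Q1_plus l" using xl p s by (auto simp: Q1_plus_def Q1_def upper_half_space_def)
    fix j
    show "x \<notin> spike j"
    proof (cases "j = m")
      case True
      show ?thesis
      proof
        assume "x \<in> spike j"
        from spike_bounds(1)[OF this] show False using True xl p s by (simp add: p_def)
      qed
    next
      case False
      define q where "q = (1 / 4 ^ j :: real)"
      \<comment> \<open>Distinct powers of 4 differ by a factor of at least 4, which puts the
        vertical line through the tip at least q/2 away from the axis of spike j.\<close>
      have "q \<le> p / 4 \<or> p \<le> q / 4"
      proof (cases "j < m")
        case True
        then have "(4::real) ^ Suc j \<le> 4 ^ m" by (intro power_increasing) auto
        then show ?thesis by (simp add: p_def q_def field_simps)
      next
        case False
        with \<open>j \<noteq> m\<close> have "(4::real) ^ Suc m \<le> 4 ^ j" by (intro power_increasing) auto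
        then show ?thesis by (simp add: p_def q_def field_simps)
      qed
      moreover have "q > 0" by (simp add: q_def)
      ultimately have "q / 2 \<le> \<bar>p - q\<bar>" using p(1) by linarith
      then show ?thesis using xl xf p s by (intro not_in_spike) (auto simp: q_def)
    qed
  qed
  then show "(1 / 4 ^ m) *\<^sub>R (axis f 1 + axis l 1) + s *\<^sub>R axis l 1 \<in> spiked M"
    by (simp add: x_def p_def)
qed simp

lemma tip_in_spike: "(1 / 4 ^ m) *\<^sub>R (axis f 1 + axis l 1) \<in> spike m"
proof -
  have "tangential l ((1 / 4 ^ m) *\<^sub>R (axis f 1 + axis l 1)) = tangential l (base m)"
    using fl by (auto simp: tangential_def vec_eq_iff base_def axis_def)
  then show ?thesis using fl by (simp add: mem_spike axis_def)
qed

lemma negative_axis_in_closure: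
  assumes "0 < t" "t < 1"
  shows "- t *\<^sub>R axis f 1 \<in> closure (spiked M)"
proof (rule closure_if_shift[of 1 _ l])
  fix s :: real assume s: "0 < s" "s < 1"
  show "- t *\<^sub>R axis f 1 + s *\<^sub>R axis l 1 \<in> spiked M"
  proof (rule spikedI)
    show "- t *\<^sub>R axis f 1 + s *\<^sub>R axis l 1 \<in> Q1_plus l"
      using fl assms s by (auto simp: Q1_plus_def Q1_def upper_half_space_def axis_def)
    fix m
    have "q / 2 \<le> \<bar>- t - q\<bar>" if "q > 0" for q :: real using that assms by linarith
    from this[of "1 / 4 ^ m"]
    show "- t *\<^sub>R axis f 1 + s *\<^sub>R axis l 1 \<notin> spike m"
      using fl s by (intro not_in_spike) (auto simp: axis_def)
  qed
qed simp

text \<open>With tolerance 1/8, a linear part would have slope at least 5/8 along e_l and at most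
  1/8 in absolute value along e_f. At the tip t (e_f + e_l) it would be at least t/2, whereas the
  value 0 there allows at most t/4.\<close>

lemma not_boundary_differentiable:
  assumes u: "solves {1..} u"
  shows "\<not> boundary_differentiable (spiked {1..}) u 0"
proof
  define \<Omega> where "\<Omega> = spiked {1..}"
  assume "boundary_differentiable (spiked {1..}) u 0"
  then obtain \<xi> where \<xi>: "(\<lambda>x. u x - (u 0 + \<xi> \<bullet> (x - 0))) \<in> o[at 0 within closure \<Omega>](\<lambda>x. norm (x - 0))"
    by (auto simp: boundary_differentiable_def \<Omega>_def)
  have "(1 / 8 :: real) > 0" by simp
  from landau_o.smallD[OF \<xi> this] have
    "\<forall>\<^sub>F x in at 0 within closure \<Omega>. \<bar>u x - \<xi> \<bullet> x\<bar> \<le> 1 / 8 * norm x"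
    using solution_zero[OF u] by simp
  then obtain \<delta> where \<delta>: "\<delta> > 0"
    "\<And>x. x \<in> closure \<Omega> \<Longrightarrow> x \<noteq> 0 \<Longrightarrow> norm x < \<delta> \<Longrightarrow> \<bar>u x - \<xi> \<bullet> x\<bar> \<le> 1 / 8 * norm x"
    unfolding eventually_at by auto
  \<comment> \<open>The bound \<delta>/2 serves the tip, whose norm is at most 2t; the bound 1/2
    excludes m = 0, which is not the index of a spike.\<close>
  obtain m where m: "(1 / 4 :: real) ^ m < min (\<delta> / 2) (1 / 2)"
    using real_arch_pow_inv[of "min (\<delta> / 2) (1 / 2)" "1 / 4"] \<delta>(1) by auto
  define t where "t = (1 / 4 ^ m :: real)"
  have t: "0 < t" "t < \<delta> / 2" "t < 1 / 2" using m by (auto simp: t_def power_divide)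
  have m1: "m \<ge> 1"
  proof (rule ccontr)
    assume "\<not> m \<ge> 1"
    then have "m = 0" by simp
    then show False using t(3) by (simp add: t_def)
  qed
  have axis_nonzero: "c *\<^sub>R axis i (1::real) \<noteq> 0" if "c \<noteq> 0" for c and i :: 'n
    using that by (simp add: axis_eq_0_iff)
  have "3 / 4 * t \<le> u (t *\<^sub>R axis l 1)"
    using solution_on_axis_lower_bound[OF u _ t(1)] t by auto
  moreover have "\<bar>u (t *\<^sub>R axis l 1) - \<xi> \<bullet> (t *\<^sub>R axis l 1)\<bar> \<le> 1 / 8 * norm (t *\<^sub>R axis l (1::real))"
    using axis_point_in_spiked[of t "{1..}"] closure_subset t axis_nonzero
    by (intro \<delta>(2)) (auto simp: \<Omega>_def)
  moreover have "\<xi> \<bullet> (t *\<^sub>R axis l 1) = t * \<xi> $ l" by (simp add: inner_axis)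
  moreover have "norm (t *\<^sub>R axis l (1::real)) = t" using t by simp
  ultimately have 1: "5 / 8 * t \<le> t * \<xi> $ l" by linarith
  \<comment> \<open>The slope along e_f is read off on the negative f-axis, because the spikes stand
    on the positive one.\<close>
  have "u (- t *\<^sub>R axis f 1) = 0"
  proof -
    have "(- t *\<^sub>R axis f (1::real)) $ l = 0" using fl by (simp add: axis_def)
    moreover from this have "- t *\<^sub>R axis f 1 \<notin> spiked {1..}" using spiked_pos[of "- t *\<^sub>R axis f 1" "{1..}"] by auto
    ultimately show ?thesis
      using u negative_axis_in_closure[of t "{1..}"] t
      by (simp add: dirichlet_solution_def frontier_spiked boundary_data_def)
  qed
  moreover have "\<bar>u (- t *\<^sub>R axis f 1) - \<xi> \<bullet> (- t *\<^sub>R axis f 1)\<bar> \<le> 1 / 8 * norm (- t *\<^sub>R axis f (1::real))"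
    using negative_axis_in_closure[of t "{1..}"] t axis_nonzero[of "- t" f]
    by (intro \<delta>(2)) (auto simp: \<Omega>_def)
  ultimately have 2: "\<bar>t * \<xi> $ f\<bar> \<le> 1 / 8 * t" using t by (simp add: inner_axis)
  define z where "z = t *\<^sub>R (axis f 1 + axis l (1::real))"
  have z_cl: "z \<in> closure (spiked {1..})" unfolding z_def t_def by (rule tip_in_closure[OF m1])
  have zl: "z $ l = t" using fl by (simp add: z_def axis_def)
  have "u z = 0"
  proof -
    have "z \<in> spike m" unfolding z_def t_def by (rule tip_in_spike)
    then have "z \<notin> spiked {1..}" using m1 by (auto simp: spiked_def)
    moreover have "z \<in> Q1_plus l"
      using fl t by (auto simp: Q1_plus_def Q1_def upper_half_space_def z_def axis_def)
    ultimately show ?thesis using u z_cl by (simp add: dirichlet_solution_def frontier_spiked boundary_data_def)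
  qed
  have "norm (axis f (1::real) + axis l 1) \<le> 2"
    using norm_triangle_ineq[of "axis f (1::real)" "axis l 1"] by simp
  then have nz: "norm z \<le> 2 * t" unfolding z_def using t by simp
  have "\<bar>u z - \<xi> \<bullet> z\<bar> \<le> 1 / 8 * norm z"
    using z_cl nz zl t by (intro \<delta>(2)) (auto simp: \<Omega>_def)
  then have "\<bar>\<xi> \<bullet> z\<bar> \<le> 1 / 4 * t" using nz \<open>u z = 0\<close> by simp
  moreover have "\<xi> \<bullet> z = t * \<xi> $ f + t * \<xi> $ l" by (simp add: z_def inner_add_right inner_axis algebra_simps)
  ultimately show False using 1 2 t by linarith
qed

end

theorem theorem2:
  fixes f l :: "'n::finite"
  assumes "CARD('n) \<ge> 4" and "f \<noteq> l"
  shows "\<exists>\<theta> :: nat \<Rightarrow> real.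
    (\<forall>m\<ge>1. \<theta> m > 0) \<and>
    (\<forall>k\<ge>1. \<exists>u.
       let D = Q1_plus l - (\<Union>m\<in>{1..k}. V l ((1 / 4 ^ m) *\<^sub>R axis f 1) (\<theta> m)) in
       the_dirichlet_solution D (boundary_data l) u \<and>
       (\<forall>y\<in>K1 l. \<exists>d. has_partial_deriv_upto D l u y d \<and>
          d \<ge> 1 - (\<Sum>m=1..k. 1 / 4 ^ m))) \<and>
    (\<exists>u.
       let \<Omega> = Q1_plus l - (\<Union>m\<in>{1..}. V l ((1 / 4 ^ m) *\<^sub>R axis f 1) (\<theta> m)) in
       the_dirichlet_solution \<Omega> (boundary_data l) u \<and>
       0 \<in> frontier \<Omega> \<and> \<not> boundary_differentiable \<Omega> u 0)"
proof -
  interpret spiked_cube f l by unfold_locales (fact assms)+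
  have spiked: "Q1_plus l - (\<Union>m\<in>M. V l ((1 / 4 ^ m) *\<^sub>R axis f 1) (\<theta> m)) = spiked M" for M
    by (simp add: spiked_def spike_def base_def)
  have "\<exists>u. the_dirichlet_solution (spiked {1..k}) (boundary_data l) u \<and>
       (\<forall>y\<in>K1 l. \<exists>d. has_partial_deriv_upto (spiked {1..k}) l u y d \<and> d \<ge> 1 - (\<Sum>m=1..k. 1 / 4 ^ m))"
    if k: "k \<ge> 1" for k
  proof -
    obtain u where u: "the_dirichlet_solution (spiked {1..k}) (boundary_data l) u"
      using solution_exists[of "{1..k}"] by auto
    then have "solves {1..k} u"
      by (simp add: the_dirichlet_solution_def)
    from partial_deriv_on_K1[OF this k] u show ?thesis by blast
  qed
  moreover have "\<exists>u. the_dirichlet_solution (spiked {1..}) (boundary_data l) u \<and>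
       0 \<in> frontier (spiked {1..}) \<and> \<not> boundary_differentiable (spiked {1..}) u 0"
  proof -
    obtain u where u: "the_dirichlet_solution (spiked {1..}) (boundary_data l) u"
      using solution_exists[of "{1..}"] by auto
    then have "solves {1..} u"
      by (simp add: the_dirichlet_solution_def)
    from not_boundary_differentiable[OF this] u zero_in_frontier_spiked show ?thesis by blast
  qed
  ultimately show ?thesis
    by (intro exI[of _ \<theta>]) (simp only: spiked Let_def theta_pos, blast)
qed

end
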